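(* Assume the exact $\gamma$-law $P=\mathsf A\rho^\gamma$ with $\frac65<\gamma<2$, and consider small constant angular velocities $\Omega$. Suppose $\gamma\ne\frac43$. Then the central density $\rho_{\mathsf O}$ is uniquely determined by the total mass $M$ for each given angular velocity $\Omega$, provided that $\beta=\frac{\Omega^2}{2\pi\mathsf G\rho_{\mathsf O}}$ is sufficiently small. That is, there is $\beta_0>0$ such that for each $\Omega$, if $\rho_{\mathsf O},\rho_{\mathsf O}'>0$ satisfy $\frac{\Omega^2}{2\pi\mathsf G\rho_{\mathsf O}}\le\beta_0$, $\frac{\Omega^2}{2\pi\mathsf G\rho_{\mathsf O}'}\le\beta_0$ and the configurations with central densities $\rho_{\mathsf O},\rho'_{\mathsf O}$ and angular velocity $\Omega$ have the same total mass, then $\rho_{\mathsf O}=\rho_{\mathsf O}'$.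
   Context: Constants: $\mathsf A,\mathsf G>0$; $\nu=1/(\gamma-1)\in(1,5)$; $a\vee b=\max(a,b)$. Lane–Emden function: $\theta(r;\nu)$ solves $-\frac1{r^2}\frac{d}{dr}(r^2\frac{d\theta}{dr})=\theta^\nu$, $\theta=1+O(r^2)$ as $r\to+0$; it is positive on $[0,\xi_1)$ and vanishes at a finite $\xi_1=\xi_1(\nu)$; for $r\ge\xi_1$ put $\theta=-\mu_1(\frac1{\xi_1}-\frac1r)$, $\mu_1=\int_0^{\xi_1}\theta^\nu r^2dr$. Fix $r_\infty>\xi_1$. Let $\mathfrak E$ be the Banach space (sup norm) of continuous functions $u(r,\zeta)$ on $[0,r_\infty]\times[-1,1]$ with $u(0,\zeta)=u(0,0)$, $u(r,-\zeta)=u(r,\zeta)$. For $f\in\mathfrak E$ let $\mathcal Kf$ be the Newtonian potential: $\mathcal Kf(r,\zeta)=\frac1{4\pi}\int_{|x'|\le r_\infty}\frac{f^\flat(x')}{|x-x'|}dx'$ where $r=|x|$, $\zeta=x_3/|x|$ and $f^\flat(x)=f(|x|,x_3/|x|)$. Let $\mathcal G(u)=1+\mathcal K((u\vee0)^\nu)-\mathcal K((u\vee0)^\nu)(0,0)$. Distorted Lane–Emden function: for all sufficiently small $\beta\ge0$, $\Theta(\cdot,\cdot;\nu,\beta)\in\mathfrak E$ is the unique solution near $\theta$ in $\mathfrak E$ of $\Theta=\frac\beta4r^2(1-\zeta^2)+\mathcal G(\Theta)$; it depends continuously on $\beta$, $\Theta(\cdot;\nu,0)=\theta$, and there is a continuous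 curve $r=\Xi_1(\zeta;\nu,\beta)<r_\infty$ such that for $0\le r\le r_\infty$, $\Theta(r,\zeta)>0\Leftrightarrow r<\Xi_1(\zeta)$. The function $\Theta\vee0$ is extended by $0$ to $r>r_\infty$. The configuration with central density $\rho_{\mathsf O}>0$ and constant angular velocity $\Omega$ has density $$\rho=\rho_{\mathsf O}\big(\Theta(r/\mathsf a,\zeta;\nu,\beta)\vee0\big)^\nu,\quad \mathsf a=\sqrt{\tfrac{\mathsf A\gamma}{4\pi\mathsf G(\gamma-1)}}\,\rho_{\mathsf O}^{-\frac{2-\gamma}2},\quad \beta=\frac{\Omega^2}{2\pi\mathsf G\rho_{\mathsf O}},$$ and total mass $M=2\pi\int_{-1}^1\int_0^\infty\rho(r,\zeta)r^2drd\zeta$. *)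

theory Defs
  imports "HOL-Analysis.Analysis" "HOL-Library.Landau_Symbols"
begin

text \<open>
  \<open>lane_emden \<nu> \<theta> \<xi>\<close>: \<open>\<theta>\<close> is the Lane--Emden function of index \<open>\<nu>\<close>, with first zero \<open>\<xi>\<close>,
  continued harmonically beyond \<open>\<xi>\<close>.
\<close>

definition lane_emden :: "real \<Rightarrow> (real \<Rightarrow> real) \<Rightarrow> real \<Rightarrow> bool" where
  "lane_emden \<nu> \<theta> \<xi> \<longleftrightarrow>
     0 < \<xi> \<and>
     continuous_on {0..\<xi>} \<theta> \<and>
     \<theta> 0 = 1 \<and>
     (\<lambda>r. \<theta> r - 1) \<in> O[at_right 0](\<lambda>r. r\<^sup>2) \<and>
     (\<forall>r\<in>{0<..<\<xi>}. \<theta> differentiable (at r) \<and>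
        (\<lambda>s. s\<^sup>2 * deriv \<theta> s) differentiable (at r) \<and>
        - (1 / r\<^sup>2) * deriv (\<lambda>s. s\<^sup>2 * deriv \<theta> s) r = \<theta> r powr \<nu>) \<and>
     (\<forall>r\<in>{0..<\<xi>}. 0 < \<theta> r) \<and>
     \<theta> \<xi> = 0 \<and>
     (\<forall>r\<ge>\<xi>. \<theta> r = - (LINT s:{0..\<xi>}|lborel. \<theta> s powr \<nu> * s\<^sup>2) * (1 / \<xi> - 1 / r))"

text \<open>
  Elements of the Banach space are represented by total functions \<open>u r \<zeta>\<close>, of which only the values
  on \<open>dom_E R\<close> matter; accordingly, equality in the space is equality on \<open>dom_E R\<close>.
\<close>

definition dom_E :: "real \<Rightarrow> (real \<times> real) set" where
  "dom_E R = {0..R} \<times> {-1..1}"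

definition space_E :: "real \<Rightarrow> (real \<Rightarrow> real \<Rightarrow> real) set" where
  "space_E R = {u. continuous_on (dom_E R) (\<lambda>(r, \<zeta>). u r \<zeta>) \<and>
     (\<forall>\<zeta>\<in>{-1..1}. u 0 \<zeta> = u 0 0) \<and>
     (\<forall>(r, \<zeta>)\<in>dom_E R. u r (- \<zeta>) = u r \<zeta>)}"

definition norm_E :: "real \<Rightarrow> (real \<Rightarrow> real \<Rightarrow> real) \<Rightarrow> real" where
  "norm_E R u = (SUP (r, \<zeta>)\<in>dom_E R. \<bar>u r \<zeta>\<bar>)"

definition dist_E :: "real \<Rightarrow> (real \<Rightarrow> real \<Rightarrow> real) \<Rightarrow> (real \<Rightarrow> real \<Rightarrow> real) \<Rightarrow> real" where
  "dist_E R u v = norm_E R (\<lambda>r \<zeta>. u r \<zeta> - v r \<zeta>)"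

definition flat :: "(real \<Rightarrow> real \<Rightarrow> real) \<Rightarrow> real^3 \<Rightarrow> real" where
  "flat f x = f (norm x) (x $ 3 / norm x)"

definition newton_pot :: "real \<Rightarrow> (real \<Rightarrow> real \<Rightarrow> real) \<Rightarrow> real^3 \<Rightarrow> real" where
  "newton_pot R f x = 1 / (4 * pi) * (LINT y:cball 0 R|lborel. flat f y / norm (x - y))"

text \<open>
  As \<open>flat f\<close> is invariant under rotations about the third axis, so is its potential;
  \<open>op_K\<close> evaluates it at the representative of \<open>(r, \<zeta>)\<close> with vanishing second coordinate.
\<close>

definition op_K :: "real \<Rightarrow> (real \<Rightarrow> real \<Rightarrow> real) \<Rightarrow> real \<Rightarrow> real \<Rightarrow> real" where
  "op_K R f r \<zeta> = newton_pot R f (vector [r * sqrt (1 - \<zeta>\<^sup>2), 0, r * \<zeta>])"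

definition op_G :: "real \<Rightarrow> real \<Rightarrow> (real \<Rightarrow> real \<Rightarrow> real) \<Rightarrow> real \<Rightarrow> real \<Rightarrow> real" where
  "op_G R \<nu> u r \<zeta> =
     1 + op_K R (\<lambda>s \<eta>. max (u s \<eta>) 0 powr \<nu>) r \<zeta> - op_K R (\<lambda>s \<eta>. max (u s \<eta>) 0 powr \<nu>) 0 0"

definition solves_distorted :: "real \<Rightarrow> real \<Rightarrow> real \<Rightarrow> (real \<Rightarrow> real \<Rightarrow> real) \<Rightarrow> bool" where
  "solves_distorted R \<nu> \<beta> u \<longleftrightarrow>
     u \<in> space_E R \<and>
     (\<forall>(r, \<zeta>)\<in>dom_E R. u r \<zeta> = \<beta> / 4 * r\<^sup>2 * (1 - \<zeta>\<^sup>2) + op_G R \<nu> u r \<zeta>)"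

text \<open>
  \<open>distorted_lane_emden R \<nu> \<theta> \<beta>\<^sub>1 \<Theta>\<close>: for each \<open>\<beta> \<in> [0, \<beta>\<^sub>1]\<close>, \<open>\<Theta> \<beta>\<close> is the unique solution in a
  ball around \<open>\<theta>\<close> whose radius does not depend on \<open>\<beta>\<close>, and \<open>\<beta> \<mapsto> \<Theta> \<beta>\<close> is continuous and starts
  at \<open>\<theta>\<close>. The values of \<open>\<Theta>\<close> for other \<open>\<beta>\<close> are irrelevant.
\<close>

definition distorted_lane_emden ::
    "real \<Rightarrow> real \<Rightarrow> (real \<Rightarrow> real) \<Rightarrow> real \<Rightarrow> (real \<Rightarrow> real \<Rightarrow> real \<Rightarrow> real) \<Rightarrow> bool" where
  "distorted_lane_emden R \<nu> \<theta> \<beta>\<^sub>1 \<Theta> \<longleftrightarrow>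
     0 < \<beta>\<^sub>1 \<and>
     (\<exists>\<delta>>0. \<forall>\<beta>\<in>{0..\<beta>\<^sub>1}.
        solves_distorted R \<nu> \<beta> (\<Theta> \<beta>) \<and> dist_E R (\<Theta> \<beta>) (\<lambda>r \<zeta>. \<theta> r) < \<delta> \<and>
        (\<forall>u. solves_distorted R \<nu> \<beta> u \<and> dist_E R u (\<lambda>r \<zeta>. \<theta> r) < \<delta> \<longrightarrow>
             (\<forall>(r, \<zeta>)\<in>dom_E R. u r \<zeta> = \<Theta> \<beta> r \<zeta>))) \<and>
     (\<forall>\<beta>\<in>{0..\<beta>\<^sub>1}. ((\<lambda>\<beta>'. dist_E R (\<Theta> \<beta>') (\<Theta> \<beta>)) \<longlongrightarrow> 0) (at \<beta> within {0..\<beta>\<^sub>1})) \<and>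
     (\<forall>(r, \<zeta>)\<in>dom_E R. \<Theta> 0 r \<zeta> = \<theta> r)"

definition pos_part_ext :: "real \<Rightarrow> (real \<Rightarrow> real \<Rightarrow> real) \<Rightarrow> real \<Rightarrow> real \<Rightarrow> real" where
  "pos_part_ext R u r \<zeta> = (if r \<le> R then max (u r \<zeta>) 0 else 0)"

definition length_scale :: "real \<Rightarrow> real \<Rightarrow> real \<Rightarrow> real \<Rightarrow> real" where
  "length_scale A G \<gamma> \<rho>\<^sub>O = sqrt (A * \<gamma> / (4 * pi * G * (\<gamma> - 1))) * \<rho>\<^sub>O powr (- (2 - \<gamma>) / 2)"

definition rot_param :: "real \<Rightarrow> real \<Rightarrow> real \<Rightarrow> real" where
  "rot_param G \<Omega> \<rho>\<^sub>O = \<Omega>\<^sup>2 / (2 * pi * G * \<rho>\<^sub>O)"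

definition density ::
    "real \<Rightarrow> (real \<Rightarrow> real \<Rightarrow> real \<Rightarrow> real) \<Rightarrow> real \<Rightarrow> real \<Rightarrow> real \<Rightarrow> real \<Rightarrow> real \<Rightarrow> real \<Rightarrow> real \<Rightarrow> real" where
  "density R \<Theta> A G \<gamma> \<Omega> \<rho>\<^sub>O r \<zeta> =
     \<rho>\<^sub>O * pos_part_ext R (\<Theta> (rot_param G \<Omega> \<rho>\<^sub>O)) (r / length_scale A G \<gamma> \<rho>\<^sub>O) \<zeta> powr (1 / (\<gamma> - 1))"

definition total_mass ::
    "real \<Rightarrow> (real \<Rightarrow> real \<Rightarrow> real \<Rightarrow> real) \<Rightarrow> real \<Rightarrow> real \<Rightarrow> real \<Rightarrow> real \<Rightarrow> real \<Rightarrow> real" where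
  "total_mass R \<Theta> A G \<gamma> \<Omega> \<rho>\<^sub>O =
     2 * pi * (LINT \<zeta>:{-1..1}|lborel. (LINT r:{0..}|lborel. density R \<Theta> A G \<gamma> \<Omega> \<rho>\<^sub>O r \<zeta> * r\<^sup>2))"

end

theory Submission
  imports Defs
begin

text \<open>
  Rescaling \<open>r\<close> by the length scale gives \<open>M = c \<rho>\<^sup>k m(\<beta>)\<close> with \<open>k = (3\<gamma> - 4) / 2 \<noteq> 0\<close> and
  \<open>m(\<beta>) = \<integral>\<integral> (\<Theta>\<^sub>\<beta> \<or> 0)\<^sup>\<nu> r\<^sup>2\<close> (\<open>total_mass_scaling\<close>). For fixed \<open>\<Omega>\<close> the product \<open>\<beta> \<rho>\<close> is constant, so
  changing \<open>ln \<rho>\<close> by \<open>t\<close> changes \<open>\<beta>\<close> by at most \<open>\<beta>\<^sub>0 t\<close>. If \<open>m\<close> is Lipschitz continuous near \<open>0\<close>, then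
  \<open>ln m\<close> changes by at most \<open>C \<beta>\<^sub>0 t\<close>, because \<open>m(0) > 0\<close>, and for small \<open>\<beta>\<^sub>0\<close> this cannot compensate the
  change \<open>k t\<close> of the other factor (\<open>mass_density_injective\<close>).

  What has to be shown is the Lipschitz continuity (\<open>lipschitz_solutions\<close>). Let \<open>\<theta> = \<Theta>\<^sub>0\<close> and
  \<open>q = \<nu> (\<theta> \<or> 0)\<^sup>\<nu>\<^sup>-\<^sup>1\<close>. The difference \<open>w\<close> of two solutions close to \<open>\<theta>\<close> satisfies
  \<open>w = b/4 r\<^sup>2 (1 - \<zeta>\<^sup>2) + K(q w + e) - K(q w + e)(0)\<close>, where \<open>b\<close> is the difference of the rotation
  parameters and \<open>e\<close> is small compared with \<open>w\<close>. The point is therefore a bound on \<open>w\<close> by \<open>b\<close> and \<open>e\<close>,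
  that is, a bounded inverse of the linearization at \<open>\<theta>\<close> (\<open>a_priori_estimate\<close>). It is obtained from
  two contraction arguments, without an expansion into spherical harmonics.

  Oscillation over spheres (\<open>oscillation_estimate\<close>). Without the symmetry in \<open>\<zeta>\<close> the translation mode
  \<open>\<theta>'(r) \<zeta>\<close> would lie in the kernel of the linearization, so evenness of \<open>w\<close> must enter. For an even
  density \<open>1 / |x - y|\<close> may be averaged over \<open>y\<close> and \<open>-y\<close>, and the average is at least
  \<open>1 / \<surd>(|x|\<^sup>2 + |y|\<^sup>2)\<close>. This lower bound depends on radii only and may be subtracted when values of
  the potential on one sphere are compared. By the shell theorem the remaining nonnegative kernel,
  divided by \<open>4 \<pi>\<close> and integrated over the sphere \<open>|y| = s\<close>, is \<open>s\<^sup>2 (1 / max r s - 1 / \<surd>(r\<^sup>2 + s\<^sup>2))\<close>, which is at most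
  \<open>9/10\<close> of \<open>s\<^sup>2 min r s / (3 (max r s)\<^sup>2)\<close>. The latter is the kernel of the first spherical harmonics,
  and differentiating the equation of \<open>\<theta>\<close> shows that it maps \<open>q p\<close> to at most \<open>p\<close>, where
  \<open>p = - \<theta>' > 0\<close>. Hence the oscillation of \<open>w\<close>, measured relative to \<open>p\<close>, is contracted by the factor
  \<open>9/10\<close>.

  Radial part. Up to an error controlled by the oscillation, \<open>w\<close> is radial, and for a radial density
  the shell theorem turns \<open>K f - K f(0)\<close> into a Volterra operator, which is a contraction in a norm
  with exponential weight.
\<close>

section \<open>Newton's shell theorem\<close>

text \<open>
  The measure-theoretic density has to be told apart from the mass density of a configuration.
\<close>

abbreviation with_density :: "'a measure \<Rightarrow> ('a \<Rightarrow> ennreal) \<Rightarrow> 'a measure" where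
  "with_density \<equiv> Nonnegative_Lebesgue_Integration.density"

definition of_triple :: "(real \<times> real) \<times> real \<Rightarrow> real^3" where
  "of_triple = (\<lambda>(\<eta>, z). fst \<eta> *\<^sub>R axis 1 1 + snd \<eta> *\<^sub>R axis 2 1 + z *\<^sub>R axis 3 1)"

lemma of_triple_nth:
  "of_triple (\<eta>, z) $ 1 = fst \<eta>" "of_triple (\<eta>, z) $ 2 = snd \<eta>" "of_triple (\<eta>, z) $ 3 = z"
  by (simp_all add: of_triple_def axis_def)

lemma measurable_of_triple [measurable]: "of_triple \<in> borel_measurable borel"
  unfolding of_triple_def split_def
  by (intro borel_measurable_continuous_onI continuous_intros)

lemma norm_real3: "norm (x :: real^3) = sqrt ((x$1)\<^sup>2 + (x$2)\<^sup>2 + (x$3)\<^sup>2)"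
  by (simp add: norm_vec_def L2_set_def sum_3)

lemma norm_of_triple: "norm (of_triple (\<eta>, z)) = sqrt ((norm \<eta>)\<^sup>2 + z\<^sup>2)"
  by (simp add: norm_real3 of_triple_nth norm_prod_def)

text \<open>
  Transports Fubini's theorem from products to \<open>\<real>\<^sup>3\<close>; the pairing separates the coordinates of a
  horizontal plane from the height.
\<close>

lemma lborel_real3: "lborel = distr lborel borel of_triple"
proof (rule lborel_eqI)
  fix l u :: "real^3"
  assume le: "\<And>b. b \<in> Basis \<Longrightarrow> l \<bullet> b \<le> u \<bullet> b"
  have le': "l $ i \<le> u $ i" for i
    using le[of "axis i 1"] by (simp add: inner_axis)
  have eq: "of_triple -` box l u = (box (l$1) (u$1) \<times> box (l$2) (u$2)) \<times> box (l$3) (u$3)"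
    by (auto simp: mem_box_cart forall_3 of_triple_nth box_real)
  have "emeasure (distr lborel borel of_triple) (box l u) = emeasure lborel (of_triple -` box l u)"
    by (subst emeasure_distr) auto
  also have "\<dots> = emeasure ((lborel \<Otimes>\<^sub>M lborel) \<Otimes>\<^sub>M lborel)
                 ((box (l$1) (u$1) \<times> box (l$2) (u$2)) \<times> box (l$3) (u$3))"
    by (simp only: lborel_prod eq)
  also have "\<dots> = ennreal ((u$1 - l$1) * (u$2 - l$2) * (u$3 - l$3))"
  proof -
    have e: "emeasure lborel (box (l $ i) (u $ i)) = ennreal (u $ i - l $ i)" for i
      using le'[of i] by (simp add: box_real)
    have nn: "0 \<le> u $ i - l $ i" for i
      using le'[of i] by simp
    have b: "box (l $ i) (u $ i) \<in> sets lborel" for i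
      by simp
    have "emeasure (lborel \<Otimes>\<^sub>M lborel) (box (l$1) (u$1) \<times> box (l$2) (u$2)) =
        ennreal ((u$1 - l$1) * (u$2 - l$2))"
      unfolding lborel.emeasure_pair_measure_Times[OF b b] e by (rule ennreal_mult[OF nn nn, symmetric])
    then show ?thesis
      unfolding lborel.emeasure_pair_measure_Times[OF pair_measureI[OF b b] b] e
      using ennreal_mult[OF mult_nonneg_nonneg[OF nn nn] nn] by metis
  qed
  also have "(u$1 - l$1) * (u$2 - l$2) * (u$3 - l$3) = (\<Prod>b\<in>Basis. (u - l) \<bullet> b)"
  proof -
    have B: "(Basis :: (real^3) set) = (\<lambda>i. axis i 1) ` UNIV"
      by (auto simp: Basis_vec_def)
    have inj: "inj (\<lambda>i::3. axis i (1::real))"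
      by (auto simp: inj_on_def axis_eq_axis)
    have "(\<Prod>b\<in>Basis. (u - l) \<bullet> b) = (\<Prod>i\<in>{1,2,3}. (u - l) $ i)"
      unfolding B prod.reindex[OF inj] unfolding UNIV_3 by (simp only: o_def inner_axis inner_real_def mult_1_right)
    then show ?thesis
      by simp
  qed
  finally show "emeasure (distr lborel borel of_triple) (box l u) = (\<Prod>b\<in>Basis. (u - l) \<bullet> b)" .
qed simp

lemma emeasure_disk:
  assumes "0 \<le> s"
  shows "emeasure lborel (cball (0 :: real \<times> real) s) = ennreal (pi * s\<^sup>2)"
  using assms by (simp add: emeasure_cball unit_ball_vol_2 power2_eq_square)

text \<open>
  On the plane at height \<open>z\<close>, the points at distance at most \<open>s\<close> from the origin of space form a disk of
  area \<open>\<pi> (s\<^sup>2 - z\<^sup>2)\<close>; differentiating in \<open>s\<close> gives a density in which \<open>z\<close> only restricts the range.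
  This is Archimedes' observation that zones of a sphere have area proportional to their height.
\<close>

lemma distr_slice:
  "distr (lborel :: (real \<times> real) measure) borel (\<lambda>\<eta>. sqrt ((norm \<eta>)\<^sup>2 + z\<^sup>2)) =
     with_density lborel (\<lambda>s. ennreal (2 * pi * s) * indicator {\<bar>z\<bar>..} s)"
    (is "?M = ?N")
proof (rule measure_eqI_generator_eq[where E = "range atMost" and \<Omega> = UNIV and A = "\<lambda>n. {..real n}"])
  show "Int_stable (range (atMost :: real \<Rightarrow> real set))"
    by (auto simp: Int_stable_def)
  have *: "sets borel = sigma_sets UNIV (range (atMost :: real \<Rightarrow> real set))"
    by (simp add: borel_eq_atMost)
  show "sets ?M = sigma_sets UNIV (range atMost)" "sets ?N = sigma_sets UNIV (range atMost)"
    using * by simp_all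
  have M: "emeasure ?M {..a} = ennreal (if \<bar>z\<bar> \<le> a then pi * (a\<^sup>2 - z\<^sup>2) else 0)" for a
  proof -
    have "emeasure ?M {..a} = emeasure lborel {\<eta> :: real \<times> real. sqrt ((norm \<eta>)\<^sup>2 + z\<^sup>2) \<le> a}"
      by (subst emeasure_distr) (auto simp: vimage_def)
    also have "\<dots> = ennreal (if \<bar>z\<bar> \<le> a then pi * (a\<^sup>2 - z\<^sup>2) else 0)"
    proof (cases "\<bar>z\<bar> \<le> a")
      case True
      have nn: "0 \<le> a\<^sup>2 - z\<^sup>2"
        using True by (simp add: abs_le_square_iff[symmetric])
      have "sqrt ((norm \<eta>)\<^sup>2 + z\<^sup>2) \<le> a \<longleftrightarrow> norm \<eta> \<le> sqrt (a\<^sup>2 - z\<^sup>2)" for \<eta> :: "real \<times> real"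
      proof -
        have "sqrt ((norm \<eta>)\<^sup>2 + z\<^sup>2) \<le> a \<longleftrightarrow> (norm \<eta>)\<^sup>2 + z\<^sup>2 \<le> a\<^sup>2"
          using True real_le_lsqrt real_sqrt_le_iff[of "(norm \<eta>)\<^sup>2 + z\<^sup>2" "a\<^sup>2"]
          by (metis abs_ge_zero order_trans real_sqrt_abs abs_of_nonneg)
        also have "\<dots> \<longleftrightarrow> (norm \<eta>)\<^sup>2 \<le> a\<^sup>2 - z\<^sup>2"
          by auto
        also have "\<dots> \<longleftrightarrow> norm \<eta> \<le> sqrt (a\<^sup>2 - z\<^sup>2)"
          using nn by (metis norm_ge_zero real_le_rsqrt real_sqrt_le_iff real_sqrt_abs abs_norm_cancel)
        finally show ?thesis .
      qed
      then have "{\<eta> :: real \<times> real. sqrt ((norm \<eta>)\<^sup>2 + z\<^sup>2) \<le> a} = cball 0 (sqrt (a\<^sup>2 - z\<^sup>2))"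
        by auto
      then show ?thesis
        using True nn by (simp add: emeasure_disk)
    next
      case False
      have "\<bar>z\<bar> \<le> sqrt ((norm \<eta>)\<^sup>2 + z\<^sup>2)" for \<eta> :: "real \<times> real"
        by (metis real_sqrt_abs real_sqrt_le_iff le_add_same_cancel2 zero_le_power2)
      then have empty: "{\<eta> :: real \<times> real. sqrt ((norm \<eta>)\<^sup>2 + z\<^sup>2) \<le> a} = {}"
        using False by (auto simp: not_le intro: order_less_le_trans)
      show ?thesis unfolding empty using False by (simp only: emeasure_empty if_False ennreal_0)
    qed
    finally show ?thesis .
  qed
  have N: "emeasure ?N {..a} = ennreal (if \<bar>z\<bar> \<le> a then pi * (a\<^sup>2 - z\<^sup>2) else 0)" for a
  proof (cases "\<bar>z\<bar> \<le> a")
    case True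
    have "emeasure ?N {..a} = (\<integral>\<^sup>+ s. ennreal (2 * pi * s) * indicator {\<bar>z\<bar>..a} s \<partial>lborel)"
      by (subst emeasure_density) (auto intro!: nn_integral_cong split: split_indicator)
    also have "\<dots> = ennreal (pi * a\<^sup>2 - pi * \<bar>z\<bar>\<^sup>2)"
      by (rule nn_integral_FTC_Icc)
         (use True in \<open>auto intro!: derivative_eq_intros\<close>)
    finally show ?thesis using True by (simp add: right_diff_distrib)
  next
    case False
    have zero: "ennreal (2 * pi * s) * indicator {\<bar>z\<bar>..} s * indicator {..a} s = 0" for s
      using False by (auto split: split_indicator)
    have "emeasure ?N {..a} = 0"
      by (subst emeasure_density) (simp_all add: zero)
    then show ?thesis using False by simp
  qed
  show "emeasure ?M X = emeasure ?N X" if "X \<in> range atMost" for X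
    using that M N by auto
  show "emeasure ?M {..real i} \<noteq> \<infinity>" for i
    using M by simp
  show "(\<Union>i. {..real i}) = UNIV"
    by (auto simp: real_arch_simple)
qed auto

lemma nn_integral_axial:
  fixes g :: "real \<times> real \<Rightarrow> ennreal"
  assumes [measurable]: "g \<in> borel_measurable borel"
  shows "(\<integral>\<^sup>+ y. g (norm y, (y :: real^3) $ 3) \<partial>lborel) =
         (\<integral>\<^sup>+ s. ennreal (2 * pi * s) * (\<integral>\<^sup>+ z. indicator {-s..s} z * g (s, z) \<partial>lborel) \<partial>lborel)"
proof -
  have [measurable]: "(\<lambda>y::real^3. y $ 3) \<in> borel_measurable borel"
    by (intro borel_measurable_continuous_onI continuous_intros)
  have [measurable]: "(\<lambda>z. g (f z, h z)) \<in> borel_measurable M"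
    if "f \<in> borel_measurable M" "h \<in> borel_measurable M" for f h and M :: "'a measure"
    using that measurable_compose[OF borel_measurable_Pair[OF that] assms] by simp
  have [measurable]: "Measurable.pred (borel \<Otimes>\<^sub>M borel) (\<lambda>x :: real \<times> real. snd x \<in> {- fst x..fst x})"
    unfolding atLeastAtMost_iff by measurable
  have [measurable]: "(\<lambda>x. g (fst x, snd x)) \<in> borel_measurable (lborel \<Otimes>\<^sub>M lborel)"
    using assms by (simp add: lborel_prod)
  have "(\<integral>\<^sup>+ y. g (norm y, (y :: real^3) $ 3) \<partial>lborel) =
        (\<integral>\<^sup>+ x. g (norm (of_triple x), of_triple x $ 3) \<partial>lborel)"
    by (subst lborel_real3, subst nn_integral_distr) auto
  also have "\<dots> = (\<integral>\<^sup>+ x. (case x of (\<eta> :: real \<times> real, z) \<Rightarrow> g (sqrt ((norm \<eta>)\<^sup>2 + z\<^sup>2), z)) \<partial>(lborel \<Otimes>\<^sub>M lborel))"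
    unfolding lborel_prod
  proof (rule nn_integral_cong)
    fix x :: "(real \<times> real) \<times> real"
    obtain \<eta> z where x: "x = (\<eta>, z)" by (cases x)
    show "g (norm (of_triple x), of_triple x $ 3) = (case x of (\<eta>, z) \<Rightarrow> g (sqrt ((norm \<eta>)\<^sup>2 + z\<^sup>2), z))"
      unfolding x norm_of_triple of_triple_nth by simp
  qed
  also have "\<dots> = (\<integral>\<^sup>+ z. \<integral>\<^sup>+ \<eta>. g (sqrt ((norm \<eta>)\<^sup>2 + z\<^sup>2), z) \<partial>(lborel :: (real \<times> real) measure) \<partial>lborel)"
    by (subst lborel_pair.nn_integral_snd[symmetric]) auto
  also have "\<dots> = (\<integral>\<^sup>+ z. \<integral>\<^sup>+ s. g (s, z) \<partial>with_density lborel (\<lambda>s. ennreal (2 * pi * s) * indicator {\<bar>z\<bar>..} s) \<partial>lborel)"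
    by (subst distr_slice[symmetric], subst nn_integral_distr) auto
  also have "\<dots> = (\<integral>\<^sup>+ z. \<integral>\<^sup>+ s. ennreal (2 * pi * s) * (indicator {-s..s} z * g (s, z)) \<partial>lborel \<partial>lborel)"
    by (intro nn_integral_cong, subst nn_integral_density)
       (auto intro!: nn_integral_cong simp: mult_ac split: split_indicator)
  also have "\<dots> = (\<integral>\<^sup>+ s. \<integral>\<^sup>+ z. ennreal (2 * pi * s) * (indicator {-s..s} z * g (s, z)) \<partial>lborel \<partial>lborel)"
    by (rule lborel_pair.Fubini') measurable
  also have "\<dots> = (\<integral>\<^sup>+ s. ennreal (2 * pi * s) * (\<integral>\<^sup>+ z. indicator {-s..s} z * g (s, z) \<partial>lborel) \<partial>lborel)"
    by (intro nn_integral_cong nn_integral_cmult) measurable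
  finally show ?thesis .
qed


text \<open>
  The case \<open>r = s\<close>, where the antiderivative is singular at the endpoint, is a single radius and can be
  left out.
\<close>

lemma nn_integral_inverse_distance_slice:
  assumes "0 \<le> r" "0 < s" "r \<noteq> s"
  shows "(\<integral>\<^sup>+ z. indicator {-s..s} z * ennreal (1 / sqrt (r\<^sup>2 + s\<^sup>2 - 2 * r * z)) \<partial>lborel) =
         ennreal (2 * s / max r s)"
proof (cases "r = 0")
  case True
  then have "(\<integral>\<^sup>+ z. indicator {-s..s} z * ennreal (1 / sqrt (r\<^sup>2 + s\<^sup>2 - 2 * r * z)) \<partial>lborel) =
      (\<integral>\<^sup>+ z. ennreal (1 / s) * indicator {-s..s} z \<partial>lborel)"
    using assms by (intro nn_integral_cong) (auto split: split_indicator)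
  also have "\<dots> = ennreal (2 * s / max r s)"
    using assms True by (subst nn_integral_cmult) (auto simp: ennreal_mult[symmetric])
  finally show ?thesis .
next
  case False
  have pos: "0 < r\<^sup>2 + s\<^sup>2 - 2 * r * z" if "z \<le> s" for z
  proof -
    have "0 < (r - s)\<^sup>2" using assms by simp
    also have "\<dots> = r\<^sup>2 + s\<^sup>2 - 2 * r * s"
      by (simp add: power2_eq_square algebra_simps)
    also have "\<dots> \<le> r\<^sup>2 + s\<^sup>2 - 2 * r * z"
      using that assms by (simp add: mult_left_mono)
    finally show ?thesis .
  qed
  have "(\<integral>\<^sup>+ z. indicator {-s..s} z * ennreal (1 / sqrt (r\<^sup>2 + s\<^sup>2 - 2 * r * z)) \<partial>lborel) =
        (\<integral>\<^sup>+ z. ennreal (1 / sqrt (r\<^sup>2 + s\<^sup>2 - 2 * r * z)) * indicator {-s..s} z \<partial>lborel)"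
    by (simp add: mult.commute)
  also have "\<dots> = ennreal (- sqrt (r\<^sup>2 + s\<^sup>2 - 2 * r * s) / r - - sqrt (r\<^sup>2 + s\<^sup>2 - 2 * r * (-s)) / r)"
  proof (rule nn_integral_FTC_Icc[where F = "\<lambda>z. - sqrt (r\<^sup>2 + s\<^sup>2 - 2 * r * z) / r"])
    fix z assume "z \<in> {-s..s}"
    then have z: "-s \<le> z" "z \<le> s" by auto
    show "((\<lambda>z. - sqrt (r\<^sup>2 + s\<^sup>2 - 2 * r * z) / r) has_real_derivative 1 / sqrt (r\<^sup>2 + s\<^sup>2 - 2 * r * z)) (at z)"
      using pos[OF z(2)] False assms(1)
      by (auto intro!: derivative_eq_intros simp: field_simps)
    show "0 \<le> 1 / sqrt (r\<^sup>2 + s\<^sup>2 - 2 * r * z)"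
      using pos[OF z(2)] by simp
  qed (use assms in auto)
  also have "r\<^sup>2 + s\<^sup>2 - 2 * r * s = (r - s)\<^sup>2"
    by (simp add: power2_eq_square algebra_simps)
  also have "r\<^sup>2 + s\<^sup>2 - 2 * r * (-s) = (r + s)\<^sup>2"
    by (simp add: power2_eq_square algebra_simps)
  also have "- sqrt ((r - s)\<^sup>2) / r - - sqrt ((r + s)\<^sup>2) / r = 2 * s / max r s"
    using assms False by (auto simp: field_simps max_def abs_if)
  finally show ?thesis .
qed

lemma borel_measurable_nth3 [measurable]: "(\<lambda>y::real^3. y $ 3) \<in> borel_measurable borel"
  by (intro borel_measurable_continuous_onI continuous_intros)

lemma norm_axis_diff: "norm (r *\<^sub>R axis 3 1 - y :: real^3) = sqrt (r\<^sup>2 + (norm y)\<^sup>2 - 2 * r * y $ 3)"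
proof -
  have "(norm (r *\<^sub>R axis 3 1 - y))\<^sup>2 = r\<^sup>2 + (norm y)\<^sup>2 - 2 * r * y $ 3"
    unfolding power2_norm_eq_inner
    by (simp add: inner_diff_left inner_diff_right inner_axis inner_axis' power2_eq_square algebra_simps)
  then show ?thesis
    by (metis norm_ge_zero real_sqrt_unique)
qed

lemma nn_integral_shell_axis:
  fixes \<phi> :: "real \<Rightarrow> ennreal"
  assumes [measurable]: "\<phi> \<in> borel_measurable borel" and "0 \<le> r"
  shows "(\<integral>\<^sup>+ y. \<phi> (norm y) * ennreal (1 / norm (r *\<^sub>R axis 3 1 - y :: real^3)) \<partial>lborel) =
         (\<integral>\<^sup>+ s. \<phi> s * ennreal (indicator {0..} s * (4 * pi * s\<^sup>2 / max r s)) \<partial>lborel)"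
proof -
  define g where "g = (\<lambda>(s, z). \<phi> s * ennreal (1 / sqrt (r\<^sup>2 + s\<^sup>2 - 2 * r * z)))"
  have [measurable]: "g \<in> borel_measurable borel"
    unfolding g_def borel_prod[symmetric] by measurable
  have "(\<integral>\<^sup>+ y. \<phi> (norm y) * ennreal (1 / norm (r *\<^sub>R axis 3 1 - y :: real^3)) \<partial>lborel) =
        (\<integral>\<^sup>+ y. g (norm y, (y :: real^3) $ 3) \<partial>lborel)"
    by (simp add: g_def norm_axis_diff)
  also have "\<dots> = (\<integral>\<^sup>+ s. ennreal (2 * pi * s) * (\<integral>\<^sup>+ z. indicator {-s..s} z * g (s, z) \<partial>lborel) \<partial>lborel)"
    by (rule nn_integral_axial) measurable
  also have "\<dots> = (\<integral>\<^sup>+ s. \<phi> s * ennreal (indicator {0..} s * (4 * pi * s\<^sup>2 / max r s)) \<partial>lborel)"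
  proof (rule nn_integral_cong_AE, rule AE_mp[OF AE_conjI[OF AE_lborel_singleton[of 0] AE_lborel_singleton[of r]]], intro AE_I2 impI)
    fix s :: real assume "s \<noteq> 0 \<and> s \<noteq> r"
    then have s: "s \<noteq> 0" "r \<noteq> s" by auto
    show "ennreal (2 * pi * s) * (\<integral>\<^sup>+ z. indicator {-s..s} z * g (s, z) \<partial>lborel) =
        \<phi> s * ennreal (indicator {0..} s * (4 * pi * s\<^sup>2 / max r s))"
    proof (cases "0 < s")
      case True
      have "(\<integral>\<^sup>+ z. indicator {-s..s} z * g (s, z) \<partial>lborel) =
          (\<integral>\<^sup>+ z. \<phi> s * (indicator {-s..s} z * ennreal (1 / sqrt (r\<^sup>2 + s\<^sup>2 - 2 * r * z))) \<partial>lborel)"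
        by (simp add: g_def mult_ac)
      also have "\<dots> = \<phi> s * ennreal (2 * s / max r s)"
        by (subst nn_integral_cmult) (auto simp: nn_integral_inverse_distance_slice[OF assms(2) True s(2)])
      finally have "ennreal (2 * pi * s) * (\<integral>\<^sup>+ z. indicator {-s..s} z * g (s, z) \<partial>lborel) =
          \<phi> s * (ennreal (2 * pi * s) * ennreal (2 * s / max r s))"
        by (simp add: mult_ac)
      also have "ennreal (2 * pi * s) * ennreal (2 * s / max r s) = ennreal ((2 * pi * s) * (2 * s / max r s))"
        using True by (intro ennreal_mult[symmetric]) auto
      also have "(2 * pi * s) * (2 * s / max r s) = indicator {0..} s * (4 * pi * s\<^sup>2 / max r s)"
        using True by (simp add: power2_eq_square)
      finally show ?thesis .
    next
      case False
      with s have "s < 0" by simp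
      then show ?thesis
        by (simp add: ennreal_neg mult_nonneg_nonpos)
    qed
  qed
  finally show ?thesis .
qed

lemma distr_orthogonal_lborel:
  fixes f :: "real^3 \<Rightarrow> real^3"
  assumes f: "orthogonal_transformation f"
  shows "distr lborel borel f = lborel"
proof (rule lborel_eqI[symmetric])
  have lin: "linear f" and inj: "inj f"
    using f by (auto simp: orthogonal_transformation_linear orthogonal_transformation_inj)
  have [measurable]: "f \<in> borel_measurable borel"
    using lin by (intro borel_measurable_continuous_onI linear_continuous_on) (simp add: linear_conv_bounded_linear)
  fix l u :: "real^3"
  assume le: "\<And>b. b \<in> Basis \<Longrightarrow> l \<bullet> b \<le> u \<bullet> b"
  have inv: "orthogonal_transformation (inv f)"
    using f by (rule orthogonal_transformation_inv)
  have vim: "f -` box l u = inv f ` box l u"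
    using f by (simp add: bij_vimage_eq_inv_image orthogonal_transformation_bij)
  have "box l u \<in> lmeasurable" by simp
  note m = measurable_orthogonal_image[OF inv this] measure_orthogonal_image[OF inv this]
  have s: "inv f ` box l u \<in> sets borel"
    unfolding vim[symmetric] using measurable_sets_borel[of f borel "box l u"] by simp
  have "emeasure (distr lborel borel f) (box l u) = emeasure lborel (inv f ` box l u)"
    by (subst emeasure_distr) (simp_all add: vim)
  also have "\<dots> = emeasure lebesgue (inv f ` box l u)"
    using s by simp
  also have "\<dots> = ennreal (measure lebesgue (box l u))"
    using emeasure_eq_measure2[OF m(1)] unfolding m(2) .
  also have "\<dots> = emeasure lborel (box l u)"
    using emeasure_eq_measure2[of "box l u" lebesgue] by simp
  also have "\<dots> = (\<Prod>b\<in>Basis. (u - l) \<bullet> b)"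
    using le by (rule emeasure_lborel_box)
  finally show "emeasure (distr lborel borel f) (box l u) = (\<Prod>b\<in>Basis. (u - l) \<bullet> b)" .
qed simp

text \<open>
  The general position of \<open>x\<close> is reduced to a point on the third axis by a rotation.
\<close>

lemma nn_integral_shell:
  fixes \<phi> :: "real \<Rightarrow> ennreal" and x :: "real^3"
  assumes [measurable]: "\<phi> \<in> borel_measurable borel"
  shows "(\<integral>\<^sup>+ y. \<phi> (norm y) * ennreal (1 / norm (x - y)) \<partial>lborel) =
         (\<integral>\<^sup>+ s. \<phi> s * ennreal (indicator {0..} s * (4 * pi * s\<^sup>2 / max (norm x) s)) \<partial>lborel)"
proof -
  have "norm (norm x *\<^sub>R axis 3 1 :: real^3) = norm x"
    by simp
  then obtain f :: "real^3 \<Rightarrow> real^3" where f: "orthogonal_transformation f" "f (norm x *\<^sub>R axis 3 1) = x"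
    using orthogonal_transformation_exists[of "norm x *\<^sub>R axis 3 1 :: real^3" x] by metis
  have lin: "linear f"
    using f by (simp add: orthogonal_transformation_linear)
  have [measurable]: "f \<in> borel_measurable borel"
    using lin by (intro borel_measurable_continuous_onI linear_continuous_on) (simp add: linear_conv_bounded_linear)
  have nf: "norm (f y) = norm y" for y
    using f by (simp add: orthogonal_transformation_norm)
  have "norm (x - f y) = norm (norm x *\<^sub>R axis 3 1 - y)" for y
    using nf[of "norm x *\<^sub>R axis 3 1 - y"] by (simp add: linear_diff[OF lin] f(2))
  then have "(\<integral>\<^sup>+ y. \<phi> (norm y) * ennreal (1 / norm (x - y)) \<partial>lborel) =
      (\<integral>\<^sup>+ y. \<phi> (norm y) * ennreal (1 / norm (norm x *\<^sub>R axis 3 1 - y :: real^3)) \<partial>lborel)"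
    by (subst distr_orthogonal_lborel[OF f(1), symmetric], subst nn_integral_distr) (auto simp: nf)
  also have "\<dots> = (\<integral>\<^sup>+ s. \<phi> s * ennreal (indicator {0..} s * (4 * pi * s\<^sup>2 / max (norm x) s)) \<partial>lborel)"
    by (rule nn_integral_shell_axis) auto
  finally show ?thesis .
qed

section \<open>Potentials of even densities\<close>

text \<open>
  The class of densities whose potentials are formed: on \<open>\<real>\<^sup>3\<close> in general, and on the line for the radial
  profile \<open>\<phi>\<close> of a density \<open>\<phi> (norm y)\<close>, where the values at negative numbers are irrelevant.
\<close>

definition bounded_source :: "real \<Rightarrow> ('a::real_normed_vector \<Rightarrow> real) \<Rightarrow> bool" where
  "bounded_source R H \<longleftrightarrow>
     H \<in> borel_measurable borel \<and> (\<exists>B. \<forall>y. \<bar>H y\<bar> \<le> B) \<and> (\<forall>y. R < norm y \<longrightarrow> H y = 0)"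

definition potential :: "(real^3 \<Rightarrow> real) \<Rightarrow> real^3 \<Rightarrow> real" where
  "potential H x = (LINT y|lborel. H y / norm (x - y)) / (4 * pi)"

lemma bounded_source_measurable [dest]: "bounded_source R H \<Longrightarrow> H \<in> borel_measurable borel"
  by (simp add: bounded_source_def)

lemma bounded_sourceE:
  assumes "bounded_source R H"
  obtains B where "0 \<le> B" "\<And>y. \<bar>H y\<bar> \<le> B" "\<And>y. R < norm y \<Longrightarrow> H y = 0"
proof -
  from assms obtain B where B: "\<And>y. \<bar>H y\<bar> \<le> B" "\<And>y. R < norm y \<Longrightarrow> H y = 0"
    unfolding bounded_source_def by blast
  have "0 \<le> B" using B(1)[of 0] abs_ge_zero order_trans by blast
  with B that show thesis by blast
qed

lemma bounded_source_add:
  assumes "bounded_source R H" "bounded_source R K"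
  shows "bounded_source R (\<lambda>y. H y + K y)"
proof -
  note [measurable] = assms[THEN bounded_source_measurable]
  obtain B where B: "\<And>y. \<bar>H y\<bar> \<le> B" "\<And>y. R < norm y \<Longrightarrow> H y = 0"
    using assms(1) by (rule bounded_sourceE) blast
  obtain C where C: "\<And>y. \<bar>K y\<bar> \<le> C" "\<And>y. R < norm y \<Longrightarrow> K y = 0"
    using assms(2) by (rule bounded_sourceE) blast
  have "\<bar>H y + K y\<bar> \<le> B + C" for y
    using B(1)[of y] C(1)[of y] by linarith
  with B C show ?thesis unfolding bounded_source_def by auto
qed

lemma bounded_source_uminus: "bounded_source R H \<Longrightarrow> bounded_source R (\<lambda>y. - H y)"
  unfolding bounded_source_def by auto

lemma bounded_source_diff:
  "bounded_source R H \<Longrightarrow> bounded_source R K \<Longrightarrow> bounded_source R (\<lambda>y. H y - K y)"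
  using bounded_source_add[OF _ bounded_source_uminus, of R H K] by simp

lemma bounded_source_radial:
  assumes "bounded_source R \<phi>"
  shows "bounded_source R (\<lambda>y :: 'a::euclidean_space. \<phi> (norm y))"
proof -
  note [measurable] = assms[THEN bounded_source_measurable]
  show ?thesis using assms unfolding bounded_source_def
    by (auto simp: abs_norm_cancel)
qed

text \<open>
  Stated as an identity of measures, so that integrals of signed densities follow as well.
\<close>

lemma shell_measure:
  fixes x :: "real^3"
  shows "distr (with_density lborel (\<lambda>y. ennreal (1 / norm (x - y)))) borel norm =
         with_density lborel (\<lambda>s. ennreal (indicator {0..} s * (4 * pi * s\<^sup>2 / max (norm x) s)))"
    (is "?M = ?N")
proof (rule measure_eqI)
  fix X assume "X \<in> sets ?M"
  then have [measurable]: "X \<in> sets borel" by simp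
  have [measurable]: "norm -` X \<in> sets (borel :: (real^3) measure)"
    using measurable_sets_borel[of norm borel X] by simp
  have "emeasure ?M X = (\<integral>\<^sup>+ y. ennreal (1 / norm (x - y)) * indicator (norm -` X) y \<partial>lborel)"
    by (subst emeasure_distr, simp, simp, subst emeasure_density) auto
  also have "\<dots> = (\<integral>\<^sup>+ y. indicator X (norm y) * ennreal (1 / norm (x - y)) \<partial>lborel)"
    by (intro nn_integral_cong) (auto split: split_indicator)
  also have "\<dots> = (\<integral>\<^sup>+ s. indicator X s * ennreal (indicator {0..} s * (4 * pi * s\<^sup>2 / max (norm x) s)) \<partial>lborel)"
    by (rule nn_integral_shell) auto
  also have "\<dots> = emeasure ?N X"
    by (subst emeasure_density) (auto simp: mult.commute)
  finally show "emeasure ?M X = emeasure ?N X" .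
qed simp

lemma shell_integral:
  fixes x :: "real^3" and \<phi> :: "real \<Rightarrow> real"
  assumes \<phi>: "bounded_source R \<phi>"
  shows "integrable lborel (\<lambda>y. \<phi> (norm y) / norm (x - y))"
    and "set_integrable lborel {0..R} (\<lambda>s. \<phi> s * (s\<^sup>2 / max (norm x) s))"
    and "(LINT y|lborel. \<phi> (norm y) / norm (x - y)) =
           4 * pi * (LINT s:{0..R}|lborel. \<phi> s * (s\<^sup>2 / max (norm x) s))"
proof -
  note [measurable] = bounded_source_measurable[OF \<phi>]
  obtain B where B: "0 \<le> B" "\<And>y. \<bar>\<phi> y\<bar> \<le> B" "\<And>y. R < norm y \<Longrightarrow> \<phi> y = 0"
    using \<phi> by (rule bounded_sourceE) blast
  let ?w = "\<lambda>s. s\<^sup>2 / max (norm x) s"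
  have le: "\<bar>\<phi> s * ?w s\<bar> \<le> B * \<bar>R\<bar>" if "s \<in> {0..R}" for s
  proof -
    have "0 \<le> ?w s" "?w s \<le> \<bar>R\<bar>"
    proof -
      show "0 \<le> ?w s" using that by (auto intro!: divide_nonneg_nonneg simp: le_max_iff_disj)
      have "?w s \<le> s"
        using that by (cases "s = 0") (auto simp: divide_le_eq power2_eq_square max_def mult_left_mono)
      then show "?w s \<le> \<bar>R\<bar>" using that by auto
    qed
    then show ?thesis
      unfolding abs_mult using B(1) B(2)[of s] by (intro mult_mono) auto
  qed
  show int: "set_integrable lborel {0..R} (\<lambda>s. \<phi> s * ?w s)"
    unfolding set_integrable_def
  proof (rule Bochner_Integration.integrable_bound)
    show "integrable lborel (\<lambda>s. B * \<bar>R\<bar> * indicator {0..R} s)"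
      by (intro integrable_mult_right integrable_real_indicator) (auto simp: emeasure_lborel_Icc_eq)
    have "norm (indicator {0..R} s *\<^sub>R (\<phi> s * ?w s)) \<le> norm (B * \<bar>R\<bar> * indicator {0..R} s)" for s
    proof (cases "s \<in> {0..R}")
      case True
      then show ?thesis using le[OF True] B(1) by (simp del: abs_mult add: abs_of_nonneg)
    qed simp
    then show "AE s in lborel. norm (indicator {0..R} s *\<^sub>R (\<phi> s * ?w s)) \<le> norm (B * \<bar>R\<bar> * indicator {0..R} s)"
      by (rule AE_I2)
  qed measurable
  have eq: "(indicator {0..} s * (4 * pi * s\<^sup>2 / max (norm x) s)) *\<^sub>R \<phi> s =
        4 * pi * (indicator {0..R} s *\<^sub>R (\<phi> s * ?w s))" for s
    using B(3)[of s] by (auto split: split_indicator)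
  have nn: "0 \<le> indicator {0..} s * (4 * pi * s\<^sup>2 / max (norm x) s)" for s :: real
    by (auto split: split_indicator intro!: divide_nonneg_nonneg simp: le_max_iff_disj)
  have "integrable lborel (\<lambda>s. (indicator {0..} s * (4 * pi * s\<^sup>2 / max (norm x) s)) *\<^sub>R \<phi> s)"
    unfolding eq using int unfolding set_integrable_def by (intro integrable_mult_right) auto
  then have "integrable (with_density lborel (\<lambda>s. ennreal (indicator {0..} s * (4 * pi * s\<^sup>2 / max (norm x) s)))) \<phi>"
    by (subst integrable_density) (use nn in \<open>auto simp del: times_divide_eq_right\<close>)
  then have "integrable (with_density lborel (\<lambda>y. ennreal (1 / norm (x - y)))) (\<lambda>y. \<phi> (norm y))"
    unfolding shell_measure[symmetric] by (subst (asm) integrable_distr_eq) auto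
  then show "integrable lborel (\<lambda>y. \<phi> (norm y) / norm (x - y))"
    by (subst (asm) integrable_density) auto
  have "(LINT y|lborel. \<phi> (norm y) / norm (x - y)) =
      integral\<^sup>L (with_density lborel (\<lambda>y. ennreal (1 / norm (x - y)))) (\<lambda>y. \<phi> (norm y))"
    by (subst integral_density) auto
  also have "\<dots> = integral\<^sup>L (distr (with_density lborel (\<lambda>y. ennreal (1 / norm (x - y)))) borel norm) \<phi>"
    by (subst integral_distr) auto
  also have "\<dots> = (LINT s|lborel. (indicator {0..} s * (4 * pi * s\<^sup>2 / max (norm x) s)) *\<^sub>R \<phi> s)"
    unfolding shell_measure by (subst integral_density) (use nn in \<open>auto simp del: times_divide_eq_right\<close>)
  also have "\<dots> = 4 * pi * (LINT s:{0..R}|lborel. \<phi> s * ?w s)"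
    unfolding eq set_lebesgue_integral_def by (rule integral_mult_right_zero)
  finally show "(LINT y|lborel. \<phi> (norm y) / norm (x - y)) =
      4 * pi * (LINT s:{0..R}|lborel. \<phi> s * ?w s)" .
qed

lemma potential_radial:
  "bounded_source R \<phi> \<Longrightarrow>
     potential (\<lambda>y. \<phi> (norm y)) x = (LINT s:{0..R}|lborel. \<phi> s * (s\<^sup>2 / max (norm x) s))"
  by (simp add: potential_def shell_integral(3))

lemma integrable_potential:
  fixes x :: "real^3"
  assumes "bounded_source R H"
  shows "integrable lborel (\<lambda>y. H y / norm (x - y))"
proof -
  note [measurable] = bounded_source_measurable[OF assms]
  obtain B where B: "0 \<le> B" "\<And>y. \<bar>H y\<bar> \<le> B" "\<And>y. R < norm y \<Longrightarrow> H y = 0"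
    using assms by (rule bounded_sourceE) blast
  have "bounded_source R (\<lambda>s. B * indicator {0..R} s :: real)"
    unfolding bounded_source_def using B(1) by (auto intro!: exI[of _ B] split: split_indicator)
  from shell_integral(1)[OF this, of x]
  have "integrable lborel (\<lambda>y. (B * indicator {0..R} (norm y)) / norm (x - y))" .
  then show ?thesis
    by (rule Bochner_Integration.integrable_bound)
       (use B in \<open>auto split: split_indicator simp: not_le intro!: AE_I2 divide_right_mono\<close>)
qed

lemma potential_add:
  "bounded_source R H \<Longrightarrow> bounded_source R K \<Longrightarrow>
     potential (\<lambda>y. H y + K y) x = potential H x + potential K x"
  unfolding potential_def add_divide_distrib
  by (subst Bochner_Integration.integral_add) (auto intro: integrable_potential simp: add_divide_distrib)

lemma potential_diff:
  "bounded_source R H \<Longrightarrow> bounded_source R K \<Longrightarrow>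
     potential (\<lambda>y. H y - K y) x = potential H x - potential K x"
  unfolding potential_def diff_divide_distrib
  by (subst Bochner_Integration.integral_diff) (auto intro: integrable_potential simp: diff_divide_distrib)

lemma potential_bound:
  assumes "bounded_source R H" "bounded_source R \<phi>" "\<And>y. \<bar>H y\<bar> \<le> \<phi> (norm y)"
  shows "\<bar>potential H x\<bar> \<le> (LINT s:{0..R}|lborel. \<phi> s * (s\<^sup>2 / max (norm x) s))"
proof -
  have "\<bar>potential H x\<bar> \<le> (LINT y|lborel. \<bar>H y / norm (x - y)\<bar>) / (4 * pi)"
    unfolding potential_def using integral_abs_bound[of lborel "\<lambda>y. H y / norm (x - y)"]
    by (simp add: divide_right_mono)
  also have "\<dots> \<le> (LINT y|lborel. \<phi> (norm y) / norm (x - y)) / (4 * pi)"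
    using assms integrable_potential[OF assms(1)] shell_integral(1)[OF assms(2)]
    by (intro divide_right_mono integral_mono integrable_abs) (auto simp: abs_divide divide_right_mono)
  also have "\<dots> = (LINT s:{0..R}|lborel. \<phi> s * (s\<^sup>2 / max (norm x) s))"
    by (simp add: shell_integral(3)[OF assms(2)])
  finally show ?thesis .
qed

text \<open>
  With \<open>a = |x - y|\<close> and \<open>b = |x + y|\<close>, the parallelogram law gives \<open>a\<^sup>2 + b\<^sup>2 = 2 (|x|\<^sup>2 + |y|\<^sup>2)\<close>; the
  harmonic mean of \<open>a\<close> and \<open>b\<close> is at most their quadratic mean.
\<close>

lemma even_kernel_ge:
  fixes x y :: "real^3"
  assumes "x \<noteq> y" "x \<noteq> - y"
  shows "1 / sqrt ((norm x)\<^sup>2 + (norm y)\<^sup>2) \<le> (1 / norm (x - y) + 1 / norm (x + y)) / 2"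
proof -
  define a b where "a = norm (x - y)" and "b = norm (x + y)"
  have a: "0 < a" and b: "0 < b"
    using assms by (auto simp: a_def b_def add_eq_0_iff2)
  have par: "a\<^sup>2 + b\<^sup>2 = 2 * ((norm x)\<^sup>2 + (norm y)\<^sup>2)"
    unfolding a_def b_def power2_norm_eq_inner
    by (simp add: inner_diff_left inner_diff_right inner_add_left inner_add_right inner_commute)
  have "((a + b) / 2)\<^sup>2 \<le> (norm x)\<^sup>2 + (norm y)\<^sup>2"
    using par sum_squares_ge_zero[of "a - b" 0] by (simp add: power2_eq_square algebra_simps)
  then have "(a + b) / 2 \<le> sqrt ((norm x)\<^sup>2 + (norm y)\<^sup>2)"
    by (rule real_le_rsqrt)
  moreover have "0 < (a + b) / 2"
    using a b by simp
  ultimately have "1 / sqrt ((norm x)\<^sup>2 + (norm y)\<^sup>2) \<le> 1 / ((a + b) / 2)"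
    by (intro frac_le) simp_all
  also have "\<dots> \<le> (1 / a + 1 / b) / 2"
  proof -
    have "4 * (a * b) \<le> (a + b) * (a + b)"
      using sum_squares_ge_zero[of "a - b" 0] by (simp add: algebra_simps)
    then show ?thesis using a b by (simp add: field_simps)
  qed
  finally show ?thesis unfolding a_def b_def .
qed

text \<open>
  The integral of a radial \<open>d\<close> against the difference of the Newtonian kernel and the lower bound
  \<open>even_kernel_ge\<close>, after integration over spheres; \<open>excess_altdef\<close> is this description.
\<close>

definition excess :: "real \<Rightarrow> (real \<Rightarrow> real) \<Rightarrow> real \<Rightarrow> real" where
  "excess R d r = (LINT s:{0..R}|lborel. d s * (s\<^sup>2 / max r s - s\<^sup>2 / sqrt (r\<^sup>2 + s\<^sup>2)))"

text \<open>
  Integration of a radial function is the shell theorem at the origin: the factor \<open>s\<close> in \<open>\<phi>\<close> cancels the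
  distance to the origin.
\<close>

lemma softened_integral:
  fixes r :: real
  assumes d: "bounded_source R d"
  shows "integrable lborel (\<lambda>y :: real^3. d (norm y) / sqrt (r\<^sup>2 + (norm y)\<^sup>2))"
    and "set_integrable lborel {0..R} (\<lambda>s. d s * (s\<^sup>2 / sqrt (r\<^sup>2 + s\<^sup>2)))"
    and "(LINT y|lborel. d (norm (y :: real^3)) / sqrt (r\<^sup>2 + (norm y)\<^sup>2)) =
           4 * pi * (LINT s:{0..R}|lborel. d s * (s\<^sup>2 / sqrt (r\<^sup>2 + s\<^sup>2)))"
proof -
  note [measurable] = bounded_source_measurable[OF d]
  obtain B where B: "0 \<le> B" "\<And>y. \<bar>d y\<bar> \<le> B" "\<And>y. R < norm y \<Longrightarrow> d y = 0"
    using d by (rule bounded_sourceE) blast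
  define \<phi> where "\<phi> s = d s * (s / sqrt (r\<^sup>2 + s\<^sup>2))" for s
  have "\<bar>s / sqrt (r\<^sup>2 + s\<^sup>2)\<bar> \<le> 1" for s
    by (cases "s = 0") (auto simp: abs_divide divide_le_eq_1 real_le_rsqrt sum_power2_gt_zero_iff)
  then have "\<bar>\<phi> s\<bar> \<le> B * 1" for s
    unfolding \<phi>_def abs_mult using B by (intro mult_mono) auto
  moreover have [measurable]: "\<phi> \<in> borel_measurable borel"
    unfolding \<phi>_def by measurable
  ultimately have \<phi>: "bounded_source R \<phi>"
    unfolding bounded_source_def \<phi>_def using B(3) by auto
  have *: "\<phi> (norm y) / norm (0 - y) = d (norm y) / sqrt (r\<^sup>2 + (norm y)\<^sup>2)" if "y \<noteq> 0" for y :: "real^3"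
    using that by (simp add: \<phi>_def)
  \<comment> \<open>At the origin the two sides may differ, by the convention \<open>x / 0 = 0\<close>.\<close>
  have ae: "AE y in lborel. \<phi> (norm y) / norm (0 - y) = d (norm y) / sqrt (r\<^sup>2 + (norm (y :: real^3))\<^sup>2)"
    using AE_lborel_singleton[of "0 :: real^3"] * by auto
  show "integrable lborel (\<lambda>y :: real^3. d (norm y) / sqrt (r\<^sup>2 + (norm y)\<^sup>2))"
    using shell_integral(1)[OF \<phi>, of 0] ae by (subst (asm) integrable_cong_AE) auto
  have **: "\<phi> s * (s\<^sup>2 / max (norm (0 :: real^3)) s) = d s * (s\<^sup>2 / sqrt (r\<^sup>2 + s\<^sup>2))" if "s \<in> {0..R}" for s
    using that by (cases "s = 0") (auto simp: \<phi>_def power2_eq_square)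
  show "set_integrable lborel {0..R} (\<lambda>s. d s * (s\<^sup>2 / sqrt (r\<^sup>2 + s\<^sup>2)))"
    using shell_integral(2)[OF \<phi>, of 0] ** by (subst (asm) set_integrable_cong) auto
  have "(LINT y|lborel. d (norm (y :: real^3)) / sqrt (r\<^sup>2 + (norm y)\<^sup>2)) =
      (LINT y|lborel. \<phi> (norm y) / norm (0 - y :: real^3))"
    using ae by (intro integral_cong_AE) auto
  also have "\<dots> = 4 * pi * (LINT s:{0..R}|lborel. \<phi> s * (s\<^sup>2 / max (norm (0 :: real^3)) s))"
    by (rule shell_integral(3)[OF \<phi>])
  also have "(LINT s:{0..R}|lborel. \<phi> s * (s\<^sup>2 / max (norm (0 :: real^3)) s)) =
      (LINT s:{0..R}|lborel. d s * (s\<^sup>2 / sqrt (r\<^sup>2 + s\<^sup>2)))"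
    using ** by (intro set_lebesgue_integral_cong) auto
  finally show "(LINT y|lborel. d (norm (y :: real^3)) / sqrt (r\<^sup>2 + (norm y)\<^sup>2)) =
           4 * pi * (LINT s:{0..R}|lborel. d s * (s\<^sup>2 / sqrt (r\<^sup>2 + s\<^sup>2)))" .
qed

lemma excess_altdef:
  assumes "bounded_source R d"
  shows "4 * pi * excess R d (norm x) =
           (LINT y|lborel. d (norm (y :: real^3)) / norm (x - y)) -
           (LINT y|lborel. d (norm (y :: real^3)) / sqrt ((norm x)\<^sup>2 + (norm y)\<^sup>2))"
  unfolding shell_integral(3)[OF assms] softened_integral(3)[OF assms] excess_def right_diff_distrib
  using shell_integral(2)[OF assms, of x] softened_integral(2)[OF assms, of "norm x"]
  by (subst set_integral_diff(2)) (auto simp: algebra_simps)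

lemma integral_reflect:
  fixes f :: "real^3 \<Rightarrow> real"
  assumes [measurable]: "f \<in> borel_measurable borel"
  shows "(LINT y|lborel. f (- y)) = (LINT y|lborel. f y)"
proof -
  have "orthogonal_transformation (uminus :: real^3 \<Rightarrow> real^3)"
    by (simp add: orthogonal_transformation_def linear_uminus)
  from distr_orthogonal_lborel[OF this] have "(LINT y|lborel. f y) = (LINT y|distr lborel borel uminus. f y)"
    by simp
  also have "\<dots> = (LINT y|lborel. f (- y))"
    by (subst integral_distr) auto
  finally show ?thesis by simp
qed

lemma integrable_reflect:
  fixes f :: "real^3 \<Rightarrow> real"
  assumes "integrable lborel f"
  shows "integrable lborel (\<lambda>y. f (- y))"
proof -
  have "orthogonal_transformation (uminus :: real^3 \<Rightarrow> real^3)"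
    by (simp add: orthogonal_transformation_def linear_uminus)
  from distr_orthogonal_lborel[OF this] have "integrable (distr lborel borel uminus) f"
    using assms by simp
  then show ?thesis
    by (subst (asm) integrable_distr_eq) (use assms in auto)
qed

text \<open>
  The subtracted term depends on \<open>norm x\<close> only, so it disappears when two points of one sphere are
  compared. What remains of the kernel is nonnegative, and so \<open>H\<close> can be replaced by its radial bound.
\<close>

lemma potential_even_bound:
  assumes H: "bounded_source R H" and even: "\<And>y. H (- y) = H y"
    and d: "bounded_source R d" and le: "\<And>y. \<bar>H y\<bar> \<le> d (norm y)"
  shows "\<bar>potential H x - (LINT y|lborel. H y / sqrt ((norm x)\<^sup>2 + (norm y)\<^sup>2)) / (4 * pi)\<bar> \<le> excess R d (norm x)"
proof -
  note [measurable] = bounded_source_measurable[OF H] bounded_source_measurable[OF d]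
  let ?k = "\<lambda>y. (1 / norm (x - y) + 1 / norm (x + y)) / 2 - 1 / sqrt ((norm x)\<^sup>2 + (norm y)\<^sup>2)"
  have int: "integrable lborel (\<lambda>y. K y * ?k y)"
    and val: "(LINT y|lborel. K y * ?k y) = (LINT y|lborel. K y / norm (x - y)) -
        (LINT y|lborel. K y / sqrt ((norm x)\<^sup>2 + (norm y)\<^sup>2))"
    if K: "bounded_source R K" "\<And>y. K (- y) = K y" and Kd: "\<And>y. \<bar>K y\<bar> \<le> d (norm y)" for K
  proof -
    note [measurable] = bounded_source_measurable[OF K(1)]
    note i1 = integrable_potential[OF K(1), of x]
    have eq: "K (-y) / norm (x - (-y)) = K y / norm (x + y)" for y
      by (simp add: K(2))
    have i2: "integrable lborel (\<lambda>y. K y / norm (x + y))"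
      using integrable_reflect[OF i1] unfolding eq .
    have e2: "(LINT y|lborel. K y / norm (x + y)) = (LINT y|lborel. K y / norm (x - y))"
      using integral_reflect[of "\<lambda>y. K y / norm (x - y)"] unfolding eq by simp
    have i3: "integrable lborel (\<lambda>y. K y / sqrt ((norm x)\<^sup>2 + (norm y)\<^sup>2))"
      using softened_integral(1)[OF d, of "norm x"]
      by (rule Bochner_Integration.integrable_bound)
         (use Kd in \<open>auto intro!: AE_I2 divide_right_mono simp: abs_divide intro: order_trans[OF _ abs_ge_self]\<close>)
    have k: "K y * ?k y = (K y / norm (x - y) + K y / norm (x + y)) / 2 - K y / sqrt ((norm x)\<^sup>2 + (norm y)\<^sup>2)" for y
      by (simp add: algebra_simps add_divide_distrib)
    show "integrable lborel (\<lambda>y. K y * ?k y)"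
      unfolding k using i1 i2 i3 by auto
    show "(LINT y|lborel. K y * ?k y) = (LINT y|lborel. K y / norm (x - y)) -
        (LINT y|lborel. K y / sqrt ((norm x)\<^sup>2 + (norm y)\<^sup>2))"
      unfolding k using i1 i2 i3 by (simp add: e2)
  qed
  have dr: "bounded_source R (\<lambda>y :: real^3. d (norm y))"
    using d by (rule bounded_source_radial)
  have dnn: "\<bar>d (norm y)\<bar> \<le> d (norm y)" for y :: "real^3"
    using le[of y] by simp
  have "\<bar>LINT y|lborel. H y * ?k y\<bar> \<le> (LINT y|lborel. \<bar>H y * ?k y\<bar>)"
    by (rule integral_abs_bound)
  also have "\<dots> \<le> (LINT y|lborel. d (norm y) * ?k y)"
  proof (rule integral_mono_AE)
    show "AE y in lborel. \<bar>H y * ?k y\<bar> \<le> d (norm y) * ?k y"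
    proof (rule AE_mp[OF AE_conjI[OF AE_lborel_singleton[of x] AE_lborel_singleton[of "- x"]]], intro AE_I2 impI)
      fix y :: "real^3" assume "y \<noteq> x \<and> y \<noteq> - x"
      then have "0 \<le> ?k y"
        using even_kernel_ge[of x y] equation_minus_iff[of x y] by auto
      then show "\<bar>H y * ?k y\<bar> \<le> d (norm y) * ?k y"
        using le[of y] by (simp add: abs_mult mult_right_mono)
    qed
  qed (use int[OF H even le] int[OF dr _ dnn] in auto)
  also have "\<dots> = 4 * pi * excess R d (norm x)"
    using val[OF dr _ dnn] excess_altdef[OF d, of x] by simp
  finally have "\<bar>LINT y|lborel. H y * ?k y\<bar> / (4 * pi) \<le> excess R d (norm x)"
    by (simp add: divide_le_eq mult.commute)
  moreover have "potential H x - (LINT y|lborel. H y / sqrt ((norm x)\<^sup>2 + (norm y)\<^sup>2)) / (4 * pi) =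
      (LINT y|lborel. H y * ?k y) / (4 * pi)"
    unfolding potential_def val[OF H even le] by (simp add: diff_divide_distrib)
  ultimately show ?thesis
    by (simp add: abs_divide)
qed

text \<open>
  The radial function \<open>c\<close> can be subtracted from the density because its potential is radial.
\<close>

lemma potential_oscillation:
  assumes H: "bounded_source R H" and even: "\<And>y. H (- y) = H y"
    and c: "bounded_source R c" and d: "bounded_source R d"
    and le: "\<And>y. \<bar>H y - c (norm y)\<bar> \<le> d (norm y)"
    and x: "norm x = r" "norm x' = r"
  shows "\<bar>potential H x - potential H x'\<bar> \<le> 2 * excess R d r"
proof -
  define h where "h = (\<lambda>y. H y - c (norm y))"
  have cr: "bounded_source R (\<lambda>y :: real^3. c (norm y))"
    using c by (rule bounded_source_radial)
  have h: "bounded_source R h"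
    unfolding h_def using H cr by (rule bounded_source_diff)
  have he: "h (- y) = h y" for y
    by (simp add: h_def even)
  have hle: "\<bar>h y\<bar> \<le> d (norm y)" for y
    using le by (simp add: h_def)
  have "potential H z = potential h z + potential (\<lambda>y. c (norm y)) z" for z
    using potential_diff[OF H cr, of z] by (simp add: h_def)
  then have "potential H x - potential H x' = potential h x - potential h x'"
    by (simp add: potential_radial[OF c] x)
  then show ?thesis
    using potential_even_bound[OF h he d hle, of x] potential_even_bound[OF h he d hle, of x']
    unfolding x by linarith
qed

section \<open>The radial profile as a comparison function\<close>

text \<open>
  A bound that improves by the factor \<open>\<kappa>\<close> up to an error \<open>B\<close> can be iterated, and in the limit the initial
  bound \<open>N\<^sub>0\<close>, which only has to exist, is forgotten.
\<close>

lemma contraction_bound: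
  fixes a g :: "'i \<Rightarrow> real"
  assumes "0 \<le> N\<^sub>0" and start: "\<And>i. i \<in> I \<Longrightarrow> a i \<le> N\<^sub>0 * g i"
    and \<kappa>: "0 \<le> \<kappa>" "\<kappa> < 1" and "0 \<le> B"
    and step: "\<And>N i. 0 \<le> N \<Longrightarrow> (\<And>j. j \<in> I \<Longrightarrow> a j \<le> N * g j) \<Longrightarrow> i \<in> I \<Longrightarrow> a i \<le> (\<kappa> * N + B) * g i"
    and nonneg: "\<And>i. i \<in> I \<Longrightarrow> 0 \<le> g i" and "i \<in> I"
  shows "a i \<le> B / (1 - \<kappa>) * g i"
proof -
  have it: "\<forall>j\<in>I. a j \<le> (\<kappa> ^ n * N\<^sub>0 + B / (1 - \<kappa>)) * g j" for n
  proof (induction n)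
    case 0
    show ?case
    proof
      fix j assume j: "j \<in> I"
      have "N\<^sub>0 * g j \<le> (\<kappa> ^ 0 * N\<^sub>0 + B / (1 - \<kappa>)) * g j"
        using assms nonneg[OF j] by (intro mult_right_mono) auto
      then show "a j \<le> (\<kappa> ^ 0 * N\<^sub>0 + B / (1 - \<kappa>)) * g j"
        using start[OF j] by simp
    qed
  next
    case (Suc n)
    have eq: "\<kappa> * (\<kappa> ^ n * N\<^sub>0 + B / (1 - \<kappa>)) + B = \<kappa> ^ Suc n * N\<^sub>0 + B / (1 - \<kappa>)"
      using \<kappa> by (simp add: field_simps)
    have "0 \<le> \<kappa> ^ n * N\<^sub>0 + B / (1 - \<kappa>)"
      using assms by (intro add_nonneg_nonneg) auto
    from step[OF this] Suc show ?case unfolding eq by blast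
  qed
  have "(\<lambda>n. (\<kappa> ^ n * N\<^sub>0 + B / (1 - \<kappa>)) * g i) \<longlonglongrightarrow> (0 * N\<^sub>0 + B / (1 - \<kappa>)) * g i"
    using \<kappa> by (intro tendsto_intros LIMSEQ_power_zero) auto
  then show ?thesis
    using it \<open>i \<in> I\<close> by (intro LIMSEQ_le_const) auto
qed

definition pos_powr :: "real \<Rightarrow> real \<Rightarrow> real" where
  "pos_powr \<nu> x = max x 0 powr \<nu>"

lemma pos_powr_nonneg [simp]: "0 \<le> pos_powr \<nu> x"
  by (simp add: pos_powr_def)

lemma continuous_pos_powr:
  assumes "0 < \<nu>" "continuous_on S u"
  shows "continuous_on S (\<lambda>x. pos_powr \<nu> (u x))"
  unfolding pos_powr_def using assms
  by (intro continuous_on_powr' continuous_intros) auto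

text \<open>
  At \<open>0\<close> the difference quotient is \<open>pos_powr (\<nu> - 1)\<close>, which tends to \<open>0\<close> because \<open>\<nu> > 1\<close>.
\<close>

lemma pos_powr_has_real_derivative:
  assumes \<nu>: "1 < \<nu>"
  shows "(pos_powr \<nu> has_real_derivative \<nu> * pos_powr (\<nu> - 1) x) (at x)"
proof -
  consider "0 < x" | "x < 0" | "x = 0" by linarith
  then show ?thesis
  proof cases
    case 1
    have "((\<lambda>x. x powr \<nu>) has_real_derivative \<nu> * pos_powr (\<nu> - 1) x) (at x)"
      using has_real_derivative_powr[OF 1, of \<nu>] 1 by (simp add: pos_powr_def)
    moreover have "\<forall>\<^sub>F y in nhds x. pos_powr \<nu> y = y powr \<nu>"
      using 1 by (auto simp: pos_powr_def intro!: eventually_nhds_in_open[of "{0<..}", THEN eventually_mono])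
    ultimately show ?thesis
      by (subst DERIV_cong_ev[OF refl _ refl])
  next
    case 2
    have "((\<lambda>x. 0) has_real_derivative \<nu> * pos_powr (\<nu> - 1) x) (at x)"
      using 2 by (auto simp: pos_powr_def)
    moreover have "\<forall>\<^sub>F y in nhds x. pos_powr \<nu> y = 0"
      using 2 by (auto simp: pos_powr_def intro!: eventually_nhds_in_open[of "{..<0}", THEN eventually_mono])
    ultimately show ?thesis
      by (subst DERIV_cong_ev[OF refl _ refl])
  next
    case 3
    have "((\<lambda>h. pos_powr (\<nu> - 1) h) \<longlongrightarrow> pos_powr (\<nu> - 1) 0) (at 0)"
      using continuous_pos_powr[of "\<nu> - 1" UNIV "\<lambda>x. x"] \<nu>
      by (simp add: continuous_on_eq_continuous_at isCont_def)
    moreover have "pos_powr \<nu> h / h = pos_powr (\<nu> - 1) h" if "h \<noteq> 0" for h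
      using that by (cases "0 < h") (auto simp: pos_powr_def powr_diff)
    ultimately have "((\<lambda>h. (pos_powr \<nu> (0 + h) - pos_powr \<nu> 0) / h) \<longlongrightarrow> 0) (at 0)"
      using \<nu> by (subst tendsto_cong[where g = "pos_powr (\<nu> - 1)"])
        (auto simp: pos_powr_def[abs_def] eventually_at_filter)
    then show ?thesis
      unfolding 3 using \<nu> by (simp add: DERIV_def pos_powr_def)
  qed
qed

text \<open>
  The right-hand side is \<open>9/10\<close> of the kernel \<open>s\<^sup>2 min r s / (3 (max r s)\<^sup>2)\<close> of the first spherical
  harmonics. With \<open>t = min r s / max r s\<close> the claim is \<open>1 - 1 / \<surd>(1 + t\<^sup>2) \<le> 3/10 t\<close> on \<open>[0, 1]\<close>; the
  optimal constant there is \<open>1 - 1 / \<surd>2 < 3/10\<close>, attained at \<open>t = 1\<close>. Only a constant below \<open>1/3\<close> makes the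
  oscillation argument a contraction.
\<close>

lemma excess_kernel_le:
  fixes r s :: real
  assumes "0 < r" "0 \<le> s"
  shows "s\<^sup>2 / max r s - s\<^sup>2 / sqrt (r\<^sup>2 + s\<^sup>2) \<le> 3/10 * (s\<^sup>2 * min r s / (max r s)\<^sup>2)"
proof -
  define M t where "M = max r s" and "t = min r s / max r s"
  have M: "0 < M" and t: "0 \<le> t" "t \<le> 1"
    using assms by (auto simp: M_def t_def divide_le_eq_1 min_def max_def)
  have "r\<^sup>2 + s\<^sup>2 = M\<^sup>2 * (1 + t\<^sup>2)"
    using assms by (auto simp: M_def t_def min_def max_def field_simps)
  then have sq: "sqrt (r\<^sup>2 + s\<^sup>2) = M * sqrt (1 + t\<^sup>2)"
    using M by (simp add: real_sqrt_mult)
  have "(1 - 3/10 * t) \<le> 1 / sqrt (1 + t\<^sup>2)"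
  proof -
    have t3: "t ^ 3 \<le> t ^ 2"
      using t by (intro power_decreasing) auto
    \<comment> \<open>The estimate \<open>t\<^sup>3 \<le> t\<^sup>2\<close> reduces the cubic to a quadratic with negative discriminant.\<close>
    have "- (6/10) + 109/100 * t - 51/100 * t\<^sup>2 \<le> 0"
    proof -
      have "0 \<le> (t - 109/102)\<^sup>2" by simp
      then show ?thesis by (simp add: power2_eq_square algebra_simps)
    qed
    then have "- (6/10) + 109/100 * t - 6/10 * t\<^sup>2 + 9/100 * t^3 \<le> 0"
      using t3 by linarith
    then have "t * (- (6/10) + 109/100 * t - 6/10 * t\<^sup>2 + 9/100 * t^3) \<le> 0"
      using t by (simp add: mult_nonneg_nonpos)
    moreover have "(1 - 3/10 * t)\<^sup>2 * (1 + t\<^sup>2) = 1 + t * (- (6/10) + 109/100 * t - 6/10 * t\<^sup>2 + 9/100 * t^3)"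
      by (simp add: power2_eq_square power3_eq_cube field_simps)
    ultimately have "(1 - 3/10 * t)\<^sup>2 * (1 + t\<^sup>2) \<le> 1"
      by linarith
    then have "sqrt ((1 - 3/10 * t)\<^sup>2 * (1 + t\<^sup>2)) \<le> 1"
      by simp
    then have "(1 - 3/10 * t) * sqrt (1 + t\<^sup>2) \<le> 1"
      using t by (simp add: real_sqrt_mult)
    then show ?thesis
      by (simp add: le_divide_eq add_pos_nonneg)
  qed
  then have "1 - 1 / sqrt (1 + t\<^sup>2) \<le> 3/10 * t" by simp
  then have "s\<^sup>2 / M * (1 - 1 / sqrt (1 + t\<^sup>2)) \<le> s\<^sup>2 / M * (3/10 * t)"
    using M by (intro mult_left_mono) auto
  then show ?thesis
    unfolding sq unfolding M_def[symmetric] t_def using M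
    by (simp add: M_def[symmetric] algebra_simps power2_eq_square)
qed

lemma continuous_on_excess_integrand:
  assumes "0 < r" "continuous_on {0..R} d"
  shows "continuous_on {0..R} (\<lambda>s. d s * (s\<^sup>2 / max r s - s\<^sup>2 / sqrt (r\<^sup>2 + s\<^sup>2)))"
  using assms by (intro continuous_intros) (auto simp: add_pos_nonneg max_def split: if_splits)

lemma LINT_eq_integral:
  fixes f :: "real \<Rightarrow> real"
  assumes "continuous_on {a..b} f"
  shows "(LINT s:{a..b}|lborel. f s) = integral {a..b} f"
  using borel_integrable_atLeastAtMost'[OF assms] by (rule set_borel_integral_eq_integral(2))

lemma excess_eq_integral:
  assumes "0 < r" "continuous_on {0..R} d"
  shows "excess R d r = integral {0..R} (\<lambda>s. d s * (s\<^sup>2 / max r s - s\<^sup>2 / sqrt (r\<^sup>2 + s\<^sup>2)))"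
  unfolding excess_def by (rule LINT_eq_integral[OF continuous_on_excess_integrand[OF assms]])

lemma excess_add:
  assumes "0 < r" "continuous_on {0..R} d" "continuous_on {0..R} d'"
  shows "excess R (\<lambda>s. a * d s + d' s) r = a * excess R d r + excess R d' r"
proof -
  note c = continuous_on_excess_integrand[OF assms(1)]
  have "continuous_on {0..R} (\<lambda>s. a * d s + d' s)"
    using assms by (intro continuous_intros)
  then show ?thesis
    using integrable_continuous_real[OF c[OF assms(2)]] integrable_continuous_real[OF c[OF assms(3)]]
    by (simp add: excess_eq_integral assms distrib_right mult.assoc integral_add integrable_on_mult_right)
qed

lemma excess_const_le:
  assumes "0 < r" "0 \<le> R" "0 \<le> B"
  shows "excess R (\<lambda>_. B) r \<le> 3/10 * B * R * r"
proof -
  have "integral {0..R} (\<lambda>s. B * (s\<^sup>2 / max r s - s\<^sup>2 / sqrt (r\<^sup>2 + s\<^sup>2))) \<le> integral {0..R} (\<lambda>s. B * (3/10 * r))"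
  proof (rule integral_le)
    fix s assume s: "s \<in> {0..R}"
    have "s\<^sup>2 * min r s / (max r s)\<^sup>2 \<le> r"
    proof -
      have "s\<^sup>2 * min r s \<le> (max r s)\<^sup>2 * r"
        using s assms by (intro mult_mono power_mono) auto
      then show ?thesis using assms s by (simp add: divide_le_eq max_def mult.commute)
    qed
    then show "B * (s\<^sup>2 / max r s - s\<^sup>2 / sqrt (r\<^sup>2 + s\<^sup>2)) \<le> B * (3/10 * r)"
      using order_trans[OF excess_kernel_le[of r s] mult_left_mono[of _ r "3/10"]] assms s
      by (intro mult_left_mono) auto
  qed (use assms in \<open>auto intro!: integrable_continuous_real continuous_on_excess_integrand\<close>)
  then show ?thesis
    using assms by (simp add: excess_eq_integral mult_ac)
qed

text \<open>
  The nonrotating configuration, given by the integral equation that results from the shell theorem.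
\<close>

locale radial_profile =
  fixes R \<nu> :: real and \<theta> :: "real \<Rightarrow> real"
  assumes R_pos: "0 < R" and \<nu>_gt_1: "1 < \<nu>"
    and continuous_\<theta>: "continuous_on {0..R} \<theta>"
    and \<theta>_eq: "\<And>r. r \<in> {0..R} \<Longrightarrow> \<theta> r = 1 - integral {0..r} (\<lambda>s. (s - s\<^sup>2 / r) * pos_powr \<nu> (\<theta> s))"
begin

definition f :: "real \<Rightarrow> real" where "f s = pos_powr \<nu> (\<theta> s)"

text \<open>
  The derivative of \<open>pos_powr \<nu>\<close> along \<open>\<theta>\<close>, the coefficient of the linearized equation.
\<close>

definition q :: "real \<Rightarrow> real" where "q s = \<nu> * pos_powr (\<nu> - 1) (\<theta> s)"

definition mass_in :: "real \<Rightarrow> real" where "mass_in r = integral {0..r} (\<lambda>s. s\<^sup>2 * f s)"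

text \<open>
  The function \<open>- \<theta>'\<close>, see \<open>\<theta>_derivative\<close>.
\<close>

definition p :: "real \<Rightarrow> real" where "p r = mass_in r / r\<^sup>2"

lemma continuous_f: "continuous_on {0..R} f"
  unfolding f_def using \<nu>_gt_1 by (intro continuous_pos_powr continuous_\<theta>) auto

lemma continuous_q: "continuous_on {0..R} q"
  unfolding q_def using \<nu>_gt_1 by (intro continuous_on_mult_left continuous_pos_powr continuous_\<theta>) auto

lemma f_nonneg: "0 \<le> f s"
  by (simp add: f_def)

lemma q_nonneg: "0 \<le> q s"
  using \<nu>_gt_1 by (simp add: q_def)

lemma \<theta>_0: "\<theta> 0 = 1"
  using \<theta>_eq[of 0] R_pos by simp

lemma f_0: "f 0 = 1"
  by (simp add: f_def \<theta>_0 pos_powr_def)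

lemma integrable_f: "r \<le> R \<Longrightarrow> (\<lambda>s. s * f s) integrable_on {0..r}" "r \<le> R \<Longrightarrow> (\<lambda>s. s\<^sup>2 * f s) integrable_on {0..r}"
  using continuous_f by (auto intro!: integrable_continuous_real continuous_intros intro: continuous_on_subset)

lemma \<theta>_mass_in: "r \<in> {0..R} \<Longrightarrow> \<theta> r = 1 - integral {0..r} (\<lambda>s. s * f s) + mass_in r / r"
proof -
  assume r: "r \<in> {0..R}"
  have "integral {0..r} (\<lambda>s. (s - s\<^sup>2 / r) * f s) = integral {0..r} (\<lambda>s. s * f s - (s\<^sup>2 * f s) / r)"
    by (simp add: algebra_simps)
  also have "\<dots> = integral {0..r} (\<lambda>s. s * f s) - mass_in r / r"
    using integrable_f[of r] r by (simp add: integral_diff mass_in_def integrable_on_divide)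
  finally show ?thesis
    using \<theta>_eq[OF r] by (simp add: f_def)
qed

lemma mass_in_derivative:
  assumes "r \<in> {0<..<R}"
  shows "(mass_in has_real_derivative r\<^sup>2 * f r) (at r)"
proof -
  have "((\<lambda>r. integral {0..r} (\<lambda>s. s\<^sup>2 * f s)) has_real_derivative r\<^sup>2 * f r) (at r within {0..R})"
    using assms continuous_f by (intro integral_has_real_derivative continuous_intros) auto
  then show ?thesis
    using assms by (simp add: mass_in_def[abs_def] at_within_Icc_at)
qed

lemma \<theta>_derivative:
  assumes "r \<in> {0<..<R}"
  shows "(\<theta> has_real_derivative - p r) (at r)"
proof -
  have "((\<lambda>r. integral {0..r} (\<lambda>s. s * f s)) has_real_derivative r * f r) (at r within {0..R})"
    using assms continuous_f by (intro integral_has_real_derivative continuous_intros) auto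
  then have 1: "((\<lambda>r. integral {0..r} (\<lambda>s. s * f s)) has_real_derivative r * f r) (at r)"
    using assms by (simp add: at_within_Icc_at)
  have "((\<lambda>r. 1 - integral {0..r} (\<lambda>s. s * f s) + mass_in r / r) has_real_derivative - p r) (at r)"
    using assms
    by (auto intro!: derivative_eq_intros 1 mass_in_derivative simp: p_def power2_eq_square field_simps)
  moreover have "\<forall>\<^sub>F s in nhds r. \<theta> s = 1 - integral {0..s} (\<lambda>s. s * f s) + mass_in s / s"
    using assms by (intro eventually_nhds_in_open[of "{0<..<R}", THEN eventually_mono]) (auto intro: \<theta>_mass_in)
  ultimately show ?thesis
    by (subst DERIV_cong_ev[OF refl _ refl])
qed

lemma f_derivative:
  assumes "r \<in> {0<..<R}"
  shows "(f has_real_derivative - q r * p r) (at r)"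
  using DERIV_chain2[OF pos_powr_has_real_derivative[OF \<nu>_gt_1] \<theta>_derivative[OF assms]]
  by (simp add: f_def[abs_def] q_def)

lemma continuous_mass_in: "continuous_on {0..R} mass_in"
  unfolding mass_in_def[abs_def]
  by (rule indefinite_integral_continuous_1[OF integrable_f(2)]) simp

lemma mass_in_mono:
  assumes "0 \<le> r" "r \<le> s" "s \<le> R"
  shows "mass_in r \<le> mass_in s"
  unfolding mass_in_def using assms integrable_f(2)[of r] integrable_f(2)[of s]
  by (intro integral_subset_le) (auto simp: f_nonneg)

lemma mass_in_nonneg: "0 \<le> r \<Longrightarrow> r \<le> R \<Longrightarrow> 0 \<le> mass_in r"
  using mass_in_mono[of 0 r] by (simp add: mass_in_def)

lemma p_nonneg: "0 \<le> r \<Longrightarrow> r \<le> R \<Longrightarrow> 0 \<le> p r"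
  by (simp add: p_def mass_in_nonneg)

text \<open>
  Together with \<open>p_lower\<close> this makes \<open>p\<close> comparable to \<open>r\<close>, so that errors of order \<open>r\<close> can be measured in
  terms of \<open>p\<close>.
\<close>

lemma p_upper: "\<exists>C>0. \<forall>r\<in>{0..R}. p r \<le> C * r"
proof -
  obtain B where B: "\<And>s. s \<in> {0..R} \<Longrightarrow> f s \<le> B"
    using continuous_attains_sup[OF _ _ continuous_f] R_pos by force
  have B0: "1 \<le> B" using B[of 0] f_0 R_pos by simp
  have "p r \<le> B * r" if r: "r \<in> {0..R}" for r
  proof (cases "r = 0")
    case False
    have "mass_in r \<le> integral {0..r} (\<lambda>s. r\<^sup>2 * B)"
      unfolding mass_in_def using r integrable_f(2)[of r] B
      by (intro integral_le) (auto intro!: mult_mono power_mono simp: f_nonneg)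
    also have "\<dots> = B * r * r\<^sup>2"
      using r by simp
    finally show ?thesis
      using False by (simp add: p_def divide_le_eq)
  qed (simp add: p_def)
  with B0 show ?thesis by (intro exI[of _ B]) auto
qed

lemma mass_in_lower_near_0: "\<exists>\<delta>>0. \<delta> \<le> R \<and> (\<forall>r\<in>{0..\<delta>}. r ^ 3 / 6 \<le> mass_in r)"
proof -
  have "0 \<in> {0..R}" using R_pos by simp
  then obtain d where d: "0 < d" "\<And>s. s \<in> {0..R} \<Longrightarrow> dist s 0 < d \<Longrightarrow> dist (f s) (f 0) < 1/2"
    using continuous_f[unfolded continuous_on_iff, rule_format, of 0 "1/2"] by auto
  define \<delta> where "\<delta> = min R (d / 2)"
  have \<delta>: "0 < \<delta>" "\<delta> \<le> R" "\<delta> < d"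
    using d R_pos by (auto simp: \<delta>_def)
  have "r ^ 3 / 6 \<le> mass_in r" if r: "r \<in> {0..\<delta>}" for r
  proof -
    \<comment> \<open>Hence \<open>mass_in r\<close> is at least \<open>\<integral> s\<^sup>2 / 2 = r\<^sup>3 / 6\<close>.\<close>
    have half: "1/2 \<le> f s" if "s \<in> {0..r}" for s
      using d(2)[of s] that r \<delta> abs_ge_minus_self[of "f s - 1"] by (auto simp: f_0 dist_real_def)
    have "((\<lambda>s. s\<^sup>2 * (1/2)) has_integral (r ^ 3 / 6 - 0 ^ 3 / 6)) {0..r}"
      using r by (intro fundamental_theorem_of_calculus)
        (auto intro!: derivative_eq_intros simp flip: has_real_derivative_iff_has_vector_derivative)
    moreover have "((\<lambda>s. s\<^sup>2 * f s) has_integral mass_in r) {0..r}"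
      unfolding mass_in_def using r \<delta> integrable_f(2)[of r] by (intro integrable_integral) auto
    ultimately have "r ^ 3 / 6 - 0 ^ 3 / 6 \<le> mass_in r"
      by (rule has_integral_le) (rule mult_left_mono[OF half], auto)
    then show ?thesis by simp
  qed
  with \<delta> show ?thesis by blast
qed

text \<open>
  Near the origin \<open>f\<close> is close to \<open>1\<close>, and \<open>mass_in\<close> cannot decrease further out.
\<close>

lemma p_lower: "\<exists>c>0. \<forall>r\<in>{0..R}. c * r \<le> p r"
proof -
  obtain \<delta> where \<delta>: "0 < \<delta>" "\<delta> \<le> R" "\<And>r. r \<in> {0..\<delta>} \<Longrightarrow> r ^ 3 / 6 \<le> mass_in r"
    using mass_in_lower_near_0 by blast
  define c where "c = \<delta> ^ 3 / (6 * R ^ 3)"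
  have c: "0 < c" using \<delta> R_pos by (simp add: c_def)
  have "c * r ^ 3 \<le> mass_in r" if r: "r \<in> {0..R}" for r
  proof (cases "r \<le> \<delta>")
    case True
    have "c \<le> 1 / 6"
      using power_mono[of \<delta> R 3] \<delta> R_pos by (simp add: c_def divide_le_eq)
    then have "c * r ^ 3 \<le> 1 / 6 * r ^ 3"
      using r by (intro mult_right_mono) auto
    then show ?thesis using \<delta>(3)[of r] True r by simp
  next
    case False
    have "c * r ^ 3 \<le> c * R ^ 3"
      using r c by (intro mult_left_mono power_mono) auto
    also have "\<dots> = \<delta> ^ 3 / 6"
      using R_pos by (simp add: c_def)
    also have "\<dots> \<le> mass_in \<delta>" using \<delta> by auto
    also have "\<dots> \<le> mass_in r" using \<delta> False r by (intro mass_in_mono) auto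
    finally show ?thesis .
  qed
  moreover have "c * r * r\<^sup>2 = c * r ^ 3" for r
    by (simp add: power2_eq_square power3_eq_cube)
  ultimately have "c * r * r\<^sup>2 \<le> mass_in r" if "r \<in> {0..R}" for r
    using that by (simp only:)
  then have "c * r \<le> p r" if "r \<in> {0..R}" for r
    using that by (cases "r = 0") (auto simp: p_def le_divide_eq)
  with c show ?thesis by blast
qed

lemma continuous_p: "continuous_on {0..R} p"
proof -
  obtain C where C: "0 < C" "\<And>r. r \<in> {0..R} \<Longrightarrow> p r \<le> C * r"
    using p_upper by blast
  have "continuous (at r within {0..R}) p" if r: "r \<in> {0..R}" for r
  proof (cases "r = 0")
    case True
    have "(p \<longlongrightarrow> 0) (at 0 within {0..R})"
    proof (rule tendsto_sandwich[of "\<lambda>_. 0" _ _ "\<lambda>r. C * r"])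
      show "((\<lambda>r. C * r) \<longlongrightarrow> 0) (at 0 within {0..R})"
        by (rule tendsto_eq_intros | simp)+
    qed (auto simp: eventually_at_filter C p_nonneg intro!: always_eventually)
    then show ?thesis
      unfolding True by (simp add: continuous_within p_def)
  next
    case False
    have "continuous (at r within {0..R}) mass_in"
      using continuous_mass_in r by (simp add: continuous_on_eq_continuous_within)
    then show ?thesis
      unfolding p_def[abs_def] using False by (intro continuous_intros) auto
  qed
  then show ?thesis by (simp add: continuous_on_eq_continuous_within)
qed

text \<open>
  By \<open>excess_kernel_le\<close> it is enough to integrate \<open>q p = - f'\<close> against the kernel \<open>s\<^sup>2 min r s / (max r s)\<^sup>2\<close>.
  Integration by parts gives \<open>3 p r - r f r\<close> from the inside and \<open>r f r - r f R\<close> from the outside; the sum is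
  at most \<open>3 p r\<close>. This is the derivative of the equation of \<open>\<theta>\<close> in disguise.
\<close>

lemma excess_q_p_le:
  assumes r: "0 < r" "r \<le> R"
  shows "excess R (\<lambda>s. q s * p s) r \<le> 9/10 * p r"
proof -
  let ?k = "\<lambda>s. s\<^sup>2 * min r s / (max r s)\<^sup>2"
  have cqp: "continuous_on {0..R} (\<lambda>s. q s * p s)"
    by (intro continuous_intros continuous_q continuous_p)
  have "((\<lambda>s. q s * p s * s ^ 3 / r\<^sup>2) has_integral
      (3 * mass_in r - r ^ 3 * f r) / r\<^sup>2 - (3 * mass_in 0 - 0 ^ 3 * f 0) / r\<^sup>2) {0..r}"
  proof (rule fundamental_theorem_of_calculus_interior)
    show "continuous_on {0..r} (\<lambda>s. (3 * mass_in s - s ^ 3 * f s) / r\<^sup>2)"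
      using r by (intro continuous_intros continuous_on_subset[OF continuous_mass_in] continuous_on_subset[OF continuous_f]) auto
    fix s assume "s \<in> {0<..<r}"
    then have s: "s \<in> {0<..<R}" using r by auto
    show "((\<lambda>s. (3 * mass_in s - s ^ 3 * f s) / r\<^sup>2) has_vector_derivative q s * p s * s ^ 3 / r\<^sup>2) (at s)"
      unfolding has_real_derivative_iff_has_vector_derivative[symmetric] using r
      by (auto intro!: derivative_eq_intros mass_in_derivative[OF s] f_derivative[OF s]
            simp: field_simps power2_eq_square power3_eq_cube power4_eq_xxxx)
  qed (use r in auto)
  then have inner: "((\<lambda>s. q s * p s * ?k s) has_integral (3 * p r - r * f r)) {0..r}"
    by (rule has_integral_eq_rhs[OF has_integral_eq, rotated])
       (use r in \<open>auto simp: mass_in_def p_def min_def max_def power2_eq_square power3_eq_cube field_simps\<close>)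
  have "((\<lambda>s. r * (q s * p s)) has_integral - (r * f R) - - (r * f r)) {r..R}"
  proof (rule fundamental_theorem_of_calculus_interior)
    show "continuous_on {r..R} (\<lambda>s. - (r * f s))"
      using r by (intro continuous_intros continuous_on_subset[OF continuous_f]) auto
    fix s assume "s \<in> {r<..<R}"
    then have s: "s \<in> {0<..<R}" using r by auto
    show "((\<lambda>s. - (r * f s)) has_vector_derivative r * (q s * p s)) (at s)"
      unfolding has_real_derivative_iff_has_vector_derivative[symmetric]
      by (auto intro!: derivative_eq_intros f_derivative[OF s])
  qed (use r in auto)
  then have outer: "((\<lambda>s. q s * p s * ?k s) has_integral - (r * f R) - - (r * f r)) {r..R}"
    by (rule has_integral_eq[rotated]) (use r in \<open>auto simp: min_def max_def power2_eq_square field_simps\<close>)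
  have all: "((\<lambda>s. q s * p s * ?k s) has_integral (3 * p r - r * f r) + (- (r * f R) - - (r * f r))) {0..R}"
    using r by (intro has_integral_combine[OF _ _ inner outer]) auto
  have "excess R (\<lambda>s. q s * p s) r \<le> 3/10 * (3 * p r - r * f R)"
    unfolding excess_eq_integral[OF r(1) cqp]
  proof (rule has_integral_le[OF integrable_integral])
    show "(\<lambda>s. q s * p s * (s\<^sup>2 / max r s - s\<^sup>2 / sqrt (r\<^sup>2 + s\<^sup>2))) integrable_on {0..R}"
      using r by (intro integrable_continuous_real continuous_on_excess_integrand cqp) auto
    show "((\<lambda>s. 3/10 * (q s * p s * ?k s)) has_integral 3/10 * (3 * p r - r * f R)) {0..R}"
      using has_integral_mult_right[OF all, of "3/10"] by simp
    fix s assume s: "s \<in> {0..R}"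
    then have "q s * p s * (s\<^sup>2 / max r s - s\<^sup>2 / sqrt (r\<^sup>2 + s\<^sup>2)) \<le> q s * p s * (3/10 * ?k s)"
      using excess_kernel_le[of r s] r by (intro mult_left_mono mult_nonneg_nonneg q_nonneg p_nonneg) auto
    then show "q s * p s * (s\<^sup>2 / max r s - s\<^sup>2 / sqrt (r\<^sup>2 + s\<^sup>2)) \<le> 3/10 * (q s * p s * ?k s)"
      by (simp add: mult_ac)
  qed
  also have "\<dots> \<le> 9/10 * p r"
    using r f_nonneg[of R] by simp
  finally show ?thesis .
qed

end

section \<open>Densities in polar coordinates\<close>

text \<open>
  The representative of \<open>(r, \<zeta>)\<close> at which \<open>op_K\<close> evaluates the potential.
\<close>

definition axis_point :: "real \<Rightarrow> real \<Rightarrow> real^3" where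
  "axis_point r \<zeta> = vector [r * sqrt (1 - \<zeta>\<^sup>2), 0, r * \<zeta>]"

definition source :: "real \<Rightarrow> (real \<Rightarrow> real \<Rightarrow> real) \<Rightarrow> real^3 \<Rightarrow> real" where
  "source R u y = indicator (cball 0 R) y * flat u y"

lemma norm_axis_point:
  assumes "0 \<le> r" "\<zeta> \<in> {-1..1}"
  shows "norm (axis_point r \<zeta>) = r"
proof -
  have "\<zeta>\<^sup>2 \<le> 1" using assms(2) by (simp add: abs_square_le_1 abs_le_iff)
  then have "norm (axis_point r \<zeta>) = sqrt (r\<^sup>2 * (1 - \<zeta>\<^sup>2) + r\<^sup>2 * \<zeta>\<^sup>2)"
    by (simp add: norm_real3 axis_point_def power_mult_distrib)
  also have "r\<^sup>2 * (1 - \<zeta>\<^sup>2) + r\<^sup>2 * \<zeta>\<^sup>2 = r\<^sup>2"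
    by (simp add: algebra_simps)
  finally show ?thesis using assms by simp
qed

lemma op_K_eq_potential: "op_K R u r \<zeta> = potential (source R u) (axis_point r \<zeta>)"
  by (simp add: op_K_def newton_pot_def potential_def source_def axis_point_def set_lebesgue_integral_def)

lemma flat_coordinates:
  assumes "norm (y :: real^3) \<le> R"
  shows "norm y \<in> {0..R}" "y $ 3 / norm y \<in> {-1..1}"
proof -
  have "\<bar>y $ 3 / norm y\<bar> \<le> 1"
    using component_le_norm_cart[of y 3] by (cases "y = 0") (auto simp: abs_divide divide_le_eq_1)
  then show "y $ 3 / norm y \<in> {-1..1}" unfolding abs_le_iff atLeastAtMost_iff by linarith
qed (use assms in auto)

lemma dom_E_compact: "compact (dom_E R)"
  unfolding dom_E_def by (intro compact_Times) auto

lemma space_E_continuous: "u \<in> space_E R \<Longrightarrow> continuous_on (dom_E R) (\<lambda>(r, \<zeta>). u r \<zeta>)"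
  by (simp add: space_E_def)

lemma continuous_on_dom_E_bounded:
  assumes "continuous_on (dom_E R) (\<lambda>(r, \<zeta>). u r \<zeta>)"
  obtains B where "0 < (B :: real)" "\<And>r \<zeta>. r \<in> {0..R} \<Longrightarrow> \<zeta> \<in> {-1..1} \<Longrightarrow> \<bar>u r \<zeta>\<bar> \<le> B"
proof -
  have "bounded ((\<lambda>(r, \<zeta>). u r \<zeta>) ` dom_E R)"
    by (intro compact_imp_bounded compact_continuous_image assms dom_E_compact)
  then obtain B where "0 < B" "\<And>x. x \<in> dom_E R \<Longrightarrow> norm (case x of (r, \<zeta>) \<Rightarrow> u r \<zeta>) \<le> B"
    unfolding bounded_pos by (metis imageI)
  then show thesis
    using that[of B] unfolding dom_E_def by fastforce
qed

lemma bounded_source_source: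
  assumes "u \<in> space_E R"
  shows "bounded_source R (source R u)"
proof -
  obtain B where B: "0 < B" "\<And>r \<zeta>. r \<in> {0..R} \<Longrightarrow> \<zeta> \<in> {-1..1} \<Longrightarrow> \<bar>u r \<zeta>\<bar> \<le> B"
    using continuous_on_dom_E_bounded[OF space_E_continuous[OF assms]] by blast
  have "(\<lambda>x. indicator (dom_E R) x *\<^sub>R (case x of (r, \<zeta>) \<Rightarrow> u r \<zeta>)) \<in> borel_measurable borel"
    using dom_E_compact[of R, THEN compact_imp_closed]
    by (intro borel_measurable_continuous_on_indicator space_E_continuous assms) auto
  then have "(\<lambda>y :: real^3. indicator (dom_E R) (norm y, y $ 3 / norm y) *\<^sub>R
      (case (norm y, y $ 3 / norm y) of (r, \<zeta>) \<Rightarrow> u r \<zeta>)) \<in> borel_measurable borel"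
    by (rule measurable_compose[rotated]) (intro borel_measurable_Pair, measurable)
  moreover have "source R u y = indicator (dom_E R) (norm y, y $ 3 / norm y) *\<^sub>R
      (case (norm y, y $ 3 / norm y) of (r, \<zeta>) \<Rightarrow> u r \<zeta>)" for y
    using flat_coordinates[of y R] by (auto simp: source_def flat_def dom_E_def split: split_indicator)
  ultimately have "source R u \<in> borel_measurable borel"
    by (simp add: measurable_cong[of borel "source R u"])
  moreover have "\<bar>source R u y\<bar> \<le> B" for y
    using B flat_coordinates[of y R] by (auto simp: source_def flat_def split: split_indicator)
  ultimately show ?thesis
    unfolding bounded_source_def by (auto simp: source_def)
qed

lemma source_even:
  assumes "u \<in> space_E R"
  shows "source R u (- y) = source R u y"
proof (cases "norm y \<le> R")
  case True
  then have "(norm y, y $ 3 / norm y) \<in> dom_E R"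
    using flat_coordinates[OF True] by (simp add: dom_E_def)
  then have "u (norm y) (- (y $ 3 / norm y)) = u (norm y) (y $ 3 / norm y)"
    using assms unfolding space_E_def by blast
  then show ?thesis by (simp add: source_def flat_def indicator_def)
qed (simp add: source_def)

lemma bounded_source_cutoff:
  assumes "continuous_on {0..R} g"
  shows "bounded_source R (\<lambda>s :: real. indicator {0..R} s * g s)"
proof -
  have "bounded (g ` {0..R})"
    by (intro compact_imp_bounded compact_continuous_image assms) auto
  then obtain B where B: "0 < B" "\<And>s. s \<in> {0..R} \<Longrightarrow> norm (g s) \<le> B"
    unfolding bounded_pos by auto
  have "(\<lambda>s. indicator {0..R} s *\<^sub>R g s) \<in> borel_measurable borel"
    by (intro borel_measurable_continuous_on_indicator assms) auto
  with B show ?thesis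
    unfolding bounded_source_def by (auto intro!: exI[of _ B] split: split_indicator)
qed

lemma op_K_oscillation:
  assumes u: "u \<in> space_E R" and c: "bounded_source R c" and g: "continuous_on {0..R} g"
    and le: "\<And>r \<zeta>. r \<in> {0..R} \<Longrightarrow> \<zeta> \<in> {-1..1} \<Longrightarrow> \<bar>u r \<zeta> - c r\<bar> \<le> g r"
    and r: "0 \<le> r" "r \<le> R" and \<zeta>: "\<zeta> \<in> {-1..1}" "\<zeta>' \<in> {-1..1}"
  shows "\<bar>op_K R u r \<zeta> - op_K R u r \<zeta>'\<bar> \<le> 2 * excess R g r"
proof -
  let ?d = "\<lambda>s. indicator {0..R} s * g s"
  have "\<bar>source R u y - c (norm y)\<bar> \<le> ?d (norm y)" for y
  proof (cases "norm y \<le> R")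
    case True
    then show ?thesis
      using le[OF flat_coordinates[OF True]] by (simp add: source_def flat_def)
  next
    case False
    then have "c (norm y) = 0"
      using c by (auto simp: bounded_source_def)
    then show ?thesis using False by (simp add: source_def)
  qed
  then have "\<bar>op_K R u r \<zeta> - op_K R u r \<zeta>'\<bar> \<le> 2 * excess R ?d r"
    unfolding op_K_eq_potential using r \<zeta>
    by (intro potential_oscillation[OF bounded_source_source[OF u] source_even[OF u] c bounded_source_cutoff[OF g]])
       (auto simp: norm_axis_point)
  also have "excess R ?d r = excess R g r"
    unfolding excess_def by (intro set_lebesgue_integral_cong) auto
  finally show ?thesis .
qed

text \<open>
  The supremum of continuous functions is lower semicontinuous, hence measurable. Radii are clamped to
  \<open>[0, R]\<close> in order to have functions that are continuous on the whole line.
\<close>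

lemma measurable_radial_sup:
  fixes w :: "real \<Rightarrow> real \<Rightarrow> real"
  assumes w: "continuous_on (dom_E R) (\<lambda>(r, \<zeta>). w r \<zeta>)" and "0 \<le> R"
  obtains M where "M \<in> borel_measurable borel"
    "\<And>r \<zeta>. r \<in> {0..R} \<Longrightarrow> \<zeta> \<in> {-1..1} \<Longrightarrow> w r \<zeta> \<le> M r"
    "\<And>r B. r \<in> {0..R} \<Longrightarrow> (\<And>\<zeta>. \<zeta> \<in> {-1..1} \<Longrightarrow> w r \<zeta> \<le> B) \<Longrightarrow> M r \<le> B"
proof -
  obtain B where B: "0 < B" "\<And>r \<zeta>. r \<in> {0..R} \<Longrightarrow> \<zeta> \<in> {-1..1} \<Longrightarrow> \<bar>w r \<zeta>\<bar> \<le> B"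
    using continuous_on_dom_E_bounded[OF w] by blast
  define k where "k r = max 0 (min R r)" for r :: real
  have k: "k r \<in> {0..R}" for r using \<open>0 \<le> R\<close> by (simp add: k_def)
  have kr: "k r = r" if "r \<in> {0..R}" for r using that by (simp add: k_def)
  define M where "M r = (SUP \<zeta>\<in>{-1..1}. w (k r) \<zeta>)" for r
  have bdd: "bdd_above ((\<lambda>\<zeta>. w (k r) \<zeta>) ` {-1..1})" for r
    using B(2)[OF k] by (intro bdd_aboveI[of _ B]) (auto simp: abs_le_iff)
  have "continuous_on UNIV (\<lambda>r. w (k r) \<zeta>)" if "\<zeta> \<in> {-1..1}" for \<zeta>
  proof -
    have "continuous_on UNIV (\<lambda>r. (k r, \<zeta>))"
      unfolding k_def by (intro continuous_intros)
    moreover have "(\<lambda>r. (k r, \<zeta>)) ` UNIV \<subseteq> dom_E R"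
      using k that by (auto simp: dom_E_def)
    ultimately show ?thesis
      using continuous_on_compose2[OF w, of UNIV "\<lambda>r. (k r, \<zeta>)"] by (simp only: prod.case)
  qed
  then have op: "open {r. a < w (k r) \<zeta>}" if "\<zeta> \<in> {-1..1}" for a \<zeta>
    using that by (intro open_Collect_less) auto
  have "{r. a < M r} = (\<Union>\<zeta>\<in>{-1..1}. {r. a < w (k r) \<zeta>})" for a
    unfolding M_def using bdd by (subst less_cSUP_iff) auto
  then have "open {r. a < M r}" for a
    using op by auto
  then have "M \<in> borel_measurable borel"
    by (subst borel_measurable_iff_greater) auto
  moreover have "w r \<zeta> \<le> M r" if "r \<in> {0..R}" "\<zeta> \<in> {-1..1}" for r \<zeta>
    using cSUP_upper[OF that(2) bdd[of r]] that by (simp add: M_def kr)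
  moreover have "M r \<le> C" if "r \<in> {0..R}" "\<And>\<zeta>. \<zeta> \<in> {-1..1} \<Longrightarrow> w r \<zeta> \<le> C" for r C
    unfolding M_def kr[OF that(1)] by (rule cSUP_least) (use that in auto)
  ultimately show thesis by (rule that)
qed

text \<open>
  The midpoint of the range of \<open>w r\<close> has distance to \<open>w\<close> at most half the oscillation. With any other radial
  comparison function, such as \<open>w r 0\<close>, the factor \<open>2\<close> in \<open>op_K_oscillation\<close> would spoil the contraction.
\<close>

lemma radial_midpoint:
  fixes w :: "real \<Rightarrow> real \<Rightarrow> real"
  assumes w: "continuous_on (dom_E R) (\<lambda>(r, \<zeta>). w r \<zeta>)" and R: "0 \<le> R"
  obtains c :: "real \<Rightarrow> real" where "c \<in> borel_measurable borel"
    "\<And>r a. r \<in> {0..R} \<Longrightarrow> (\<And>\<zeta>. \<zeta> \<in> {-1..1} \<Longrightarrow> \<bar>w r \<zeta>\<bar> \<le> a) \<Longrightarrow> \<bar>c r\<bar> \<le> a"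
    "\<And>r \<zeta> D. r \<in> {0..R} \<Longrightarrow> (\<And>\<zeta> \<zeta>'. \<zeta> \<in> {-1..1} \<Longrightarrow> \<zeta>' \<in> {-1..1} \<Longrightarrow> w r \<zeta> - w r \<zeta>' \<le> 2 * D) \<Longrightarrow>
        \<zeta> \<in> {-1..1} \<Longrightarrow> \<bar>w r \<zeta> - c r\<bar> \<le> D"
proof -
  obtain M where M: "M \<in> borel_measurable borel"
    "\<And>r \<zeta>. r \<in> {0..R} \<Longrightarrow> \<zeta> \<in> {-1..1} \<Longrightarrow> w r \<zeta> \<le> M r"
    "\<And>r B. r \<in> {0..R} \<Longrightarrow> (\<And>\<zeta>. \<zeta> \<in> {-1..1} \<Longrightarrow> w r \<zeta> \<le> B) \<Longrightarrow> M r \<le> B"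
    using measurable_radial_sup[OF w R] by blast
  have "continuous_on (dom_E R) (\<lambda>(r, \<zeta>). - w r \<zeta>)"
    using continuous_on_minus[OF w] by (simp add: split_beta)
  then obtain m where m: "m \<in> borel_measurable borel"
    "\<And>r \<zeta>. r \<in> {0..R} \<Longrightarrow> \<zeta> \<in> {-1..1} \<Longrightarrow> - w r \<zeta> \<le> m r"
    "\<And>r B. r \<in> {0..R} \<Longrightarrow> (\<And>\<zeta>. \<zeta> \<in> {-1..1} \<Longrightarrow> - w r \<zeta> \<le> B) \<Longrightarrow> m r \<le> B"
    using measurable_radial_sup[of R "\<lambda>r \<zeta>. - w r \<zeta>"] R by blast
  note [measurable] = M(1) m(1)
  show thesis
  proof (rule that[of "\<lambda>r. (M r - m r) / 2"])
    show "(\<lambda>r. (M r - m r) / 2) \<in> borel_measurable borel" by measurable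
  next
    fix r a assume r: "r \<in> {0..R}" and a: "\<And>\<zeta>. \<zeta> \<in> {-1..1} \<Longrightarrow> \<bar>w r \<zeta>\<bar> \<le> a"
    have "M r \<le> a" "m r \<le> a"
      using a by (auto intro!: M(3)[OF r] m(3)[OF r] simp: abs_le_iff)
    moreover have "- a \<le> M r" "- a \<le> m r"
      using M(2)[OF r, of 0] m(2)[OF r, of 0] a[of 0] by (auto simp: abs_le_iff)
    ultimately show "\<bar>(M r - m r) / 2\<bar> \<le> a"
      by (simp add: abs_le_iff)
  next
    fix r \<zeta> D :: real assume r: "r \<in> {0..R}" and \<zeta>: "\<zeta> \<in> {-1..1}"
      and D: "\<And>\<zeta> \<zeta>'. \<zeta> \<in> {-1..1} \<Longrightarrow> \<zeta>' \<in> {-1..1} \<Longrightarrow> w r \<zeta> - w r \<zeta>' \<le> 2 * D"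
    have "M r \<le> 2 * D + w r \<zeta>'" if "\<zeta>' \<in> {-1..1}" for \<zeta>'
      using D[OF _ that] by (intro M(3)[OF r]) (simp add: algebra_simps)
    then have "m r \<le> 2 * D - M r"
      by (intro m(3)[OF r]) (simp add: algebra_simps)
    then show "\<bar>w r \<zeta> - (M r - m r) / 2\<bar> \<le> D"
      using M(2)[OF r \<zeta>] m(2)[OF r \<zeta>] by (simp add: abs_le_iff field_simps)
  qed
qed

section \<open>The linearized equation\<close>

context radial_profile
begin

lemma q_bound: "\<exists>Q\<ge>1. \<forall>s\<in>{0..R}. q s \<le> Q"
proof -
  obtain Q where "\<And>s. s \<in> {0..R} \<Longrightarrow> q s \<le> Q"
    using continuous_attains_sup[OF _ _ continuous_q] R_pos by force
  then show ?thesis by (intro exI[of _ "max 1 Q"]) (auto simp: le_max_iff_disj)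
qed

lemma bounded_source_q_mult:
  assumes [measurable]: "c \<in> borel_measurable borel" and "\<And>s. s \<in> {0..R} \<Longrightarrow> \<bar>c s\<bar> \<le> B"
  shows "bounded_source R (\<lambda>s :: real. indicator {0..R} s * (q s * c s))"
proof -
  note q = bounded_source_cutoff[OF continuous_q]
  note [measurable] = bounded_source_measurable[OF q]
  obtain Q where Q: "1 \<le> Q" "\<And>s. s \<in> {0..R} \<Longrightarrow> q s \<le> Q"
    using q_bound by blast
  have eq: "indicator {0..R} s * (q s * c s) = (indicator {0..R} s * q s) * c s" for s :: real
    by simp
  have "\<bar>indicator {0..R} s * (q s * c s)\<bar> \<le> Q * \<bar>B\<bar>" for s :: real
  proof (cases "s \<in> {0..R}")
    case True
    then have "\<bar>q s\<bar> * \<bar>c s\<bar> \<le> Q * \<bar>B\<bar>"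
      using Q assms(2)[OF True] q_nonneg[of s] by (intro mult_mono) auto
    then show ?thesis using True by (simp add: abs_mult)
  qed (use Q in simp)
  moreover have "(\<lambda>s. indicator {0..R} s * (q s * c s)) \<in> borel_measurable borel"
    unfolding eq by measurable
  ultimately show ?thesis
    unfolding bounded_source_def
    by (intro conjI exI[of _ "Q * \<bar>B\<bar>"] allI impI) (auto simp: indicator_def)
qed

text \<open>
  The equation for the difference \<open>w\<close> of two solutions whose rotation parameters differ by \<open>b\<close>, where \<open>u\<close> is
  the difference of the densities and \<open>\<delta>\<close> bounds the error of linearizing it.
\<close>

definition linearized :: "real \<Rightarrow> real \<Rightarrow> (real \<Rightarrow> real \<Rightarrow> real) \<Rightarrow> (real \<Rightarrow> real \<Rightarrow> real) \<Rightarrow> bool" where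
  "linearized b \<delta> w u \<longleftrightarrow> w \<in> space_E R \<and> u \<in> space_E R \<and> 0 \<le> \<delta> \<and>
     (\<forall>r\<in>{0..R}. \<forall>\<zeta>\<in>{-1..1}. \<bar>u r \<zeta> - q r * w r \<zeta>\<bar> \<le> \<delta>) \<and>
     (\<forall>r\<in>{0..R}. \<forall>\<zeta>\<in>{-1..1}. w r \<zeta> = b / 4 * r\<^sup>2 * (1 - \<zeta>\<^sup>2) + (op_K R u r \<zeta> - op_K R u 0 0))"

text \<open>
  Contraction of the oscillation relative to \<open>2 p\<close>: if it is at most \<open>N\<close>, then subtracting the radial midpoint
  leaves a density of size \<open>N q p + \<delta>\<close>, and by \<open>excess_q_p_le\<close> its potential has relative oscillation at
  most \<open>9/10 N\<close> plus a multiple of \<open>\<delta>\<close>.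
\<close>

lemma oscillation_estimate:
  "\<exists>K>0. \<forall>w u b \<delta>. linearized b \<delta> w u \<longrightarrow>
     (\<forall>r\<in>{0..R}. \<forall>\<zeta>\<in>{-1..1}. \<forall>\<zeta>'\<in>{-1..1}. w r \<zeta> - w r \<zeta>' \<le> K * (\<bar>b\<bar> + \<delta>) * (2 * p r))"
proof -
  obtain c1 where c1: "0 < c1" "\<And>r. r \<in> {0..R} \<Longrightarrow> c1 * r \<le> p r"
    using p_lower by blast
  define K where "K = R / c1"
  have K: "0 < K" using R_pos c1 by (simp add: K_def)
  have rK: "R * r \<le> K * p r" if "r \<in> {0..R}" for r
    using mult_left_mono[OF c1(2)[OF that], of K] K c1 by (simp add: K_def)
  show ?thesis
  proof (intro exI[of _ "10 * K"] conjI allI impI ballI)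
    show "0 < 10 * K" using K by simp
    fix w u :: "real \<Rightarrow> real \<Rightarrow> real" and b \<delta> r\<^sub>0 \<zeta>\<^sub>0 \<zeta>\<^sub>0' :: real
    assume lin: "linearized b \<delta> w u"
      and r0: "r\<^sub>0 \<in> {0..R}" "\<zeta>\<^sub>0 \<in> {-1..1}" "\<zeta>\<^sub>0' \<in> {-1..1}"
    then have w: "w \<in> space_E R" and u: "u \<in> space_E R" and \<delta>: "0 \<le> \<delta>"
      and uw: "\<forall>r\<in>{0..R}. \<forall>\<zeta>\<in>{-1..1}. \<bar>u r \<zeta> - q r * w r \<zeta>\<bar> \<le> \<delta>"
      and weq: "\<forall>r\<in>{0..R}. \<forall>\<zeta>\<in>{-1..1}. w r \<zeta> = b / 4 * r\<^sup>2 * (1 - \<zeta>\<^sup>2) + (op_K R u r \<zeta> - op_K R u 0 0)"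
      unfolding linearized_def by blast+

    define B where "B = K * (\<bar>b\<bar> + \<delta>)"
    have B: "0 \<le> B" using K \<delta> by (simp add: B_def)
    obtain Bw where Bw: "0 < Bw" "\<And>r \<zeta>. r \<in> {0..R} \<Longrightarrow> \<zeta> \<in> {-1..1} \<Longrightarrow> \<bar>w r \<zeta>\<bar> \<le> Bw"
      using continuous_on_dom_E_bounded[OF space_E_continuous[OF w]] by blast
    obtain Bu where Bu: "0 < Bu" "\<And>r \<zeta>. r \<in> {0..R} \<Longrightarrow> \<zeta> \<in> {-1..1} \<Longrightarrow> \<bar>u r \<zeta>\<bar> \<le> Bu"
      using continuous_on_dom_E_bounded[OF space_E_continuous[OF u]] by blast
    have w0: "w 0 \<zeta> = w 0 0" if "\<zeta> \<in> {-1..1}" for \<zeta>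
      using w that unfolding space_E_def by blast
    have diff_le: "w r \<zeta> - w r \<zeta>' \<le> \<bar>b\<bar> / 4 * (R * r) + \<bar>op_K R u r \<zeta> - op_K R u r \<zeta>'\<bar>"
      if r: "r \<in> {0..R}" and \<zeta>: "\<zeta> \<in> {-1..1}" "\<zeta>' \<in> {-1..1}" for r \<zeta> \<zeta>'
    proof -
      have sq: "\<zeta>\<^sup>2 \<le> 1" "\<zeta>'\<^sup>2 \<le> 1"
        using \<zeta> by (auto simp: abs_square_le_1 abs_le_iff)
      then have diff1: "\<bar>\<zeta>'\<^sup>2 - \<zeta>\<^sup>2\<bar> \<le> 1"
        using zero_le_power2[of \<zeta>] zero_le_power2[of \<zeta>'] unfolding abs_le_iff by linarith
      have "b / 4 * r\<^sup>2 * (1 - \<zeta>\<^sup>2) - b / 4 * r\<^sup>2 * (1 - \<zeta>'\<^sup>2) = b / 4 * (r * r * (\<zeta>'\<^sup>2 - \<zeta>\<^sup>2))"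
        by (simp add: power2_eq_square field_simps)
      also have "\<dots> \<le> \<bar>b / 4\<bar> * \<bar>r * r * (\<zeta>'\<^sup>2 - \<zeta>\<^sup>2)\<bar>"
        by (metis abs_ge_self abs_mult)
      also have "\<bar>r * r * (\<zeta>'\<^sup>2 - \<zeta>\<^sup>2)\<bar> = r * r * \<bar>\<zeta>'\<^sup>2 - \<zeta>\<^sup>2\<bar>"
        using r by (simp add: abs_mult)
      also have "\<bar>b / 4\<bar> * (r * r * \<bar>\<zeta>'\<^sup>2 - \<zeta>\<^sup>2\<bar>) \<le> \<bar>b / 4\<bar> * (R * r * 1)"
        using r diff1 by (intro mult_left_mono mult_mono mult_right_mono) auto
      finally show ?thesis
        using weq r \<zeta> by simp
    qed
    let ?I = "{0..R} \<times> {-1..1::real} \<times> {-1..1::real}"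
    let ?a = "\<lambda>(r, \<zeta>, \<zeta>'). w r \<zeta> - w r \<zeta>'"
    let ?g = "\<lambda>(r, \<zeta> :: real, \<zeta>' :: real). 2 * p r"
    have "?a (r\<^sub>0, \<zeta>\<^sub>0, \<zeta>\<^sub>0') \<le> B / (1 - 9/10) * ?g (r\<^sub>0, \<zeta>\<^sub>0, \<zeta>\<^sub>0')"
    proof (rule contraction_bound[where I = ?I and N\<^sub>0 = "K * (\<bar>b\<bar> + Bu)"])
      show "0 \<le> K * (\<bar>b\<bar> + Bu)" using K Bu by simp
      show "0 \<le> ?g i" if "i \<in> ?I" for i
        using that p_nonneg by auto
      show "?a i \<le> K * (\<bar>b\<bar> + Bu) * ?g i" if "i \<in> ?I" for i
      proof -
        obtain r \<zeta> \<zeta>' where i: "i = (r, \<zeta>, \<zeta>')" by (cases i)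
        with that have r: "r \<in> {0..R}" and \<zeta>: "\<zeta> \<in> {-1..1}" "\<zeta>' \<in> {-1..1}" by auto
        show ?thesis
        proof (cases "r = 0")
          case True
          then show ?thesis using w0[OF \<zeta>(1)] w0[OF \<zeta>(2)] by (simp add: i p_def)
        next
          case False
          have "bounded_source R (\<lambda>_ :: real. 0)"
            by (auto simp: bounded_source_def)
          from op_K_oscillation[OF u this, of "\<lambda>_. Bu" r \<zeta> \<zeta>']
          have "\<bar>op_K R u r \<zeta> - op_K R u r \<zeta>'\<bar> \<le> 2 * excess R (\<lambda>_. Bu) r"
            using Bu r \<zeta> by auto
          also have "\<dots> \<le> 2 * (3/10 * Bu * R * r)"
            using excess_const_le[of r R Bu] False r R_pos Bu by simp
          finally have "w r \<zeta> - w r \<zeta>' \<le> \<bar>b\<bar> / 4 * (R * r) + 2 * (3/10 * Bu * R * r)"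
            using diff_le[OF r \<zeta>] by linarith
          also have "\<dots> = (\<bar>b\<bar> / 4 + 6/10 * Bu) * (R * r)"
            by (simp add: algebra_simps)
          also have "\<dots> \<le> (2 * \<bar>b\<bar> + 2 * Bu) * (K * p r)"
            using Bu r R_pos by (intro mult_mono rK[OF r]) auto
          finally show ?thesis by (simp add: i algebra_simps)
        qed
      qed
      fix N i
      assume N: "0 \<le> N" and IH: "\<And>j. j \<in> ?I \<Longrightarrow> ?a j \<le> N * ?g j" and "i \<in> ?I"
      then obtain r \<zeta> \<zeta>' where i: "i = (r, \<zeta>, \<zeta>')" and r: "r \<in> {0..R}" and \<zeta>: "\<zeta> \<in> {-1..1}" "\<zeta>' \<in> {-1..1}"
        by auto
      show "?a i \<le> (9/10 * N + B) * ?g i"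
      proof (cases "r = 0")
        case True
        then show ?thesis using w0[OF \<zeta>(1)] w0[OF \<zeta>(2)] by (simp add: i p_def)
      next
        case False
        then have r0: "0 < r" using r by simp
        obtain c where c: "c \<in> borel_measurable borel"
          "\<And>r a. r \<in> {0..R} \<Longrightarrow> (\<And>\<zeta>. \<zeta> \<in> {-1..1} \<Longrightarrow> \<bar>w r \<zeta>\<bar> \<le> a) \<Longrightarrow> \<bar>c r\<bar> \<le> a"
          "\<And>r \<zeta> D. r \<in> {0..R} \<Longrightarrow> (\<And>\<zeta> \<zeta>'. \<zeta> \<in> {-1..1} \<Longrightarrow> \<zeta>' \<in> {-1..1} \<Longrightarrow> w r \<zeta> - w r \<zeta>' \<le> 2 * D) \<Longrightarrow>
              \<zeta> \<in> {-1..1} \<Longrightarrow> \<bar>w r \<zeta> - c r\<bar> \<le> D"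
          using radial_midpoint[OF space_E_continuous[OF w]] R_pos by (metis less_imp_le)
        have wc: "\<bar>w s \<eta> - c s\<bar> \<le> N * p s" if "s \<in> {0..R}" "\<eta> \<in> {-1..1}" for s \<eta>
        proof (rule c(3)[OF that(1) _ that(2)])
          show "w s \<eta> - w s \<eta>' \<le> 2 * (N * p s)" if "\<eta> \<in> {-1..1}" "\<eta>' \<in> {-1..1}" for \<eta> \<eta>'
            using IH[of "(s, \<eta>, \<eta>')"] that \<open>s \<in> {0..R}\<close> by (simp add: mult_ac)
        qed
        let ?g' = "\<lambda>s. N * (q s * p s) + \<delta>"
        have cont: "continuous_on {0..R} (\<lambda>s. q s * p s)"
          by (intro continuous_intros continuous_q continuous_p)
        then have cont': "continuous_on {0..R} ?g'"
          by (intro continuous_on_add continuous_on_mult_left continuous_on_const)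
        have bs: "bounded_source R (\<lambda>s :: real. indicator {0..R} s * (q s * c s))"
          by (rule bounded_source_q_mult[OF c(1), of Bw]) (use c(2) Bw in blast)
        have "\<bar>op_K R u r \<zeta> - op_K R u r \<zeta>'\<bar> \<le> 2 * excess R ?g' r"
        proof (rule op_K_oscillation[OF u bs cont'])
          fix s \<eta> assume s: "s \<in> {0..R}" "\<eta> \<in> {-1..1::real}"
          have "\<bar>u s \<eta> - q s * c s\<bar> \<le> \<bar>u s \<eta> - q s * w s \<eta>\<bar> + \<bar>q s * (w s \<eta> - c s)\<bar>"
            by (simp add: algebra_simps)
          also have "\<dots> \<le> \<delta> + q s * (N * p s)"
            using uw s wc[OF s] q_nonneg[of s] by (intro add_mono) (auto simp: abs_mult intro!: mult_left_mono)
          finally show "\<bar>u s \<eta> - indicator {0..R} s * (q s * c s)\<bar> \<le> ?g' s"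
            using s by (simp add: mult_ac)
        qed (use r \<zeta> in auto)
        also have "excess R ?g' r = N * excess R (\<lambda>s. q s * p s) r + excess R (\<lambda>_. \<delta>) r"
          by (rule excess_add[OF r0 cont]) simp
        also have "\<dots> \<le> N * (9/10 * p r) + 3/10 * \<delta> * R * r"
          using excess_q_p_le[of r] excess_const_le[of r R \<delta>] r0 r \<delta> R_pos N by (intro add_mono mult_left_mono) auto
        finally have "w r \<zeta> - w r \<zeta>' \<le> 9/10 * N * (2 * p r) + (\<bar>b\<bar> / 4 + 6/10 * \<delta>) * (R * r)"
          using diff_le[OF r \<zeta>] by (simp add: algebra_simps)
        also have "(\<bar>b\<bar> / 4 + 6/10 * \<delta>) * (R * r) \<le> (2 * \<bar>b\<bar> + 2 * \<delta>) * (K * p r)"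
          using \<delta> r R_pos by (intro mult_mono rK[OF r]) auto
        finally show ?thesis by (simp add: i B_def algebra_simps)
      qed
    qed (use B r0 in auto)
    then show "w r\<^sub>0 \<zeta>\<^sub>0 - w r\<^sub>0 \<zeta>\<^sub>0' \<le> 10 * K * (\<bar>b\<bar> + \<delta>) * (2 * p r\<^sub>0)"
      by (simp add: B_def)
  qed
qed

lemma integral_exp_le:
  fixes r \<sigma> :: real
  assumes "0 \<le> r" "0 < \<sigma>"
  shows "integral {0..r} (\<lambda>s. exp (\<sigma> * s)) \<le> exp (\<sigma> * r) / \<sigma>"
proof -
  have "((\<lambda>s. exp (\<sigma> * s)) has_integral (exp (\<sigma> * r) / \<sigma> - exp (\<sigma> * 0) / \<sigma>)) {0..r}"
    using assms by (intro fundamental_theorem_of_calculus[where f = "\<lambda>s. exp (\<sigma> * s) / \<sigma>"])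
      (auto intro!: derivative_eq_intros simp flip: has_real_derivative_iff_has_vector_derivative)
  then show ?thesis
    using assms by (auto simp: integral_unique)
qed

lemma potential_const_bound:
  assumes "bounded_source R H" "\<And>y. \<bar>H y\<bar> \<le> E" "0 \<le> E"
  shows "\<bar>potential H x\<bar> \<le> E * R\<^sup>2"
proof -
  let ?\<phi> = "\<lambda>s. indicator {0..R} s * E"
  have b: "bounded_source R ?\<phi>"
    by (rule bounded_source_cutoff) simp
  have "\<bar>H y\<bar> \<le> ?\<phi> (norm y)" for y
    using assms by (cases "norm y \<le> R") (auto simp: bounded_source_def)
  from potential_bound[OF assms(1) b this]
  have "\<bar>potential H x\<bar> \<le> (LINT s:{0..R}|lborel. ?\<phi> s * (s\<^sup>2 / max (norm x) s))" .
  also have "\<dots> \<le> (LINT s:{0..R}|lborel. E * R)"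
  proof (rule set_integral_mono)
    show "set_integrable lborel {0..R} (\<lambda>s. ?\<phi> s * (s\<^sup>2 / max (norm x) s))"
      by (rule shell_integral(2)[OF b])
    show "set_integrable lborel {0..R} (\<lambda>s. E * R)"
      by (rule borel_integrable_atLeastAtMost') simp
    fix s assume s: "s \<in> {0..R}"
    have "s\<^sup>2 / max (norm x) s \<le> s"
      using s by (cases "s = 0") (auto simp: divide_le_eq power2_eq_square max_def mult_left_mono)
    then have "s\<^sup>2 / max (norm x) s \<le> R" using s by auto
    then show "?\<phi> s * (s\<^sup>2 / max (norm x) s) \<le> E * R"
      using s mult_left_mono[of "s\<^sup>2 / max (norm x) s" R E] assms(3) by simp
  qed
  also have "\<dots> = E * R\<^sup>2"
    using R_pos by (subst LINT_eq_integral) (auto simp: power2_eq_square)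
  finally show ?thesis .
qed

text \<open>
  In the difference of the two potentials, shells outside \<open>x\<close> cancel. The remaining integral over \<open>[0, norm x]\<close>
  gains the factor \<open>1 / \<sigma>\<close> from the exponential weight.
\<close>

lemma radial_potential_increment:
  assumes c: "c \<in> borel_measurable borel" and W: "0 \<le> W"
    and le: "\<And>s. s \<in> {0..R} \<Longrightarrow> \<bar>c s\<bar> \<le> W * exp (\<sigma> * s)" and \<sigma>: "0 < \<sigma>"
    and Q: "0 \<le> Q" "\<And>s. s \<in> {0..R} \<Longrightarrow> q s \<le> Q" and r: "norm x \<in> {0..R}"
  defines "\<phi> \<equiv> \<lambda>s. indicator {0..R} s * (q s * c s)"
  shows "\<bar>potential (\<lambda>y. \<phi> (norm y)) x - potential (\<lambda>y. \<phi> (norm y)) 0\<bar> \<le> R * Q * W * exp (\<sigma> * norm x) / \<sigma>"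
proof -
  define r where "r = norm x"
  have r: "0 \<le> r" "r \<le> R" using r by (auto simp: r_def)
  have cB: "\<bar>c s\<bar> \<le> W * exp (\<sigma> * R)" if "s \<in> {0..R}" for s
  proof -
    have "W * exp (\<sigma> * s) \<le> W * exp (\<sigma> * R)"
      using that \<sigma> W by (intro mult_left_mono) auto
    then show ?thesis using le[OF that] by linarith
  qed
  have b: "bounded_source R \<phi>"
    unfolding \<phi>_def by (rule bounded_source_q_mult[OF c cB])
  let ?D = "\<lambda>s. \<phi> s * (s\<^sup>2 / max r s) - \<phi> s * (s\<^sup>2 / max 0 s)"
  have i: "set_integrable lborel {0..R} ?D"
    using set_integral_diff(1)[OF shell_integral(2)[OF b, of x] shell_integral(2)[OF b, of 0]]
    by (simp add: r_def)
  have eq: "potential (\<lambda>y. \<phi> (norm y)) x - potential (\<lambda>y. \<phi> (norm y)) 0 = (LINT s:{0..R}|lborel. ?D s)"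
    using set_integral_diff(2)[OF shell_integral(2)[OF b, of x] shell_integral(2)[OF b, of 0]]
    by (simp add: potential_radial[OF b] r_def)
  have "\<bar>potential (\<lambda>y. \<phi> (norm y)) x - potential (\<lambda>y. \<phi> (norm y)) 0\<bar> \<le> (LINT s:{0..R}|lborel. \<bar>?D s\<bar>)"
    unfolding eq using set_integral_norm_bound[OF i] by simp
  also have "\<dots> = (LINT s:{0..r}|lborel. \<bar>?D s\<bar>)"
  proof -
    have "indicator {0..R} s *\<^sub>R \<bar>?D s\<bar> = indicator {0..r} s *\<^sub>R \<bar>?D s\<bar>" for s
      using r by (auto split: split_indicator simp: max_def)
    then show ?thesis unfolding set_lebesgue_integral_def by (simp only:)
  qed
  also have "\<dots> \<le> (LINT s:{0..r}|lborel. (R * Q * W) * exp (\<sigma> * s))"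
  proof (rule set_integral_mono)
    show "set_integrable lborel {0..r} (\<lambda>s. \<bar>?D s\<bar>)"
      using set_integrable_subset[OF set_integrable_abs[OF i], of "{0..r}"] r by simp
    show "set_integrable lborel {0..r} (\<lambda>s. (R * Q * W) * exp (\<sigma> * s))"
      by (intro borel_integrable_atLeastAtMost' continuous_intros)
    fix s assume s: "s \<in> {0..r}"
    then have sR: "s \<in> {0..R}" using r by auto
    have "?D s = \<phi> s * (s\<^sup>2 / max r s - s\<^sup>2 / max 0 s)"
      by (simp add: right_diff_distrib)
    then have "\<bar>?D s\<bar> = \<bar>\<phi> s\<bar> * \<bar>s\<^sup>2 / max r s - s\<^sup>2 / max 0 s\<bar>"
      by (simp only: abs_mult)
    also have "\<dots> \<le> (Q * (W * exp (\<sigma> * s))) * R"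
    proof (rule mult_mono)
      show "\<bar>\<phi> s\<bar> \<le> Q * (W * exp (\<sigma> * s))"
        using le[OF sR] Q(1) Q(2)[OF sR] q_nonneg[of s] sR by (auto simp: \<phi>_def abs_mult intro!: mult_mono)
      have "s\<^sup>2 / max r s \<le> s" "0 \<le> s\<^sup>2 / max r s" "s\<^sup>2 / max 0 s = s"
        using s by (auto simp: power2_eq_square max_def divide_le_eq mult_left_mono)
      then show "\<bar>s\<^sup>2 / max r s - s\<^sup>2 / max 0 s\<bar> \<le> R"
        using sR by (auto simp: abs_le_iff)
    qed (use Q W in auto)
    finally show "\<bar>?D s\<bar> \<le> (R * Q * W) * exp (\<sigma> * s)"
      by (simp add: mult_ac)
  qed
  also have "\<dots> = (R * Q * W) * integral {0..r} (\<lambda>s. exp (\<sigma> * s))"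
    by (subst LINT_eq_integral) (auto intro!: continuous_intros)
  also have "\<dots> \<le> (R * Q * W) * (exp (\<sigma> * r) / \<sigma>)"
    using integral_exp_le[OF r(1) \<sigma>] R_pos Q W by (intro mult_left_mono) auto
  finally show ?thesis by (simp add: r_def)
qed

text \<open>
  By \<open>oscillation_estimate\<close> the density is the radial function \<open>q c\<close>, with \<open>c\<close> the midpoint of \<open>w\<close>, up to
  an error of order \<open>|b| + \<delta>\<close>. The contribution of \<open>q c\<close> is a Volterra term, and \<open>|c|\<close> is bounded by \<open>|w|\<close>;
  so the weighted supremum of \<open>w\<close> is contracted by the factor \<open>1/2\<close>.
\<close>

lemma a_priori_estimate:
  "\<exists>C>0. \<forall>w u b \<delta>. linearized b \<delta> w u \<longrightarrow>
     (\<forall>r\<in>{0..R}. \<forall>\<zeta>\<in>{-1..1}. \<bar>w r \<zeta>\<bar> \<le> C * (\<bar>b\<bar> + \<delta>))"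
proof -
  obtain Q where Q: "1 \<le> Q" "\<And>s. s \<in> {0..R} \<Longrightarrow> q s \<le> Q"
    using q_bound by blast
  obtain C\<^sub>2 where C2: "0 < C\<^sub>2" "\<And>r. r \<in> {0..R} \<Longrightarrow> p r \<le> C\<^sub>2 * r"
    using p_upper by blast
  obtain K where K: "0 < K" and osc: "\<And>w u b \<delta> r \<zeta> \<zeta>'. linearized b \<delta> w u \<Longrightarrow>
     r \<in> {0..R} \<Longrightarrow> \<zeta> \<in> {-1..1} \<Longrightarrow> \<zeta>' \<in> {-1..1} \<Longrightarrow> w r \<zeta> - w r \<zeta>' \<le> K * (\<bar>b\<bar> + \<delta>) * (2 * p r)"
    using oscillation_estimate by blast
  \<comment> \<open>The Volterra term is bounded by \<open>R Q / \<sigma>\<close> times the weighted norm; this choice makes it \<open>1/2\<close>.\<close>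
  define \<sigma> where "\<sigma> = 2 * R * Q"
  have \<sigma>: "0 < \<sigma>" using R_pos Q by (simp add: \<sigma>_def)
  define E where "E = Q * (K * (C\<^sub>2 * R)) + 1"
  have E: "0 < E" using Q K C2 R_pos by (auto simp: E_def intro!: add_nonneg_pos mult_nonneg_nonneg)
  define C where "C = 2 * (R\<^sup>2 + 2 * E * R\<^sup>2) * exp (\<sigma> * R)"
  show ?thesis
  proof (intro exI[of _ C] conjI allI impI ballI)
    show "0 < C" using R_pos E by (simp add: C_def add_pos_pos)
    fix w u :: "real \<Rightarrow> real \<Rightarrow> real" and b \<delta> r\<^sub>0 \<zeta>\<^sub>0 :: real
    assume lin: "linearized b \<delta> w u"
      and r0: "r\<^sub>0 \<in> {0..R}" "\<zeta>\<^sub>0 \<in> {-1..1}"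
    then have w: "w \<in> space_E R" and u: "u \<in> space_E R" and \<delta>: "0 \<le> \<delta>"
      and uw: "\<forall>r\<in>{0..R}. \<forall>\<zeta>\<in>{-1..1}. \<bar>u r \<zeta> - q r * w r \<zeta>\<bar> \<le> \<delta>"
      and weq: "\<forall>r\<in>{0..R}. \<forall>\<zeta>\<in>{-1..1}. w r \<zeta> = b / 4 * r\<^sup>2 * (1 - \<zeta>\<^sup>2) + (op_K R u r \<zeta> - op_K R u 0 0)"
      unfolding linearized_def by blast+
    define D where "D = \<bar>b\<bar> + \<delta>"
    have D: "0 \<le> D" "\<delta> \<le> D" "\<bar>b\<bar> \<le> D" using \<delta> by (auto simp: D_def)
    obtain Bw where Bw: "0 < Bw" "\<And>r \<zeta>. r \<in> {0..R} \<Longrightarrow> \<zeta> \<in> {-1..1} \<Longrightarrow> \<bar>w r \<zeta>\<bar> \<le> Bw"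
      using continuous_on_dom_E_bounded[OF space_E_continuous[OF w]] by blast
    obtain c where c: "c \<in> borel_measurable borel"
      "\<And>r a. r \<in> {0..R} \<Longrightarrow> (\<And>\<zeta>. \<zeta> \<in> {-1..1} \<Longrightarrow> \<bar>w r \<zeta>\<bar> \<le> a) \<Longrightarrow> \<bar>c r\<bar> \<le> a"
      "\<And>r \<zeta> D. r \<in> {0..R} \<Longrightarrow> (\<And>\<zeta> \<zeta>'. \<zeta> \<in> {-1..1} \<Longrightarrow> \<zeta>' \<in> {-1..1} \<Longrightarrow> w r \<zeta> - w r \<zeta>' \<le> 2 * D) \<Longrightarrow>
          \<zeta> \<in> {-1..1} \<Longrightarrow> \<bar>w r \<zeta> - c r\<bar> \<le> D"
      using radial_midpoint[OF space_E_continuous[OF w]] R_pos by (metis less_imp_le)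
    have wc: "\<bar>w s \<eta> - c s\<bar> \<le> K * (C\<^sub>2 * R) * D" if s: "s \<in> {0..R}" "\<eta> \<in> {-1..1}" for s \<eta>
    proof -
      have "\<bar>w s \<eta> - c s\<bar> \<le> K * D * p s"
      proof (rule c(3)[OF s(1) _ s(2)])
        show "w s \<eta> - w s \<eta>' \<le> 2 * (K * D * p s)" if "\<eta> \<in> {-1..1}" "\<eta>' \<in> {-1..1}" for \<eta> \<eta>'
          using osc[OF lin s(1) that] by (simp add: D_def mult_ac)
      qed
      also have "\<dots> \<le> K * D * (C\<^sub>2 * R)"
      proof (rule mult_left_mono)
        have "C\<^sub>2 * s \<le> C\<^sub>2 * R" using s C2(1) by simp
        then show "p s \<le> C\<^sub>2 * R" using C2(2)[OF s(1)] by linarith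
      qed (use K D in auto)
      finally show ?thesis by (simp add: mult_ac)
    qed
    define \<phi> where "\<phi> s = indicator {0..R} s * (q s * c s)" for s :: real
    have b\<phi>: "bounded_source R \<phi>"
      unfolding \<phi>_def by (rule bounded_source_q_mult[OF c(1), of Bw]) (use c(2) Bw in blast)
    note b\<phi>' = bounded_source_radial[OF b\<phi>, where 'a = "real^3"]
    define h where "h y = source R u y - \<phi> (norm y)" for y
    have bh: "bounded_source R h"
      unfolding h_def by (rule bounded_source_diff[OF bounded_source_source[OF u] b\<phi>'])
    have h_le: "\<bar>h y\<bar> \<le> E * D" for y
    proof (cases "norm y \<le> R")
      case True
      define s \<eta> where "s = norm y" and "\<eta> = y $ 3 / norm y"
      have s: "s \<in> {0..R}" "\<eta> \<in> {-1..1}"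
        using flat_coordinates[OF True] by (auto simp: s_def \<eta>_def)
      have "h y = (u s \<eta> - q s * w s \<eta>) + q s * (w s \<eta> - c s)"
        using True s by (simp add: h_def source_def flat_def \<phi>_def s_def \<eta>_def algebra_simps)
      then have "\<bar>h y\<bar> \<le> \<bar>u s \<eta> - q s * w s \<eta>\<bar> + \<bar>q s * (w s \<eta> - c s)\<bar>"
        by (simp only: abs_triangle_ineq)
      also have "\<dots> \<le> D + Q * (K * (C\<^sub>2 * R) * D)"
      proof (rule add_mono)
        show "\<bar>u s \<eta> - q s * w s \<eta>\<bar> \<le> D" using uw s D(2) by force
        show "\<bar>q s * (w s \<eta> - c s)\<bar> \<le> Q * (K * (C\<^sub>2 * R) * D)"
          unfolding abs_mult using wc[OF s] Q(1) Q(2)[OF s(1)] q_nonneg[of s] by (intro mult_mono) auto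
      qed
      finally show ?thesis by (simp add: E_def algebra_simps)
    next
      case False
      then show ?thesis using E D by (simp add: h_def source_def \<phi>_def)
    qed
    have main: "\<bar>w r \<zeta>\<bar> \<le> (R\<^sup>2 + 2 * E * R\<^sup>2) * D +
        \<bar>potential (\<lambda>y. \<phi> (norm y)) (axis_point r \<zeta>) - potential (\<lambda>y. \<phi> (norm y)) 0\<bar>"
      if r: "r \<in> {0..R}" "\<zeta> \<in> {-1..1}" for r \<zeta>
    proof -
      have split: "potential (source R u) x = potential (\<lambda>y. \<phi> (norm y)) x + potential h x" for x
        using potential_add[OF b\<phi>' bh] by (simp add: h_def)
      have ap0: "axis_point 0 0 = 0"
        using norm_axis_point[of 0 0] by simp
      have hb: "\<bar>potential h x\<bar> \<le> E * D * R\<^sup>2" for x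
        using E D by (intro potential_const_bound[OF bh h_le]) auto
      have "\<bar>b / 4 * r\<^sup>2 * (1 - \<zeta>\<^sup>2)\<bar> = \<bar>b / 4\<bar> * (r\<^sup>2 * \<bar>1 - \<zeta>\<^sup>2\<bar>)"
        by (simp add: abs_mult)
      also have "\<dots> \<le> D * (R\<^sup>2 * 1)"
        using r D R_pos zero_le_power2[of \<zeta>] abs_square_le_1[of \<zeta>]
        by (intro mult_mono power_mono) (auto simp: abs_le_iff)
      finally have g: "\<bar>b / 4 * r\<^sup>2 * (1 - \<zeta>\<^sup>2)\<bar> \<le> R\<^sup>2 * D" by (simp add: mult.commute)
      have "w r \<zeta> = b / 4 * r\<^sup>2 * (1 - \<zeta>\<^sup>2) +
          (potential (\<lambda>y. \<phi> (norm y)) (axis_point r \<zeta>) - potential (\<lambda>y. \<phi> (norm y)) 0) +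
          (potential h (axis_point r \<zeta>) - potential h 0)"
        using weq r by (simp add: op_K_eq_potential split ap0)
      then have "\<bar>w r \<zeta>\<bar> \<le> R\<^sup>2 * D + \<bar>potential (\<lambda>y. \<phi> (norm y)) (axis_point r \<zeta>) - potential (\<lambda>y. \<phi> (norm y)) 0\<bar> +
          (E * D * R\<^sup>2 + E * D * R\<^sup>2)"
        using g hb[of 0] hb[of "axis_point r \<zeta>"] by linarith
      then show ?thesis by (simp add: algebra_simps)
    qed
    let ?I = "{0..R} \<times> {-1..1::real}"
    let ?B = "(R\<^sup>2 + 2 * E * R\<^sup>2) * D"
    have B: "0 \<le> ?B" using E D by simp
    have exp1: "1 \<le> exp (\<sigma> * r)" if "r \<in> {0..R}" for r
      using that \<sigma> by simp
    have "(\<lambda>(r, \<zeta>). \<bar>w r \<zeta>\<bar>) (r\<^sub>0, \<zeta>\<^sub>0) \<le> ?B / (1 - 1/2) * (\<lambda>(r, \<zeta> :: real). exp (\<sigma> * r)) (r\<^sub>0, \<zeta>\<^sub>0)"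
    proof (rule contraction_bound[where I = ?I and N\<^sub>0 = Bw])
      show "0 \<le> Bw" using Bw by simp
      show "0 \<le> ?B" by (rule B)
      show "(case i of (r, \<zeta>) \<Rightarrow> \<bar>w r \<zeta>\<bar>) \<le> Bw * (case i of (r, \<zeta>) \<Rightarrow> exp (\<sigma> * r))" if mem: "i \<in> ?I" for i
      proof -
        obtain r \<zeta> where i: "i = (r, \<zeta>)" "r \<in> {0..R}" "\<zeta> \<in> {-1..1}" using mem by auto
        have "\<bar>w r \<zeta>\<bar> \<le> Bw * 1" using Bw i by simp
        also have "\<dots> \<le> Bw * exp (\<sigma> * r)"
          using exp1[OF i(2)] Bw by (intro mult_left_mono) auto
        finally show ?thesis by (simp add: i)
      qed
      fix W i
      assume W: "0 \<le> W" and i: "i \<in> ?I"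
        and IH: "\<And>j. j \<in> ?I \<Longrightarrow> (case j of (r, \<zeta>) \<Rightarrow> \<bar>w r \<zeta>\<bar>) \<le> W * (case j of (r, \<zeta>) \<Rightarrow> exp (\<sigma> * r))"
      obtain r \<zeta> where i: "i = (r, \<zeta>)" "r \<in> {0..R}" "\<zeta> \<in> {-1..1}"
        using i by (cases i) auto
      have nr: "norm (axis_point r \<zeta>) = r"
        using i by (intro norm_axis_point) auto
      have cW: "\<bar>c s\<bar> \<le> W * exp (\<sigma> * s)" if "s \<in> {0..R}" for s
        using IH that by (intro c(2)) auto
      have "\<bar>w r \<zeta>\<bar> \<le> ?B + R * Q * W * exp (\<sigma> * r) / \<sigma>"
        using main[OF i(2,3)] radial_potential_increment[OF c(1) W cW \<sigma> _ Q(2), of "axis_point r \<zeta>"] Q(1) i(2)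
        unfolding \<phi>_def nr by simp
      also have "R * Q * W * exp (\<sigma> * r) / \<sigma> = 1/2 * W * exp (\<sigma> * r)"
        using R_pos Q by (simp add: \<sigma>_def)
      also have "?B + 1/2 * W * exp (\<sigma> * r) \<le> (1/2 * W + ?B) * exp (\<sigma> * r)"
        using mult_left_mono[OF exp1[OF i(2)] B] by (simp add: algebra_simps)
      finally show "(case i of (r, \<zeta>) \<Rightarrow> \<bar>w r \<zeta>\<bar>) \<le> (1/2 * W + ?B) * (case i of (r, \<zeta>) \<Rightarrow> exp (\<sigma> * r))"
        by (simp add: i)
    qed (use r0 in auto)
    then have "\<bar>w r\<^sub>0 \<zeta>\<^sub>0\<bar> \<le> 2 * ?B * exp (\<sigma> * r\<^sub>0)" by simp
    also have "\<dots> \<le> 2 * ?B * exp (\<sigma> * R)"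
      using B r0 \<sigma> by (intro mult_left_mono) auto
    finally show "\<bar>w r\<^sub>0 \<zeta>\<^sub>0\<bar> \<le> C * (\<bar>b\<bar> + \<delta>)"
      by (simp add: C_def D_def algebra_simps)
  qed
qed

end

section \<open>Dependence of the mass on the rotation parameter\<close>

text \<open>
  The derivative is uniformly continuous on bounded intervals, so the mean value theorem applies uniformly
  in \<open>t\<close>.
\<close>

lemma pos_powr_linearization:
  assumes \<nu>: "1 < \<nu>" and \<eta>: "0 < \<eta>"
  shows "\<exists>\<epsilon>>0. \<forall>t a b. \<bar>t\<bar> \<le> B \<longrightarrow> \<bar>a - t\<bar> \<le> \<epsilon> \<longrightarrow> \<bar>b - t\<bar> \<le> \<epsilon> \<longrightarrow>
    \<bar>pos_powr \<nu> a - pos_powr \<nu> b - \<nu> * pos_powr (\<nu> - 1) t * (a - b)\<bar> \<le> \<eta> * \<bar>a - b\<bar>"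
proof -
  let ?F' = "\<lambda>x. \<nu> * pos_powr (\<nu> - 1) x"
  have "uniformly_continuous_on {-B-1..B+1} ?F'"
    using \<nu> by (intro compact_uniformly_continuous continuous_on_mult_left continuous_pos_powr continuous_on_id) auto
  then obtain d where d: "0 < d" "\<And>x y. x \<in> {-B-1..B+1} \<Longrightarrow> y \<in> {-B-1..B+1} \<Longrightarrow> dist y x < d \<Longrightarrow> dist (?F' y) (?F' x) < \<eta>"
    using \<eta> unfolding uniformly_continuous_on_def by metis
  define \<epsilon> where "\<epsilon> = min 1 (d / 2)"
  have \<epsilon>: "0 < \<epsilon>" "\<epsilon> \<le> 1" "\<epsilon> < d" using d(1) by (auto simp: \<epsilon>_def)
  show ?thesis
  proof (intro exI[of _ \<epsilon>] conjI allI impI)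
    fix t a b assume t: "\<bar>t\<bar> \<le> B" and a: "\<bar>a - t\<bar> \<le> \<epsilon>" and b: "\<bar>b - t\<bar> \<le> \<epsilon>"
    let ?G = "\<lambda>x. pos_powr \<nu> x - ?F' t * x"
    have "norm (?G a - ?G b) \<le> \<eta> * norm (a - b)"
    proof (rule field_differentiable_bound[where S = "{t - \<epsilon>..t + \<epsilon>}" and f' = "\<lambda>x. ?F' x - ?F' t"])
      fix x assume x: "x \<in> {t - \<epsilon>..t + \<epsilon>}"
      show "(?G has_field_derivative ?F' x - ?F' t) (at x within {t - \<epsilon>..t + \<epsilon>})"
        by (rule DERIV_subset[OF _ subset_UNIV])
           (auto intro!: derivative_eq_intros pos_powr_has_real_derivative[OF \<nu>])
      have "dist (?F' x) (?F' t) < \<eta>"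
        using t x \<epsilon> by (intro d(2)) (auto simp: dist_real_def abs_le_iff)
      then show "norm (?F' x - ?F' t) \<le> \<eta>" by (simp add: dist_norm)
    qed (use a b in \<open>auto simp: abs_le_iff\<close>)
    then show "\<bar>pos_powr \<nu> a - pos_powr \<nu> b - ?F' t * (a - b)\<bar> \<le> \<eta> * \<bar>a - b\<bar>"
      by (simp add: algebra_simps)
  qed (rule \<epsilon>(1))
qed

lemma space_E_diff:
  assumes "u \<in> space_E R" "v \<in> space_E R"
  shows "(\<lambda>r \<zeta>. u r \<zeta> - v r \<zeta>) \<in> space_E R"
proof -
  have "continuous_on (dom_E R) (\<lambda>(r, \<zeta>). u r \<zeta> - v r \<zeta>)"
    using continuous_on_diff[OF space_E_continuous[OF assms(1)] space_E_continuous[OF assms(2)]]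
    by (simp add: split_beta)
  then show ?thesis
    using assms unfolding space_E_def by (fastforce intro: arg_cong2[where f = minus])
qed

lemma space_E_pos_powr:
  assumes "u \<in> space_E R" "0 < \<nu>"
  shows "(\<lambda>r \<zeta>. pos_powr \<nu> (u r \<zeta>)) \<in> space_E R"
proof -
  have "continuous_on (dom_E R) (\<lambda>(r, \<zeta>). pos_powr \<nu> (u r \<zeta>))"
    using continuous_pos_powr[OF assms(2) space_E_continuous[OF assms(1)]]
    by (simp add: split_beta)
  then show ?thesis
    using assms unfolding space_E_def by (fastforce intro: arg_cong[where f = "pos_powr \<nu>"])
qed

lemma op_K_diff:
  assumes "u \<in> space_E R" "v \<in> space_E R"
  shows "op_K R (\<lambda>r \<zeta>. u r \<zeta> - v r \<zeta>) r \<zeta> = op_K R u r \<zeta> - op_K R v r \<zeta>"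
proof -
  have "source R (\<lambda>r \<zeta>. u r \<zeta> - v r \<zeta>) = (\<lambda>y. source R u y - source R v y)"
    by (auto simp: source_def flat_def fun_eq_iff algebra_simps)
  then show ?thesis
    using potential_diff[OF bounded_source_source[OF assms(1)] bounded_source_source[OF assms(2)]]
    by (simp add: op_K_eq_potential)
qed

lemma norm_E_upper:
  assumes "u \<in> space_E R" "r \<in> {0..R}" "\<zeta> \<in> {-1..1}"
  shows "\<bar>u r \<zeta>\<bar> \<le> norm_E R u"
proof -
  obtain B where B: "0 < B" "\<And>r \<zeta>. r \<in> {0..R} \<Longrightarrow> \<zeta> \<in> {-1..1} \<Longrightarrow> \<bar>u r \<zeta>\<bar> \<le> B"
    using continuous_on_dom_E_bounded[OF space_E_continuous[OF assms(1)]] by blast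
  have "bdd_above ((\<lambda>(r, \<zeta>). \<bar>u r \<zeta>\<bar>) ` dom_E R)"
    by (rule bdd_aboveI[of _ B]) (use B(2) in \<open>auto simp: dom_E_def\<close>)
  from cSUP_upper[OF _ this, of "(r, \<zeta>)"] show ?thesis
    using assms by (simp add: norm_E_def dom_E_def)
qed

lemma solves_distorted_eq:
  assumes "solves_distorted R \<nu> \<beta> u" "r \<in> {0..R}" "\<zeta> \<in> {-1..1}"
  shows "u r \<zeta> = \<beta> / 4 * r\<^sup>2 * (1 - \<zeta>\<^sup>2) +
    (1 + op_K R (\<lambda>s \<eta>. pos_powr \<nu> (u s \<eta>)) r \<zeta> - op_K R (\<lambda>s \<eta>. pos_powr \<nu> (u s \<eta>)) 0 0)"
  using assms by (auto simp: solves_distorted_def op_G_def dom_E_def pos_powr_def)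

text \<open>
  For a radial density the shell theorem reduces the equation \<open>\<Theta> = \<G>(\<Theta>)\<close> to an integral equation on the line.
\<close>

lemma radial_profile_nonrotating:
  assumes R: "0 < R" and \<nu>: "1 < \<nu>" and sol: "solves_distorted R \<nu> 0 u"
    and rad: "\<And>r \<zeta>. r \<in> {0..R} \<Longrightarrow> \<zeta> \<in> {-1..1} \<Longrightarrow> u r \<zeta> = \<theta> r"
  shows "radial_profile R \<nu> \<theta>"
proof
  have u: "u \<in> space_E R" using sol by (simp add: solves_distorted_def)
  have "continuous_on {0..R} (\<lambda>r. (r, 0 :: real))"
    by (intro continuous_intros)
  moreover have "(\<lambda>r. (r, 0)) ` {0..R} \<subseteq> dom_E R"
    by (auto simp: dom_E_def)
  ultimately have "continuous_on {0..R} (\<lambda>r. u r 0)"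
    using continuous_on_compose2[OF space_E_continuous[OF u], of "{0..R}" "\<lambda>r. (r, 0)"] by (simp only: prod.case)
  then show cont: "continuous_on {0..R} \<theta>"
    by (rule continuous_on_eq) (simp add: rad)
  fix r assume r: "r \<in> {0..R}"
  have cf: "continuous_on {0..R} (\<lambda>s. pos_powr \<nu> (\<theta> s))"
    using \<nu> by (intro continuous_pos_powr cont) auto
  define \<phi> where "\<phi> s = indicator {0..R} s * pos_powr \<nu> (\<theta> s)" for s :: real
  have b: "bounded_source R \<phi>"
    unfolding \<phi>_def by (rule bounded_source_cutoff[OF cf])
  have "source R (\<lambda>s \<eta>. pos_powr \<nu> (u s \<eta>)) = (\<lambda>y. \<phi> (norm y))"
    using flat_coordinates[where R = R] rad
    by (auto simp: source_def flat_def \<phi>_def fun_eq_iff indicator_def)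
  then have K: "op_K R (\<lambda>s \<eta>. pos_powr \<nu> (u s \<eta>)) s 0 = (LINT t:{0..R}|lborel. \<phi> t * (t\<^sup>2 / max s t))"
    if "0 \<le> s" for s
    using potential_radial[OF b] norm_axis_point[OF that, of 0] by (simp add: op_K_eq_potential)
  have "u r 0 = 1 + (op_K R (\<lambda>s \<eta>. pos_powr \<nu> (u s \<eta>)) r 0 - op_K R (\<lambda>s \<eta>. pos_powr \<nu> (u s \<eta>)) 0 0)"
    using solves_distorted_eq[OF sol r, of 0] by simp
  also have "op_K R (\<lambda>s \<eta>. pos_powr \<nu> (u s \<eta>)) r 0 - op_K R (\<lambda>s \<eta>. pos_powr \<nu> (u s \<eta>)) 0 0 =
      (LINT t:{0..R}|lborel. \<phi> t * (t\<^sup>2 / max r t) - \<phi> t * (t\<^sup>2 / max 0 t))"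
    using set_integral_diff(2)[OF shell_integral(2)[OF b, of "axis_point r 0"] shell_integral(2)[OF b, of "axis_point 0 0"]] r
    by (simp add: K norm_axis_point)
  also have "\<dots> = (LINT t:{0..r}|lborel. - ((t - t\<^sup>2 / r) * pos_powr \<nu> (\<theta> t)))"
  proof -
    have "indicator {0..R} t *\<^sub>R (\<phi> t * (t\<^sup>2 / max r t) - \<phi> t * (t\<^sup>2 / max 0 t)) =
        indicator {0..r} t *\<^sub>R - ((t - t\<^sup>2 / r) * pos_powr \<nu> (\<theta> t))" for t
      using r by (cases "t = 0") (auto simp: \<phi>_def indicator_def max_def power2_eq_square algebra_simps)
    then show ?thesis unfolding set_lebesgue_integral_def by (simp only:)
  qed
  also have "\<dots> = - integral {0..r} (\<lambda>t. (t - t\<^sup>2 / r) * pos_powr \<nu> (\<theta> t))"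
  proof -
    have "continuous_on {0..r} (\<lambda>t. (t - t\<^sup>2 / r) * pos_powr \<nu> (\<theta> t))"
    proof (cases "r = 0")
      case False
      then show ?thesis
        using r by (intro continuous_intros continuous_on_subset[OF cf]) auto
    qed simp
    then show ?thesis
      by (subst LINT_eq_integral) (auto intro: continuous_on_minus)
  qed
  finally show "\<theta> r = 1 - integral {0..r} (\<lambda>s. (s - s\<^sup>2 / r) * pos_powr \<nu> (\<theta> s))"
    using rad[OF r, of 0] by simp
qed (use R \<nu> in auto)

context radial_profile
begin

text \<open>
  Close to \<open>\<theta>\<close> the linearization error is \<open>\<eta> |w|\<close> with \<open>\<eta>\<close> as small as desired; for \<open>C \<eta> = 1/2\<close>, where \<open>C\<close>
  is the constant of the a priori estimate, it is absorbed.
\<close>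

lemma lipschitz_solutions:
  "\<exists>\<epsilon>>0. \<exists>L>0. \<forall>\<beta> \<beta>' u v. solves_distorted R \<nu> \<beta> u \<longrightarrow> solves_distorted R \<nu> \<beta>' v \<longrightarrow>
     (\<forall>r\<in>{0..R}. \<forall>\<zeta>\<in>{-1..1}. \<bar>u r \<zeta> - \<theta> r\<bar> \<le> \<epsilon> \<and> \<bar>v r \<zeta> - \<theta> r\<bar> \<le> \<epsilon>) \<longrightarrow>
     (\<forall>r\<in>{0..R}. \<forall>\<zeta>\<in>{-1..1}. \<bar>pos_powr \<nu> (u r \<zeta>) - pos_powr \<nu> (v r \<zeta>)\<bar> \<le> L * \<bar>\<beta> - \<beta>'\<bar>)"
proof -
  obtain C where C: "0 < C" and est: "\<And>w u b \<delta> r \<zeta>. linearized b \<delta> w u \<Longrightarrow> r \<in> {0..R} \<Longrightarrow> \<zeta> \<in> {-1..1} \<Longrightarrow>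
      \<bar>w r \<zeta>\<bar> \<le> C * (\<bar>b\<bar> + \<delta>)"
    using a_priori_estimate by blast
  define \<eta> where "\<eta> = 1 / (2 * C)"
  have \<eta>: "0 < \<eta>" using C by (simp add: \<eta>_def)
  obtain B where B: "\<And>s. s \<in> {0..R} \<Longrightarrow> norm (\<theta> s) \<le> B"
    using compact_imp_bounded[OF compact_continuous_image[OF continuous_\<theta>]] unfolding bounded_iff by blast
  obtain \<epsilon> where \<epsilon>: "0 < \<epsilon>" "\<And>t a b. \<bar>t\<bar> \<le> B \<Longrightarrow> \<bar>a - t\<bar> \<le> \<epsilon> \<Longrightarrow> \<bar>b - t\<bar> \<le> \<epsilon> \<Longrightarrow>
    \<bar>pos_powr \<nu> a - pos_powr \<nu> b - \<nu> * pos_powr (\<nu> - 1) t * (a - b)\<bar> \<le> \<eta> * \<bar>a - b\<bar>"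
    using pos_powr_linearization[OF \<nu>_gt_1 \<eta>, of B] by blast
  obtain Q where Q: "1 \<le> Q" "\<And>s. s \<in> {0..R} \<Longrightarrow> q s \<le> Q"
    using q_bound by blast
  define L where "L = (\<eta> + Q) * (2 * C)"
  show ?thesis
  proof (rule exI[of _ \<epsilon>], rule conjI[OF \<epsilon>(1)], rule exI[of _ L], intro conjI allI impI ballI)
    show "0 < L" using \<eta> Q C by (simp add: L_def)
    fix \<beta> \<beta>' u v and r\<^sub>0 \<zeta>\<^sub>0 :: real
    assume u: "solves_distorted R \<nu> \<beta> u" and v: "solves_distorted R \<nu> \<beta>' v"
      and close: "\<forall>r\<in>{0..R}. \<forall>\<zeta>\<in>{-1..1}. \<bar>u r \<zeta> - \<theta> r\<bar> \<le> \<epsilon> \<and> \<bar>v r \<zeta> - \<theta> r\<bar> \<le> \<epsilon>"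
      and r0: "r\<^sub>0 \<in> {0..R}" "\<zeta>\<^sub>0 \<in> {-1..1}"
    define w where "w r \<zeta> = u r \<zeta> - v r \<zeta>" for r \<zeta>
    define x where "x r \<zeta> = pos_powr \<nu> (u r \<zeta>) - pos_powr \<nu> (v r \<zeta>)" for r \<zeta>
    have uE: "u \<in> space_E R" and vE: "v \<in> space_E R"
      using u v by (auto simp: solves_distorted_def)
    have wE: "w \<in> space_E R"
      unfolding w_def by (rule space_E_diff[OF uE vE])
    have FE: "(\<lambda>r \<zeta>. pos_powr \<nu> (u r \<zeta>)) \<in> space_E R" "(\<lambda>r \<zeta>. pos_powr \<nu> (v r \<zeta>)) \<in> space_E R"
      using \<nu>_gt_1 by (auto intro!: space_E_pos_powr uE vE)
    have xE: "x \<in> space_E R"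
      unfolding x_def by (rule space_E_diff[OF FE])
    have xw: "\<bar>x r \<zeta> - q r * w r \<zeta>\<bar> \<le> \<eta> * \<bar>w r \<zeta>\<bar>" if "r \<in> {0..R}" "\<zeta> \<in> {-1..1}" for r \<zeta>
      using \<epsilon>(2)[of "\<theta> r" "u r \<zeta>" "v r \<zeta>"] B[OF that(1)] close that by (simp add: x_def w_def q_def)
    have weq: "w r \<zeta> = (\<beta> - \<beta>') / 4 * r\<^sup>2 * (1 - \<zeta>\<^sup>2) + (op_K R x r \<zeta> - op_K R x 0 0)"
      if "r \<in> {0..R}" "\<zeta> \<in> {-1..1}" for r \<zeta>
      unfolding w_def solves_distorted_eq[OF u that] solves_distorted_eq[OF v that] x_def op_K_diff[OF FE]
      by (simp add: diff_divide_distrib left_diff_distrib)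
    obtain Bw where Bw: "0 < Bw" "\<And>r \<zeta>. r \<in> {0..R} \<Longrightarrow> \<zeta> \<in> {-1..1} \<Longrightarrow> \<bar>w r \<zeta>\<bar> \<le> Bw"
      using continuous_on_dom_E_bounded[OF space_E_continuous[OF wE]] by blast
    have "(\<lambda>(r, \<zeta>). \<bar>w r \<zeta>\<bar>) (r\<^sub>0, \<zeta>\<^sub>0) \<le> (C * \<bar>\<beta> - \<beta>'\<bar>) / (1 - 1/2) * (\<lambda>_. 1) (r\<^sub>0, \<zeta>\<^sub>0)"
    proof (rule contraction_bound[where I = "{0..R} \<times> {-1..1}" and N\<^sub>0 = Bw])
      fix N and i :: "real \<times> real"
      assume N: "0 \<le> N" and i: "i \<in> {0..R} \<times> {-1..1}"
        and IH: "\<And>j. j \<in> {0..R} \<times> {-1..1} \<Longrightarrow> (case j of (r, \<zeta>) \<Rightarrow> \<bar>w r \<zeta>\<bar>) \<le> N * 1"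
      have "linearized (\<beta> - \<beta>') (\<eta> * N) w x"
        unfolding linearized_def
      proof (intro conjI ballI wE xE weq)
        show "0 \<le> \<eta> * N" using \<eta> N by simp
        fix r \<zeta> :: real assume rz: "r \<in> {0..R}" "\<zeta> \<in> {-1..1}"
        have "\<eta> * \<bar>w r \<zeta>\<bar> \<le> \<eta> * N"
          using IH[of "(r, \<zeta>)"] rz \<eta> by (intro mult_left_mono) auto
        then show "\<bar>x r \<zeta> - q r * w r \<zeta>\<bar> \<le> \<eta> * N"
          using xw[OF rz] by linarith
      qed
      from est[OF this] have "(case i of (r, \<zeta>) \<Rightarrow> \<bar>w r \<zeta>\<bar>) \<le> C * (\<bar>\<beta> - \<beta>'\<bar> + \<eta> * N)"
        using i by auto
      also have "\<dots> = (1/2 * N + C * \<bar>\<beta> - \<beta>'\<bar>) * 1"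
        using C by (simp add: \<eta>_def field_simps)
      finally show "(case i of (r, \<zeta>) \<Rightarrow> \<bar>w r \<zeta>\<bar>) \<le> (1/2 * N + C * \<bar>\<beta> - \<beta>'\<bar>) * 1" .
    qed (use Bw C r0 in auto)
    then have w_le: "\<bar>w r\<^sub>0 \<zeta>\<^sub>0\<bar> \<le> 2 * C * \<bar>\<beta> - \<beta>'\<bar>" by simp
    have "\<bar>x r\<^sub>0 \<zeta>\<^sub>0\<bar> \<le> \<bar>x r\<^sub>0 \<zeta>\<^sub>0 - q r\<^sub>0 * w r\<^sub>0 \<zeta>\<^sub>0\<bar> + \<bar>q r\<^sub>0 * w r\<^sub>0 \<zeta>\<^sub>0\<bar>"
      by simp
    also have "\<dots> \<le> \<eta> * \<bar>w r\<^sub>0 \<zeta>\<^sub>0\<bar> + Q * \<bar>w r\<^sub>0 \<zeta>\<^sub>0\<bar>"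
      unfolding abs_mult using xw[OF r0] Q(2)[OF r0(1)] q_nonneg[of r\<^sub>0]
      by (intro add_mono mult_right_mono) auto
    also have "\<dots> = (\<eta> + Q) * \<bar>w r\<^sub>0 \<zeta>\<^sub>0\<bar>" by (simp add: algebra_simps)
    also have "\<dots> \<le> (\<eta> + Q) * (2 * C * \<bar>\<beta> - \<beta>'\<bar>)"
      using w_le \<eta> Q by (intro mult_left_mono) auto
    finally show "\<bar>pos_powr \<nu> (u r\<^sub>0 \<zeta>\<^sub>0) - pos_powr \<nu> (v r\<^sub>0 \<zeta>\<^sub>0)\<bar> \<le> L * \<bar>\<beta> - \<beta>'\<bar>"
      by (simp add: x_def L_def algebra_simps)
  qed
qed

end

text \<open>
  For \<open>h = (\<Theta> \<or> 0)\<^sup>\<nu>\<close> this is the mass up to a factor \<open>2 \<pi>\<close> and the scaling.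
\<close>

definition moment :: "real \<Rightarrow> (real \<Rightarrow> real \<Rightarrow> real) \<Rightarrow> real" where
  "moment R h = integral {-1..1} (\<lambda>\<zeta>. integral {0..R} (\<lambda>r. h r \<zeta> * r\<^sup>2))"

lemma moment_continuity:
  assumes h: "continuous_on (dom_E R) (\<lambda>(r, \<zeta>). h r \<zeta>)"
  shows "\<zeta> \<in> {-1..1} \<Longrightarrow> continuous_on {0..R} (\<lambda>r. h r \<zeta> * r\<^sup>2)"
    and "continuous_on {-1..1} (\<lambda>\<zeta>. integral {0..R} (\<lambda>r. h r \<zeta> * r\<^sup>2))"
proof -
  have 1: "continuous_on ({-1..1} \<times> {0..R}) (\<lambda>x. (snd x, fst x))"
    by (intro continuous_intros)
  have 2: "(\<lambda>x. (snd x, fst x)) ` ({-1..1} \<times> {0..R}) \<subseteq> dom_E R"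
    by (auto simp: dom_E_def)
  have "continuous_on ({-1..1} \<times> {0..R}) (\<lambda>x. h (snd x) (fst x))"
    using continuous_on_compose2[OF h 1 2] by simp
  then have c: "continuous_on ({-1..1} \<times> {0..R}) (\<lambda>(\<zeta>, r). h r \<zeta> * r\<^sup>2)"
    unfolding split_beta by (intro continuous_intros)
  show "continuous_on {0..R} (\<lambda>r. h r \<zeta> * r\<^sup>2)" if "\<zeta> \<in> {-1..1}"
  proof -
    have 1: "continuous_on {0..R} (\<lambda>r. (\<zeta>, r))"
      by (intro continuous_intros)
    have 2: "(\<lambda>r. (\<zeta>, r)) ` {0..R} \<subseteq> {-1..1} \<times> {0..R}"
      using that by auto
    show ?thesis using continuous_on_compose2[OF c 1 2] by simp
  qed
  show "continuous_on {-1..1} (\<lambda>\<zeta>. integral {0..R} (\<lambda>r. h r \<zeta> * r\<^sup>2))"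
    using integral_continuous_on_param[of "{-1..1}" 0 R "\<lambda>\<zeta> r. h r \<zeta> * r\<^sup>2"] c by simp
qed

lemma moment_diff_le:
  assumes h: "continuous_on (dom_E R) (\<lambda>(r, \<zeta>). h r \<zeta>)" and h': "continuous_on (dom_E R) (\<lambda>(r, \<zeta>). h' r \<zeta>)"
    and R: "0 \<le> R" and le: "\<And>r \<zeta>. r \<in> {0..R} \<Longrightarrow> \<zeta> \<in> {-1..1} \<Longrightarrow> \<bar>h r \<zeta> - h' r \<zeta>\<bar> \<le> e"
  shows "\<bar>moment R h - moment R h'\<bar> \<le> 2 * R ^ 3 * e"
proof -
  note c = moment_continuity[OF h] and c' = moment_continuity[OF h']
  have e: "0 \<le> e" using le[of 0 0] R abs_ge_zero order_trans by fastforce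
  have inner: "\<bar>integral {0..R} (\<lambda>r. h r \<zeta> * r\<^sup>2) - integral {0..R} (\<lambda>r. h' r \<zeta> * r\<^sup>2)\<bar> \<le> R ^ 3 * e"
    if \<zeta>: "\<zeta> \<in> {-1..1}" for \<zeta>
  proof -
    have "integral {0..R} (\<lambda>r. h r \<zeta> * r\<^sup>2) - integral {0..R} (\<lambda>r. h' r \<zeta> * r\<^sup>2) =
        integral {0..R} (\<lambda>r. h r \<zeta> * r\<^sup>2 - h' r \<zeta> * r\<^sup>2)"
      using c(1)[OF \<zeta>] c'(1)[OF \<zeta>] by (simp add: integral_diff integrable_continuous_real)
    also have "norm \<dots> \<le> (e * R\<^sup>2) * (R - 0)"
    proof (rule integral_bound)
      show "continuous_on {0..R} (\<lambda>r. h r \<zeta> * r\<^sup>2 - h' r \<zeta> * r\<^sup>2)"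
        using c(1)[OF \<zeta>] c'(1)[OF \<zeta>] by (intro continuous_on_diff)
      fix r assume r: "r \<in> {0..R}"
      have "h r \<zeta> * r\<^sup>2 - h' r \<zeta> * r\<^sup>2 = (h r \<zeta> - h' r \<zeta>) * r\<^sup>2" by (simp add: algebra_simps)
      then show "norm (h r \<zeta> * r\<^sup>2 - h' r \<zeta> * r\<^sup>2) \<le> e * R\<^sup>2"
        using le[OF r \<zeta>] r e by (auto simp: abs_mult intro!: mult_mono power_mono)
    qed (use R in auto)
    finally show ?thesis by (simp add: power2_eq_square power3_eq_cube mult_ac)
  qed
  have "moment R h - moment R h' = integral {-1..1} (\<lambda>\<zeta>. integral {0..R} (\<lambda>r. h r \<zeta> * r\<^sup>2) - integral {0..R} (\<lambda>r. h' r \<zeta> * r\<^sup>2))"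
    unfolding moment_def using c(2) c'(2) by (simp add: integral_diff integrable_continuous_real)
  also have "norm \<dots> \<le> (R ^ 3 * e) * (1 - (-1))"
    using c(2) c'(2) inner by (intro integral_bound continuous_on_diff) auto
  finally show ?thesis by (simp add: mult_ac)
qed

lemma (in radial_profile) moment_radial_pos:
  assumes "\<And>r \<zeta>. r \<in> {0..R} \<Longrightarrow> \<zeta> \<in> {-1..1} \<Longrightarrow> u r \<zeta> = \<theta> r"
  shows "0 < moment R (\<lambda>r \<zeta>. pos_powr \<nu> (u r \<zeta>))"
proof -
  have "integral {0..R} (\<lambda>r. pos_powr \<nu> (u r \<zeta>) * r\<^sup>2) = mass_in R" if "\<zeta> \<in> {-1..1}" for \<zeta>
    unfolding mass_in_def f_def using that assms by (intro integral_cong) auto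
  then have "moment R (\<lambda>r \<zeta>. pos_powr \<nu> (u r \<zeta>)) = integral {-1..1} (\<lambda>\<zeta> :: real. mass_in R)"
    unfolding moment_def by (intro integral_cong) auto
  also have "\<dots> = 2 * mass_in R" by simp
  finally have eq: "moment R (\<lambda>r \<zeta>. pos_powr \<nu> (u r \<zeta>)) = 2 * mass_in R" .
  obtain c where c: "0 < c" "\<And>r. r \<in> {0..R} \<Longrightarrow> c * r \<le> p r"
    using p_lower by blast
  have "0 < p R" using c(2)[of R] R_pos mult_pos_pos[OF c(1) R_pos] by (auto intro: order_less_le_trans)
  then show ?thesis
    using R_pos by (simp add: eq p_def zero_less_divide_iff)
qed

lemma total_mass_scaling:
  assumes "0 < A" "0 < G" "1 < \<gamma>" "0 < \<rho>" and u: "\<Theta> (rot_param G \<Omega> \<rho>) \<in> space_E R" and R: "0 \<le> R"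
  shows "total_mass R \<Theta> A G \<gamma> \<Omega> \<rho> =
    2 * pi * sqrt (A * \<gamma> / (4 * pi * G * (\<gamma> - 1))) ^ 3 *
      (\<rho> powr ((3 * \<gamma> - 4) / 2) * moment R (\<lambda>r \<zeta>. pos_powr (1 / (\<gamma> - 1)) (\<Theta> (rot_param G \<Omega> \<rho>) r \<zeta>)))"
proof -
  define S a \<nu> v where "S = sqrt (A * \<gamma> / (4 * pi * G * (\<gamma> - 1)))" and "a = length_scale A G \<gamma> \<rho>"
    and "\<nu> = 1 / (\<gamma> - 1)" and "v = \<Theta> (rot_param G \<Omega> \<rho>)"
  have S: "0 < S" using assms by (simp add: S_def)
  have aeq: "a = S * \<rho> powr (- (2 - \<gamma>) / 2)"
    by (simp add: a_def S_def length_scale_def)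
  have a: "0 < a" using S assms by (simp add: aeq)
  have \<nu>: "0 < \<nu>" using assms by (simp add: \<nu>_def)
  have c: "continuous_on (dom_E R) (\<lambda>(r, \<zeta>). pos_powr \<nu> (v r \<zeta>))"
    using \<nu> u by (intro space_E_continuous space_E_pos_powr) (auto simp: v_def)
  have inner: "(LINT r:{0..}|lborel. density R \<Theta> A G \<gamma> \<Omega> \<rho> r \<zeta> * r\<^sup>2) =
      \<rho> * a ^ 3 * integral {0..R} (\<lambda>r. pos_powr \<nu> (v r \<zeta>) * r\<^sup>2)" if \<zeta>: "\<zeta> \<in> {-1..1}" for \<zeta>
  proof -
    let ?g = "\<lambda>r. indicator {0..} r *\<^sub>R (density R \<Theta> A G \<gamma> \<Omega> \<rho> r \<zeta> * r\<^sup>2)"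
    have g: "?g (0 + a * r) = \<rho> * a\<^sup>2 * (indicator {0..R} r *\<^sub>R (pos_powr \<nu> (v r \<zeta>) * r\<^sup>2))" for r
      using a \<nu> by (auto simp: density_def pos_part_ext_def pos_powr_def a_def[symmetric] v_def[symmetric] \<nu>_def[symmetric]
          indicator_def power_mult_distrib zero_le_mult_iff)
    have "(LINT r:{0..}|lborel. density R \<Theta> A G \<gamma> \<Omega> \<rho> r \<zeta> * r\<^sup>2) = \<bar>a\<bar> *\<^sub>R (LINT r|lborel. ?g (0 + a * r))"
      unfolding set_lebesgue_integral_def using a by (intro lborel_integral_real_affine) auto
    also have "\<dots> = \<rho> * a ^ 3 * (LINT r:{0..R}|lborel. pos_powr \<nu> (v r \<zeta>) * r\<^sup>2)"
      unfolding g set_lebesgue_integral_def using a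
      by (subst integral_mult_right_zero) (simp add: power2_eq_square power3_eq_cube)
    also have "(LINT r:{0..R}|lborel. pos_powr \<nu> (v r \<zeta>) * r\<^sup>2) = integral {0..R} (\<lambda>r. pos_powr \<nu> (v r \<zeta>) * r\<^sup>2)"
      by (rule LINT_eq_integral[OF moment_continuity(1)[OF c \<zeta>]])
    finally show ?thesis .
  qed
  have "(LINT \<zeta>:{-1..1}|lborel. (LINT r:{0..}|lborel. density R \<Theta> A G \<gamma> \<Omega> \<rho> r \<zeta> * r\<^sup>2)) =
      (LINT \<zeta>:{-1..1}|lborel. \<rho> * a ^ 3 * integral {0..R} (\<lambda>r. pos_powr \<nu> (v r \<zeta>) * r\<^sup>2))"
    using inner by (intro set_lebesgue_integral_cong) auto
  also have "\<dots> = \<rho> * a ^ 3 * moment R (\<lambda>r \<zeta>. pos_powr \<nu> (v r \<zeta>))"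
    using moment_continuity(2)[OF c] by (simp add: LINT_eq_integral moment_def)
  also have "\<rho> * a ^ 3 = S ^ 3 * \<rho> powr ((3 * \<gamma> - 4) / 2)"
  proof -
    have "(\<rho> powr (- (2 - \<gamma>) / 2)) ^ 3 = \<rho> powr (- (3 * (2 - \<gamma>)) / 2)"
      using assms by (simp add: powr_power)
    then have "\<rho> * a ^ 3 = S ^ 3 * (\<rho> powr 1 * \<rho> powr (- (3 * (2 - \<gamma>)) / 2))"
      using assms by (simp add: aeq power_mult_distrib)
    also have "\<rho> powr 1 * \<rho> powr (- (3 * (2 - \<gamma>)) / 2) = \<rho> powr ((3 * \<gamma> - 4) / 2)"
      unfolding powr_add[symmetric] by (simp add: field_simps)
    finally show ?thesis .
  qed
  finally show ?thesis
    by (simp add: total_mass_def S_def \<nu>_def v_def mult_ac)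
qed

text \<open>
  The hypothesis \<open>\<beta> * \<rho> = \<beta>' * \<rho>'\<close> expresses that both configurations rotate equally fast. With
  \<open>t = (\<rho>' - \<rho>) / \<rho>'\<close> one has \<open>ln \<rho>' - ln \<rho> \<ge> t\<close> and \<open>\<beta> - \<beta>' = \<beta> t\<close>, so the power of the density
  dominates.
\<close>

lemma mass_density_injective:
  fixes \<rho> \<rho>' \<beta> \<beta>' :: real
  assumes \<rho>: "0 < \<rho>" "\<rho> < \<rho>'" and \<beta>: "\<beta> * \<rho> = \<beta>' * \<rho>'" "0 \<le> \<beta>" "\<beta> \<le> \<beta>\<^sub>0"
    and m: "0 < \<mu>" "\<mu> \<le> m" "\<mu> \<le> m'" and lip: "\<bar>m - m'\<bar> \<le> L * \<bar>\<beta> - \<beta>'\<bar>" "0 \<le> L"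
    and small: "L * \<beta>\<^sub>0 < \<bar>k\<bar> * \<mu>"
  shows "\<rho> powr k * m \<noteq> \<rho>' powr k * m'"
proof
  assume eq: "\<rho> powr k * m = \<rho>' powr k * m'"
  define t where "t = (\<rho>' - \<rho>) / \<rho>'"
  have t: "0 < t" using \<rho> by (simp add: t_def)
  have ln_diff: "\<bar>ln x - ln y\<bar> \<le> \<bar>x - y\<bar> / \<mu>" if "\<mu> \<le> x" "\<mu> \<le> y" for x y
  proof -
    have *: "ln x - ln y \<le> \<bar>x - y\<bar> / \<mu>" if "\<mu> \<le> x" "\<mu> \<le> y" for x y
    proof -
      have "ln x - ln y = ln (x / y)" using that m(1) by (simp add: ln_div)
      also have "\<dots> \<le> x / y - 1" using that m(1) by (intro ln_le_minus_one) auto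
      also have "\<dots> = (x - y) / y" using that m(1) by (simp add: field_simps)
      also have "\<dots> \<le> \<bar>x - y\<bar> / \<mu>"
        using that m(1) by (intro frac_le) auto
      finally show ?thesis .
    qed
    show ?thesis using *[OF that] *[OF that(2,1)] by (simp add: abs_le_iff abs_minus_commute)
  qed
  have "ln (\<rho> powr k * m) = k * ln \<rho> + ln m" "ln (\<rho>' powr k * m') = k * ln \<rho>' + ln m'"
    using \<rho> m by (auto simp: ln_mult ln_powr)
  then have "k * (ln \<rho>' - ln \<rho>) = ln m - ln m'"
    using eq by (simp add: algebra_simps)
  then have "\<bar>k\<bar> * \<bar>ln \<rho>' - ln \<rho>\<bar> = \<bar>ln m - ln m'\<bar>"
    by (metis abs_mult)
  also have "\<dots> \<le> L * \<bar>\<beta> - \<beta>'\<bar> / \<mu>"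
    using ln_diff[OF m(2,3)] divide_right_mono[OF lip(1), of \<mu>] m(1) by linarith
  also have "\<bar>\<beta> - \<beta>'\<bar> = \<beta> * t"
  proof -
    have "\<beta>' = \<beta> * \<rho> / \<rho>'" using \<beta>(1) \<rho> by (simp add: field_simps)
    then have "\<beta> - \<beta>' = \<beta> * t" using \<rho> by (simp add: t_def field_simps)
    then show ?thesis using \<beta> t by simp
  qed
  also have "L * (\<beta> * t) / \<mu> \<le> L * (\<beta>\<^sub>0 * t) / \<mu>"
    using \<beta> lip(2) t m(1) by (intro divide_right_mono mult_left_mono mult_right_mono) auto
  finally have le: "\<bar>k\<bar> * \<bar>ln \<rho>' - ln \<rho>\<bar> \<le> L * \<beta>\<^sub>0 / \<mu> * t" by (simp add: mult_ac)
  have "ln (\<rho> / \<rho>') \<le> \<rho> / \<rho>' - 1" using \<rho> by (intro ln_le_minus_one) auto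
  then have "t \<le> ln \<rho>' - ln \<rho>"
    using \<rho> by (simp add: t_def ln_div diff_divide_distrib)
  then have "\<bar>k\<bar> * t \<le> \<bar>k\<bar> * \<bar>ln \<rho>' - ln \<rho>\<bar>"
    by (intro mult_left_mono) auto
  with le have "\<bar>k\<bar> * t \<le> L * \<beta>\<^sub>0 / \<mu> * t" by linarith
  then have "\<bar>k\<bar> * \<mu> \<le> L * \<beta>\<^sub>0"
    using t m(1) by (simp add: le_divide_eq)
  with small show False by linarith
qed

theorem theorem5:
  fixes A G \<gamma> \<nu> \<xi>\<^sub>1 R \<beta>\<^sub>1 :: real
    and \<theta> :: "real \<Rightarrow> real"
    and \<Theta> :: "real \<Rightarrow> real \<Rightarrow> real \<Rightarrow> real"
  assumes "0 < A" and "0 < G"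
    and "6 / 5 < \<gamma>" and "\<gamma> < 2" and "\<gamma> \<noteq> 4 / 3"
    and "\<nu> = 1 / (\<gamma> - 1)"
    and "lane_emden \<nu> \<theta> \<xi>\<^sub>1"
    and "\<xi>\<^sub>1 < R"
    and "distorted_lane_emden R \<nu> \<theta> \<beta>\<^sub>1 \<Theta>"
  shows "\<exists>\<beta>\<^sub>0>0. \<beta>\<^sub>0 \<le> \<beta>\<^sub>1 \<and>
    (\<forall>\<Omega> \<rho>\<^sub>O \<rho>\<^sub>O'. 0 < \<rho>\<^sub>O \<longrightarrow> 0 < \<rho>\<^sub>O' \<longrightarrow>
       rot_param G \<Omega> \<rho>\<^sub>O \<le> \<beta>\<^sub>0 \<longrightarrow> rot_param G \<Omega> \<rho>\<^sub>O' \<le> \<beta>\<^sub>0 \<longrightarrow>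
       total_mass R \<Theta> A G \<gamma> \<Omega> \<rho>\<^sub>O = total_mass R \<Theta> A G \<gamma> \<Omega> \<rho>\<^sub>O' \<longrightarrow>
       \<rho>\<^sub>O = \<rho>\<^sub>O')"
proof -
  have R: "0 < R" using assms by (auto simp: lane_emden_def)
  have \<nu>: "1 < \<nu>" using assms by simp
  have \<beta>1: "0 < \<beta>\<^sub>1" and sol: "\<And>\<beta>. \<beta> \<in> {0..\<beta>\<^sub>1} \<Longrightarrow> solves_distorted R \<nu> \<beta> (\<Theta> \<beta>)"
    and lim: "\<And>\<beta>. \<beta> \<in> {0..\<beta>\<^sub>1} \<Longrightarrow> ((\<lambda>\<beta>'. dist_E R (\<Theta> \<beta>') (\<Theta> \<beta>)) \<longlongrightarrow> 0) (at \<beta> within {0..\<beta>\<^sub>1})"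
    and \<Theta>0: "\<forall>(r, \<zeta>)\<in>dom_E R. \<Theta> 0 r \<zeta> = \<theta> r"
    using assms(9) unfolding distorted_lane_emden_def by blast+
  have rad: "\<Theta> 0 r \<zeta> = \<theta> r" if "r \<in> {0..R}" "\<zeta> \<in> {-1..1}" for r \<zeta>
    using \<Theta>0 that by (auto simp: dom_E_def)
  interpret radial_profile R \<nu> \<theta>
    using radial_profile_nonrotating[OF R \<nu> sol rad] \<beta>1 by auto
  have E: "\<Theta> \<beta> \<in> space_E R" if "\<beta> \<in> {0..\<beta>\<^sub>1}" for \<beta>
    using sol[OF that] by (simp add: solves_distorted_def)
  obtain \<epsilon> L where \<epsilon>: "0 < \<epsilon>" and L: "0 < L" and lip: "\<And>\<beta> \<beta>' u v r \<zeta>. solves_distorted R \<nu> \<beta> u \<Longrightarrow>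
      solves_distorted R \<nu> \<beta>' v \<Longrightarrow> \<forall>r\<in>{0..R}. \<forall>\<zeta>\<in>{-1..1}. \<bar>u r \<zeta> - \<theta> r\<bar> \<le> \<epsilon> \<and> \<bar>v r \<zeta> - \<theta> r\<bar> \<le> \<epsilon> \<Longrightarrow>
      r \<in> {0..R} \<Longrightarrow> \<zeta> \<in> {-1..1} \<Longrightarrow> \<bar>pos_powr \<nu> (u r \<zeta>) - pos_powr \<nu> (v r \<zeta>)\<bar> \<le> L * \<bar>\<beta> - \<beta>'\<bar>"
    using lipschitz_solutions by metis
  obtain d where d: "0 < d" "\<And>\<beta>. \<beta> \<in> {0..\<beta>\<^sub>1} \<Longrightarrow> \<beta> \<noteq> 0 \<Longrightarrow> \<beta> < d \<Longrightarrow> dist_E R (\<Theta> \<beta>) (\<Theta> 0) < \<epsilon>"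
  proof -
    have "0 \<in> {0..\<beta>\<^sub>1}" using \<beta>1 by simp
    from order_tendstoD(2)[OF lim[OF this] \<epsilon>] show thesis
      using that unfolding eventually_at by (auto simp: dist_real_def)
  qed
  have close: "\<bar>\<Theta> \<beta> r \<zeta> - \<theta> r\<bar> \<le> \<epsilon>" if \<beta>: "\<beta> \<in> {0..\<beta>\<^sub>1}" "\<beta> < d" and r: "r \<in> {0..R}" "\<zeta> \<in> {-1..1}" for \<beta> r \<zeta>
  proof (cases "\<beta> = 0")
    case True
    then show ?thesis using rad[OF r] \<epsilon> by simp
  next
    case False
    have "0 \<in> {0..\<beta>\<^sub>1}" using \<beta>1 by simp
    from norm_E_upper[OF space_E_diff[OF E[OF \<beta>(1)] E[OF this]] r] d(2)[OF \<beta>(1) False \<beta>(2)]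
    show ?thesis by (simp add: dist_E_def rad[OF r])
  qed
  define m where "m \<beta> = moment R (\<lambda>r \<zeta>. pos_powr \<nu> (\<Theta> \<beta> r \<zeta>))" for \<beta>
  define L' where "L' = 2 * R ^ 3 * L"
  have L': "0 < L'" using L R by (simp add: L'_def)
  have m_lip: "\<bar>m \<beta> - m \<beta>'\<bar> \<le> L' * \<bar>\<beta> - \<beta>'\<bar>"
    if \<beta>: "\<beta> \<in> {0..\<beta>\<^sub>1}" "\<beta> < d" "\<beta>' \<in> {0..\<beta>\<^sub>1}" "\<beta>' < d" for \<beta> \<beta>'
  proof -
    have "\<bar>m \<beta> - m \<beta>'\<bar> \<le> 2 * R ^ 3 * (L * \<bar>\<beta> - \<beta>'\<bar>)"
      unfolding m_def
    proof (rule moment_diff_le)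
      show "continuous_on (dom_E R) (\<lambda>(r, \<zeta>). pos_powr \<nu> (\<Theta> \<beta> r \<zeta>))"
        "continuous_on (dom_E R) (\<lambda>(r, \<zeta>). pos_powr \<nu> (\<Theta> \<beta>' r \<zeta>))"
        using \<nu> by (intro space_E_continuous space_E_pos_powr E \<beta>; simp)+
      show "\<bar>pos_powr \<nu> (\<Theta> \<beta> r \<zeta>) - pos_powr \<nu> (\<Theta> \<beta>' r \<zeta>)\<bar> \<le> L * \<bar>\<beta> - \<beta>'\<bar>"
        if "r \<in> {0..R}" "\<zeta> \<in> {-1..1}" for r \<zeta>
        using close \<beta> by (intro lip[OF sol sol _ that]) auto
    qed (use R in simp)
    then show ?thesis by (simp add: L'_def mult.assoc)
  qed
  have m0: "0 < m 0"
    unfolding m_def using rad by (rule moment_radial_pos)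
  define k where "k = (3 * \<gamma> - 4) / 2"
  have k: "k \<noteq> 0" using assms by (simp add: k_def)
  define \<mu> where "\<mu> = m 0 / 2"
  have \<mu>: "0 < \<mu>" using m0 by (simp add: \<mu>_def)
  \<comment> \<open>The second entry keeps \<open>\<Theta> \<beta>\<close> in the range of the Lipschitz estimate, the third gives \<open>m \<beta> \<ge> \<mu>\<close>, and the
    last one is the smallness condition of \<open>mass_density_injective\<close>.\<close>
  define \<beta>\<^sub>0 where "\<beta>\<^sub>0 = Min {\<beta>\<^sub>1, d / 2, \<mu> / L', \<bar>k\<bar> * \<mu> / (2 * L')}"
  have \<beta>0: "0 < \<beta>\<^sub>0" "\<beta>\<^sub>0 \<le> \<beta>\<^sub>1" "\<beta>\<^sub>0 \<le> d / 2" "\<beta>\<^sub>0 \<le> \<mu> / L'" "\<beta>\<^sub>0 \<le> \<bar>k\<bar> * \<mu> / (2 * L')"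
  proof -
    show "0 < \<beta>\<^sub>0" using \<beta>1 d(1) \<mu> L' k unfolding \<beta>\<^sub>0_def by auto
    show "\<beta>\<^sub>0 \<le> \<beta>\<^sub>1" "\<beta>\<^sub>0 \<le> d / 2" "\<beta>\<^sub>0 \<le> \<mu> / L'" "\<beta>\<^sub>0 \<le> \<bar>k\<bar> * \<mu> / (2 * L')"
      unfolding \<beta>\<^sub>0_def by (rule Min_le; simp)+
  qed
  have small: "L' * \<beta>\<^sub>0 < \<bar>k\<bar> * \<mu>"
  proof -
    have "L' * \<beta>\<^sub>0 \<le> \<bar>k\<bar> * \<mu> / 2" using \<beta>0(5) L' by (simp add: field_simps)
    also have "\<dots> < \<bar>k\<bar> * \<mu>" using k \<mu> by simp
    finally show ?thesis .
  qed
  have in_range: "\<beta> \<in> {0..\<beta>\<^sub>1} \<and> \<beta> < d" if "0 \<le> \<beta>" "\<beta> \<le> \<beta>\<^sub>0" for \<beta>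
    using that \<beta>0 d(1) by auto
  have m_ge: "\<mu> \<le> m \<beta>" if "0 \<le> \<beta>" "\<beta> \<le> \<beta>\<^sub>0" for \<beta>
  proof -
    have "\<bar>m \<beta> - m 0\<bar> \<le> L' * \<beta>"
      using m_lip[of \<beta> 0] in_range[OF that] in_range[of 0] that \<beta>0 by simp
    also have "\<dots> \<le> \<mu>"
    proof -
      have "L' * \<beta> \<le> L' * (\<mu> / L')" using that \<beta>0(4) L' by (intro mult_left_mono) auto
      then show ?thesis using L' by simp
    qed
    finally show ?thesis
      using abs_ge_minus_self[of "m \<beta> - m 0"] unfolding \<mu>_def by linarith
  qed
  define P where "P = 2 * pi * sqrt (A * \<gamma> / (4 * pi * G * (\<gamma> - 1))) ^ 3"
  have P: "P \<noteq> 0" using assms by (simp add: P_def)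
  have rot: "0 \<le> rot_param G \<Omega> \<rho>" "rot_param G \<Omega> \<rho> * \<rho> = \<Omega>\<^sup>2 / (2 * pi * G)" if "0 < \<rho>" for \<Omega> \<rho>
    using that assms by (auto simp: rot_param_def)
  have mass: "total_mass R \<Theta> A G \<gamma> \<Omega> \<rho> = P * (\<rho> powr k * m (rot_param G \<Omega> \<rho>))"
    if "0 < \<rho>" "rot_param G \<Omega> \<rho> \<le> \<beta>\<^sub>0" for \<Omega> \<rho>
    unfolding P_def k_def m_def assms(6)
    using that assms R rot(1)[OF that(1)] in_range
    by (intro total_mass_scaling E) auto
  have no_smaller: False
    if "0 < \<rho>" "\<rho> < \<rho>'" "rot_param G \<Omega> \<rho> \<le> \<beta>\<^sub>0" "rot_param G \<Omega> \<rho>' \<le> \<beta>\<^sub>0"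
      "total_mass R \<Theta> A G \<gamma> \<Omega> \<rho> = total_mass R \<Theta> A G \<gamma> \<Omega> \<rho>'" for \<rho> \<rho>' \<Omega>
  proof -
    let ?\<beta> = "rot_param G \<Omega> \<rho>" and ?\<beta>' = "rot_param G \<Omega> \<rho>'"
    have \<rho>': "0 < \<rho>'" using that by simp
    note nn = rot(1)[OF that(1)] rot(1)[OF \<rho>']
    have "\<rho> powr k * m ?\<beta> \<noteq> \<rho>' powr k * m ?\<beta>'"
      using that rot[OF that(1)] rot[OF \<rho>'] nn m_ge in_range m_lip \<mu> L' small
      by (intro mass_density_injective[where \<beta> = ?\<beta> and \<beta>' = ?\<beta>' and L = L' and \<mu> = \<mu> and \<beta>\<^sub>0 = \<beta>\<^sub>0]) auto
    then show False
      using that(5) mass[OF that(1,3)] mass[OF \<rho>' that(4)] P by simp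
  qed
  show ?thesis
  proof (intro exI[of _ \<beta>\<^sub>0] conjI allI impI)
    fix \<Omega> \<rho> \<rho>'
    assume "0 < \<rho>" "0 < \<rho>'" "rot_param G \<Omega> \<rho> \<le> \<beta>\<^sub>0" "rot_param G \<Omega> \<rho>' \<le> \<beta>\<^sub>0"
      "total_mass R \<Theta> A G \<gamma> \<Omega> \<rho> = total_mass R \<Theta> A G \<gamma> \<Omega> \<rho>'"
    then show "\<rho> = \<rho>'"
      using no_smaller[of \<rho> \<rho>' \<Omega>] no_smaller[of \<rho>' \<rho> \<Omega>] by (metis linorder_neqE_linordered_idom)
  qed (use \<beta>0 in auto)
qed

end
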